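(* Let $M$ be a finite-dimensional smooth parallelizable manifold with a trivialization $\Phi:M\times V\to TM$, where $V$ is a finite-dimensional real vector space, let $T>0$, let $H:[0,T]\times T^*M\to\mathbb{R}$ be smooth with trivialized Hamiltonian $h:[0,T]\times M\times V^*\to\mathbb{R}$, $h(t,q,\mu)=H(t,q,\Phi(q)^{-*}\mu)$, and fix $q_0\in M$ and $\mu_1\in V^*$. Let $(q,\mu)\in C^1_{q_0}([0,T],M\times V^* )$, i.e. $(q,\mu):[0,T]\to M\times V^*$ is a $C^1$ curve with $q(0)=q_0$. Then the Type II d'Alembert variational principle $$\delta s[q,\mu]=\langle\mu_1,\eta(T)\rangle\quad\text{for all trivialized partial variations }(\eta,\delta\mu)\text{ of }(q,\mu)$$ holds if and only if the Hamel equations on $M\times V^*$ with trivialized Type II boundary conditions hold: $$\dot q(t)=\Phi(q)D_\mu h(t,q,\mu)\quad\text{for all }t\in(0,T),$$ $$\dot\mu(t)=\mathrm{ad}^*_\xi\mu-\Phi(q)^*D_qh(t,q,\mu)\quad\text{for all }t\in(0,T),$$ $$q(0)=q_0,\qquad\mu(T)=\mu_1,$$ where $\xi:=\Phi(q)^{-1}\dot q$ is the trivialized velocity.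
   Context: Trivialization: $\Phi:M\times V\to TM$ is a diffeomorphism such that for every $q\in M$ the map $\Phi(q):=\Phi(q,\cdot):V\to T_qM$ is a linear isomorphism onto $T_qM$. Its inverse is $\Phi(q)^{-1}:T_qM\to V$; its dual is $\Phi(q)^*:T_q^*M\to V^*$, and $\Phi(q)^{-*}:=(\Phi(q)^{-1})^*:V^*\to T_q^*M$. $\langle\cdot,\cdot\rangle$ denotes the duality pairing (on $V^*\times V$ or $T^*_qM\times T_qM$). $D_qh(t,q,\mu)\in T_q^*M$ and $D_\mu h(t,q,\mu)\in V$ are the partial derivatives of $h$ on the product $[0,T]\times M\times V^*$. Derivative of $\Phi$: in local coordinates $q=(q^i)$ on $M$ (with the induced identification of tangent spaces with a fixed vector space), $\Phi(q):V\to T_qM$ is represented by a matrix depending on $q$, and for $v\in T_qM$, $D\Phi(q)\cdot v:V\to T_qM$ is the linear map whose matrix is the directional derivative $v^l\,\partial\Phi(q)/\partial q^l$; its value on $w\in V$ is written $D\Phi(q)\cdot v\cdot w$. Bracket: for $u,v\in V$ and $q\in M$, define $$[u,v]_q:=\Phi(q)^{-1}\,D\Phi(q)\cdot\Phi(q)u\cdot v-\Phi(q)^{-1}\,D\Phi(q)\cdot\Phi(q)v\cdot u\ \in V.$$ (This equals $\Phi(q)^{-1}$ applied to the value at $q$ of the Lie bracket of the vector fields $x\mapsto\Phi(x)u$ and $x\mapsto\Phi(x)v$, hence does not depend on the coordinates.) For $\xi\in V$, along the curve, $\mathrm{ad}^*_\xi:V^*\to V^*$ is the adjoint of $[\xi,\cdot]_q$,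 i.e. $\langle\mathrm{ad}^*_\xi\alpha,v\rangle=\langle\alpha,[\xi,v]_q\rangle$ for all $\alpha\in V^*$, $v\in V$. Curves, action and variations: $C^1_{q_0}([0,T],M\times V^* )=\{(q,\mu)\in C^1([0,T],M\times V^* ):q(0)=q_0\}$, and the trivialized action on this space is $$s[q,\mu]=\int_0^T\big[\langle\mu,\Phi(q)^{-1}\dot q\rangle-h(t,q,\mu)\big]\,dt.$$ A trivialized partial variation of $(q,\mu)$ is a pair $(\eta,\delta\mu)\in C^1([0,T],V\times V^* )$ with $\eta(0)=0$; it corresponds to the variation $(\delta q,\delta\mu)$ with $\delta q=\Phi(q)\eta$. The variation of the action is $\delta s[q,\mu]=\frac{d}{d\epsilon}\big|_{\epsilon=0}s[q_\epsilon,\mu_\epsilon]$, where $(q_\epsilon,\mu_\epsilon)$ is a one-parameter family of curves in $C^1_{q_0}([0,T],M\times V^* )$ through $(q,\mu)$ at $\epsilon=0$ with $\frac{d}{d\epsilon}|_{\epsilon=0}q_\epsilon=\Phi(q)\eta$ and $\frac{d}{d\epsilon}|_{\epsilon=0}\mu_\epsilon=\delta\mu$. *)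

theory Defs
  imports "HOL-Analysis.Analysis"
begin

section \<open>Smooth functions on subsets of normed spaces\<close>

fun Ck_on :: "nat \<Rightarrow> 'a::real_normed_vector set \<Rightarrow> ('a \<Rightarrow> 'b::real_normed_vector) \<Rightarrow> bool" where
  "Ck_on 0 S f \<longleftrightarrow> continuous_on S f"
| "Ck_on (Suc k) S f \<longleftrightarrow>
     (\<forall>x\<in>S. f differentiable (at x)) \<and> (\<forall>v. Ck_on k S (\<lambda>x. frechet_derivative f (at x) v))"

text \<open>
  \<^const>\<open>Ck_on\<close> is meant for open sets and finite-dimensional domains, where continuity of
  all iterated directional derivatives gives continuous differentiability. On an arbitrary set
  (such as a closed time interval times an open set) a function is smooth if it locally extends
  to a smooth function on an open set.
\<close>

definition smooth_on :: "'a::real_normed_vector set \<Rightarrow> ('a \<Rightarrow> 'b::real_normed_vector) \<Rightarrow> bool" where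
  "smooth_on S f \<longleftrightarrow>
     (\<forall>x\<in>S. \<exists>U g. open U \<and> x \<in> U \<and> (\<forall>k. Ck_on k U g) \<and> (\<forall>y\<in>U \<inter> S. g y = f y))"


section \<open>Smooth manifolds\<close>

text \<open>
  A chart is a pair of its domain and its coordinate map. A manifold is given by an atlas: its
  point set is the union of the chart domains, and its topology is the one that makes the charts
  homeomorphisms onto open sets.
\<close>

type_synonym ('m, 'e) chart = "'m set \<times> ('m \<Rightarrow> 'e)"

abbreviation chart_inv :: "('m, 'e) chart \<Rightarrow> 'e \<Rightarrow> 'm" where
  "chart_inv c \<equiv> inv_into (fst c) (snd c)"

definition points :: "('m, 'e) chart set \<Rightarrow> 'm set" where
  "points A = (\<Union>c\<in>A. fst c)"

definition atlas_topology :: "('m, 'e::real_normed_vector) chart set \<Rightarrow> 'm topology" where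
  "atlas_topology A =
     topology (\<lambda>W. W \<subseteq> points A \<and> (\<forall>c\<in>A. open (snd c ` (W \<inter> fst c))))"

definition smooth_atlas :: "('m, 'e::real_normed_vector) chart set \<Rightarrow> bool" where
  "smooth_atlas A \<longleftrightarrow>
     (\<forall>c\<in>A. inj_on (snd c) (fst c)) \<and>
     (\<forall>c\<in>A. \<forall>d\<in>A. open (snd c ` (fst c \<inter> fst d)) \<and>
        smooth_on (snd c ` (fst c \<inter> fst d)) (snd d \<circ> chart_inv c))"

definition smooth_manifold :: "('m, 'e::real_normed_vector) chart set \<Rightarrow> bool" where
  "smooth_manifold A \<longleftrightarrow>
     smooth_atlas A \<and> Hausdorff_space (atlas_topology A) \<and> second_countable (atlas_topology A)"

definition smooth_map ::
  "('m, 'e::real_normed_vector) chart set \<Rightarrow> ('n, 'f::real_normed_vector) chart set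
    \<Rightarrow> ('m \<Rightarrow> 'n) \<Rightarrow> bool" where
  "smooth_map A B f \<longleftrightarrow>
     continuous_map (atlas_topology A) (atlas_topology B) f \<and>
     (\<forall>c\<in>A. \<forall>d\<in>B. smooth_on (snd c ` {p \<in> fst c. f p \<in> fst d}) (snd d \<circ> f \<circ> chart_inv c))"

definition diffeomorphism ::
  "('m, 'e::real_normed_vector) chart set \<Rightarrow> ('n, 'f::real_normed_vector) chart set
    \<Rightarrow> ('m \<Rightarrow> 'n) \<Rightarrow> bool" where
  "diffeomorphism A B f \<longleftrightarrow>
     bij_betw f (points A) (points B) \<and> smooth_map A B f \<and> smooth_map B A (inv_into (points A) f)"

text \<open>The product of a manifold with a vector space.\<close>

definition times_atlas ::
  "('m, 'e::real_normed_vector) chart set \<Rightarrow> ('m \<times> 'w::real_normed_vector, 'e \<times> 'w) chart set" where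
  "times_atlas A = (\<lambda>c. (fst c \<times> UNIV, \<lambda>(q, w). (snd c q, w))) ` A"


section \<open>Tangent and cotangent bundle\<close>

text \<open>
  A tangent vector at \<open>q\<close> is the family of its coordinate vectors in the charts around \<open>q\<close>,
  which transform by the derivatives of the transition maps. The entries at all other indices
  are set to 0, so that equality of tangent vectors is equality of functions. The vector space
  operations are pointwise.
\<close>

type_synonym ('m, 'e) tvec = "('m, 'e) chart \<Rightarrow> 'e"

definition charts_at :: "('m, 'e) chart set \<Rightarrow> 'm \<Rightarrow> ('m, 'e) chart set" where
  "charts_at A q = {c \<in> A. q \<in> fst c}"

definition transition_deriv ::
  "('m, 'e::real_normed_vector) chart \<Rightarrow> ('m, 'e) chart \<Rightarrow> 'm \<Rightarrow> 'e \<Rightarrow> 'e" where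
  "transition_deriv c d q = frechet_derivative (snd d \<circ> chart_inv c) (at (snd c q))"

definition tangent_space ::
  "('m, 'e::real_normed_vector) chart set \<Rightarrow> 'm \<Rightarrow> ('m, 'e) tvec set" where
  "tangent_space A q =
     {v. (\<forall>c\<in>charts_at A q. \<forall>d\<in>charts_at A q. v d = transition_deriv c d q (v c)) \<and>
         (\<forall>c. c \<notin> charts_at A q \<longrightarrow> v c = 0)}"

definition tv_add :: "('m, 'e::real_normed_vector) tvec \<Rightarrow> ('m, 'e) tvec \<Rightarrow> ('m, 'e) tvec" where
  "tv_add v w = (\<lambda>c. v c + w c)"

definition tv_scale :: "real \<Rightarrow> ('m, 'e::real_normed_vector) tvec \<Rightarrow> ('m, 'e) tvec" where
  "tv_scale r v = (\<lambda>c. r *\<^sub>R v c)"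

text \<open>The tangent vector at \<open>q\<close> whose coordinate vector in the chart \<open>c\<close> is \<open>x\<close>.\<close>

definition tvec_of ::
  "('m, 'e::real_normed_vector) chart set \<Rightarrow> ('m, 'e) chart \<Rightarrow> 'm \<Rightarrow> 'e \<Rightarrow> ('m, 'e) tvec" where
  "tvec_of A c q x = (\<lambda>d. if d \<in> charts_at A q then transition_deriv c d q x else 0)"

definition tangent_atlas ::
  "('m, 'e::real_normed_vector) chart set \<Rightarrow> ('m \<times> ('m, 'e) tvec, 'e \<times> 'e) chart set" where
  "tangent_atlas A =
     (\<lambda>c. ({(q, v). q \<in> fst c \<and> v \<in> tangent_space A q}, \<lambda>(q, v). (snd c q, v c))) ` A"

text \<open>Covectors are extended by 0 outside the tangent space.\<close>

type_synonym ('m, 'e) covec = "('m, 'e) tvec \<Rightarrow> real"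

definition cotangent_space ::
  "('m, 'e::real_normed_vector) chart set \<Rightarrow> 'm \<Rightarrow> ('m, 'e) covec set" where
  "cotangent_space A q =
     {\<alpha>. (\<forall>v\<in>tangent_space A q. \<forall>w\<in>tangent_space A q. \<alpha> (tv_add v w) = \<alpha> v + \<alpha> w) \<and>
         (\<forall>r. \<forall>v\<in>tangent_space A q. \<alpha> (tv_scale r v) = r * \<alpha> v) \<and>
         (\<forall>v. v \<notin> tangent_space A q \<longrightarrow> \<alpha> v = 0)}"

definition cotangent_atlas ::
  "('m, 'e::real_normed_vector) chart set
    \<Rightarrow> ('m \<times> ('m, 'e) covec, 'e \<times> ('e \<Rightarrow>\<^sub>L real)) chart set" where
  "cotangent_atlas A =
     (\<lambda>c. ({(q, \<alpha>). q \<in> fst c \<and> \<alpha> \<in> cotangent_space A q},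
           \<lambda>(q, \<alpha>). (snd c q, Blinfun (\<lambda>x. \<alpha> (tvec_of A c q x))))) ` A"

text \<open>The differential at \<open>q\<close> of a real function on the manifold; the choice of chart is immaterial.\<close>

definition chart_at :: "('m, 'e) chart set \<Rightarrow> 'm \<Rightarrow> ('m, 'e) chart" where
  "chart_at A q = (SOME c. c \<in> charts_at A q)"

definition differential ::
  "('m, 'e::real_normed_vector) chart set \<Rightarrow> ('m \<Rightarrow> real) \<Rightarrow> 'm \<Rightarrow> ('m, 'e) covec" where
  "differential A f q = (\<lambda>v. if v \<in> tangent_space A q
     then let c = chart_at A q in frechet_derivative (f \<circ> chart_inv c) (at (snd c q)) (v c)
     else 0)"


section \<open>Curves\<close>

text \<open>
  Derivatives are taken within \<open>I\<close>, hence one-sided at the endpoints of a closed interval.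
\<close>

definition C1_on :: "real set \<Rightarrow> (real \<Rightarrow> 'b::real_normed_vector) \<Rightarrow> bool" where
  "C1_on I f \<longleftrightarrow>
     (\<exists>f'. (\<forall>t\<in>I. (f has_vector_derivative f' t) (at t within I)) \<and> continuous_on I f')"

definition C1_curve_on ::
  "('m, 'e::real_normed_vector) chart set \<Rightarrow> real set \<Rightarrow> (real \<Rightarrow> 'm) \<Rightarrow> bool" where
  "C1_curve_on A I q \<longleftrightarrow>
     continuous_map (top_of_set I) (atlas_topology A) q \<and>
     (\<forall>c\<in>A. C1_on {t \<in> I. q t \<in> fst c} (snd c \<circ> q))"

definition velocity ::
  "('m, 'e::real_normed_vector) chart set \<Rightarrow> real set \<Rightarrow> (real \<Rightarrow> 'm) \<Rightarrow> real \<Rightarrow> ('m, 'e) tvec" where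
  "velocity A I q t = (\<lambda>c. if c \<in> charts_at A (q t)
     then vector_derivative (snd c \<circ> q) (at t within I) else 0)"

text \<open>
  For a (relatively) open part \<open>D\<close> of a strip in the \<open>(\<epsilon>, t)\<close>-plane: \<open>x\<close>, its two first partial
  derivatives and the mixed one exist and are continuous on \<open>D\<close>. On the full strip over \<open>[0,T]\<close>
  this says that \<open>\<epsilon> \<mapsto> x \<epsilon>\<close> is a \<open>C\<^sup>1\<close> map into the Banach space of \<open>C\<^sup>1\<close> curves on \<open>[0,T]\<close>.
\<close>

definition C1_family_on ::
  "(real \<times> real) set \<Rightarrow> (real \<Rightarrow> real \<Rightarrow> 'b::real_normed_vector) \<Rightarrow> bool" where
  "C1_family_on D x \<longleftrightarrow>
     (\<exists>xt xe xet.
        (\<forall>(\<epsilon>, t)\<in>D.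
           ((\<lambda>s. x \<epsilon> s) has_vector_derivative xt \<epsilon> t) (at t within {s. (\<epsilon>, s) \<in> D}) \<and>
           ((\<lambda>r. x r t) has_vector_derivative xe \<epsilon> t) (at \<epsilon> within {r. (r, t) \<in> D}) \<and>
           ((\<lambda>r. xt r t) has_vector_derivative xet \<epsilon> t) (at \<epsilon> within {r. (r, t) \<in> D})) \<and>
        continuous_on D (\<lambda>(\<epsilon>, t). x \<epsilon> t) \<and> continuous_on D (\<lambda>(\<epsilon>, t). xt \<epsilon> t) \<and>
        continuous_on D (\<lambda>(\<epsilon>, t). xe \<epsilon> t) \<and> continuous_on D (\<lambda>(\<epsilon>, t). xet \<epsilon> t))"


section \<open>Trivializations\<close>

text \<open>
  The dual of the vector space \<open>'v\<close> is \<open>'v \<Rightarrow>\<^sub>L real\<close>, and the pairing is \<^const>\<open>blinfun_apply\<close>.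
\<close>

definition trivialization ::
  "('m, 'e::euclidean_space) chart set \<Rightarrow> ('m \<Rightarrow> 'v::euclidean_space \<Rightarrow> ('m, 'e) tvec) \<Rightarrow> bool" where
  "trivialization A \<Phi> \<longleftrightarrow>
     diffeomorphism (times_atlas A) (tangent_atlas A) (\<lambda>(q, u). (q, \<Phi> q u)) \<and>
     (\<forall>q\<in>points A. bij_betw (\<Phi> q) UNIV (tangent_space A q) \<and>
        (\<forall>u v. \<Phi> q (u + v) = tv_add (\<Phi> q u) (\<Phi> q v)) \<and>
        (\<forall>r u. \<Phi> q (r *\<^sub>R u) = tv_scale r (\<Phi> q u)))"

text \<open>The dual map \<open>T\<^sub>q\<^sup>*M \<rightarrow> V\<^sup>*\<close> of \<open>\<Phi>(q)\<close>, and the dual map \<open>V\<^sup>* \<rightarrow> T\<^sub>q\<^sup>*M\<close> of its inverse.\<close>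

definition triv_dual ::
  "('m \<Rightarrow> 'v::euclidean_space \<Rightarrow> ('m, 'e) tvec) \<Rightarrow> 'm \<Rightarrow> ('m, 'e) covec \<Rightarrow> ('v \<Rightarrow>\<^sub>L real)" where
  "triv_dual \<Phi> q \<alpha> = Blinfun (\<lambda>u. \<alpha> (\<Phi> q u))"

definition triv_dual_inv ::
  "('m, 'e::euclidean_space) chart set \<Rightarrow> ('m \<Rightarrow> 'v::euclidean_space \<Rightarrow> ('m, 'e) tvec)
    \<Rightarrow> 'm \<Rightarrow> ('v \<Rightarrow>\<^sub>L real) \<Rightarrow> ('m, 'e) covec" where
  "triv_dual_inv A \<Phi> q \<mu> =
     (\<lambda>v. if v \<in> tangent_space A q then blinfun_apply \<mu> (inv (\<Phi> q) v) else 0)"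

text \<open>
  \<open>D\<Phi>(q)\<cdot>v\<cdot>w\<close> in the chart \<open>c\<close>: the directional derivative, along the tangent vector \<open>v\<close>, of the
  local representative of the vector field \<open>x \<mapsto> \<Phi>(x)w\<close>. By itself it depends on the chart; the
  bracket below does not.
\<close>

definition triv_deriv ::
  "('m, 'e::euclidean_space) chart set \<Rightarrow> ('m \<Rightarrow> 'v::euclidean_space \<Rightarrow> ('m, 'e) tvec)
    \<Rightarrow> ('m, 'e) chart \<Rightarrow> 'm \<Rightarrow> ('m, 'e) tvec \<Rightarrow> 'v \<Rightarrow> ('m, 'e) tvec" where
  "triv_deriv A \<Phi> c q v w =
     tvec_of A c q (frechet_derivative (\<lambda>x. \<Phi> (chart_inv c x) w c) (at (snd c q)) (v c))"

definition bracket ::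
  "('m, 'e::euclidean_space) chart set \<Rightarrow> ('m \<Rightarrow> 'v::euclidean_space \<Rightarrow> ('m, 'e) tvec)
    \<Rightarrow> 'm \<Rightarrow> 'v \<Rightarrow> 'v \<Rightarrow> 'v" where
  "bracket A \<Phi> q u v = (let c = chart_at A q in
     inv (\<Phi> q) (triv_deriv A \<Phi> c q (\<Phi> q u) v) - inv (\<Phi> q) (triv_deriv A \<Phi> c q (\<Phi> q v) u))"

definition ad_star ::
  "('m, 'e::euclidean_space) chart set \<Rightarrow> ('m \<Rightarrow> 'v::euclidean_space \<Rightarrow> ('m, 'e) tvec)
    \<Rightarrow> 'm \<Rightarrow> 'v \<Rightarrow> ('v \<Rightarrow>\<^sub>L real) \<Rightarrow> ('v \<Rightarrow>\<^sub>L real)" where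
  "ad_star A \<Phi> q \<xi> \<alpha> = Blinfun (\<lambda>v. blinfun_apply \<alpha> (bracket A \<Phi> q \<xi> v))"

definition triv_velocity ::
  "('m, 'e::euclidean_space) chart set \<Rightarrow> ('m \<Rightarrow> 'v::euclidean_space \<Rightarrow> ('m, 'e) tvec)
    \<Rightarrow> real \<Rightarrow> (real \<Rightarrow> 'm) \<Rightarrow> real \<Rightarrow> 'v" where
  "triv_velocity A \<Phi> T q t = inv (\<Phi> (q t)) (velocity A {0..T} q t)"


section \<open>Hamiltonian, action and variational principle\<close>

definition smooth_hamiltonian ::
  "('m, 'e::euclidean_space) chart set \<Rightarrow> real \<Rightarrow> (real \<Rightarrow> 'm \<times> ('m, 'e) covec \<Rightarrow> real) \<Rightarrow> bool" where
  "smooth_hamiltonian A T H \<longleftrightarrow>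
     (\<forall>c\<in>cotangent_atlas A.
        smooth_on ({0..T} \<times> snd c ` fst c) (\<lambda>(t, z). H t (chart_inv c z)))"

definition triv_hamiltonian ::
  "('m, 'e::euclidean_space) chart set \<Rightarrow> ('m \<Rightarrow> 'v::euclidean_space \<Rightarrow> ('m, 'e) tvec)
    \<Rightarrow> (real \<Rightarrow> 'm \<times> ('m, 'e) covec \<Rightarrow> real) \<Rightarrow> real \<Rightarrow> 'm \<Rightarrow> ('v \<Rightarrow>\<^sub>L real) \<Rightarrow> real" where
  "triv_hamiltonian A \<Phi> H t q \<mu> = H t (q, triv_dual_inv A \<Phi> q \<mu>)"

definition D_q ::
  "('m, 'e::euclidean_space) chart set \<Rightarrow> (real \<Rightarrow> 'm \<Rightarrow> ('v::euclidean_space \<Rightarrow>\<^sub>L real) \<Rightarrow> real)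
    \<Rightarrow> real \<Rightarrow> 'm \<Rightarrow> ('v \<Rightarrow>\<^sub>L real) \<Rightarrow> ('m, 'e) covec" where
  "D_q A h t q \<mu> = differential A (\<lambda>x. h t x \<mu>) q"

text \<open>The derivative in \<open>\<mu>\<close>, an element of the bidual of \<open>V\<close>, is identified with a vector of \<open>V\<close>.\<close>

definition D_mu ::
  "(real \<Rightarrow> 'm \<Rightarrow> ('v::euclidean_space \<Rightarrow>\<^sub>L real) \<Rightarrow> real) \<Rightarrow> real \<Rightarrow> 'm \<Rightarrow> ('v \<Rightarrow>\<^sub>L real) \<Rightarrow> 'v" where
  "D_mu h t q \<mu> = (THE w. ((\<lambda>\<nu>. h t q \<nu>) has_derivative (\<lambda>\<nu>. blinfun_apply \<nu> w)) (at \<mu>))"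

definition action ::
  "('m, 'e::euclidean_space) chart set \<Rightarrow> ('m \<Rightarrow> 'v::euclidean_space \<Rightarrow> ('m, 'e) tvec)
    \<Rightarrow> (real \<Rightarrow> 'm \<Rightarrow> ('v \<Rightarrow>\<^sub>L real) \<Rightarrow> real) \<Rightarrow> real \<Rightarrow> (real \<Rightarrow> 'm) \<Rightarrow> (real \<Rightarrow> 'v \<Rightarrow>\<^sub>L real) \<Rightarrow> real"
  where
  "action A \<Phi> h T q \<mu> =
     integral {0..T} (\<lambda>t. blinfun_apply (\<mu> t) (triv_velocity A \<Phi> T q t) - h t (q t) (\<mu> t))"

definition partial_variation ::
  "real \<Rightarrow> (real \<Rightarrow> 'v::euclidean_space) \<Rightarrow> (real \<Rightarrow> 'v \<Rightarrow>\<^sub>L real) \<Rightarrow> bool" where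
  "partial_variation T \<eta> \<delta>\<mu> \<longleftrightarrow> C1_on {0..T} \<eta> \<and> C1_on {0..T} \<delta>\<mu> \<and> \<eta> 0 = 0"

definition admissible_curve ::
  "('m, 'e::euclidean_space) chart set \<Rightarrow> real \<Rightarrow> 'm
    \<Rightarrow> (real \<Rightarrow> 'm) \<Rightarrow> (real \<Rightarrow> 'v::euclidean_space \<Rightarrow>\<^sub>L real) \<Rightarrow> bool" where
  "admissible_curve A T q\<^sub>0 q \<mu> \<longleftrightarrow> C1_curve_on A {0..T} q \<and> C1_on {0..T} \<mu> \<and> q 0 = q\<^sub>0"

text \<open>
  A continuously differentiable one-parameter family of admissible curves through \<open>(q, \<mu>)\<close>,
  defined for \<open>\<bar>\<epsilon>\<bar> < a\<close>, whose derivative at \<open>\<epsilon> = 0\<close> is the variation given by \<open>(\<eta>, \<delta>\<mu>)\<close>.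
\<close>

definition variation_family ::
  "('m, 'e::euclidean_space) chart set \<Rightarrow> ('m \<Rightarrow> 'v::euclidean_space \<Rightarrow> ('m, 'e) tvec)
    \<Rightarrow> real \<Rightarrow> 'm \<Rightarrow> (real \<Rightarrow> 'm) \<Rightarrow> (real \<Rightarrow> 'v \<Rightarrow>\<^sub>L real)
    \<Rightarrow> (real \<Rightarrow> 'v) \<Rightarrow> (real \<Rightarrow> 'v \<Rightarrow>\<^sub>L real)
    \<Rightarrow> real \<Rightarrow> (real \<Rightarrow> real \<Rightarrow> 'm) \<Rightarrow> (real \<Rightarrow> real \<Rightarrow> 'v \<Rightarrow>\<^sub>L real) \<Rightarrow> bool" where
  "variation_family A \<Phi> T q\<^sub>0 q \<mu> \<eta> \<delta>\<mu> a qf \<mu>f \<longleftrightarrow>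
     a > 0 \<and>
     (\<forall>\<epsilon>\<in>{-a<..<a}. admissible_curve A T q\<^sub>0 (qf \<epsilon>) (\<mu>f \<epsilon>)) \<and>
     continuous_map (top_of_set ({-a<..<a} \<times> {0..T})) (atlas_topology A) (\<lambda>(\<epsilon>, t). qf \<epsilon> t) \<and>
     (\<forall>c\<in>A. C1_family_on {(\<epsilon>, t). \<epsilon> \<in> {-a<..<a} \<and> t \<in> {0..T} \<and> qf \<epsilon> t \<in> fst c}
               (\<lambda>\<epsilon> t. snd c (qf \<epsilon> t))) \<and>
     C1_family_on ({-a<..<a} \<times> {0..T}) \<mu>f \<and>
     (\<forall>t\<in>{0..T}. qf 0 t = q t \<and> \<mu>f 0 t = \<mu> t \<and>
        velocity A {-a<..<a} (\<lambda>\<epsilon>. qf \<epsilon> t) 0 = \<Phi> (q t) (\<eta> t) \<and>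
        ((\<lambda>\<epsilon>. \<mu>f \<epsilon> t) has_vector_derivative \<delta>\<mu> t) (at 0))"

definition type_II_dAlembert ::
  "('m, 'e::euclidean_space) chart set \<Rightarrow> ('m \<Rightarrow> 'v::euclidean_space \<Rightarrow> ('m, 'e) tvec)
    \<Rightarrow> (real \<Rightarrow> 'm \<Rightarrow> ('v \<Rightarrow>\<^sub>L real) \<Rightarrow> real) \<Rightarrow> real \<Rightarrow> 'm \<Rightarrow> ('v \<Rightarrow>\<^sub>L real)
    \<Rightarrow> (real \<Rightarrow> 'm) \<Rightarrow> (real \<Rightarrow> 'v \<Rightarrow>\<^sub>L real) \<Rightarrow> bool" where
  "type_II_dAlembert A \<Phi> h T q\<^sub>0 \<mu>\<^sub>1 q \<mu> \<longleftrightarrow>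
     (\<forall>\<eta> \<delta>\<mu> a qf \<mu>f.
        partial_variation T \<eta> \<delta>\<mu> \<longrightarrow> variation_family A \<Phi> T q\<^sub>0 q \<mu> \<eta> \<delta>\<mu> a qf \<mu>f \<longrightarrow>
        ((\<lambda>\<epsilon>. action A \<Phi> h T (qf \<epsilon>) (\<mu>f \<epsilon>)) has_real_derivative blinfun_apply \<mu>\<^sub>1 (\<eta> T)) (at 0))"

end

theory Submission
  imports Defs
begin

text \<open>
  In a chart the integrand of the action is a \<open>C\<^sup>1\<close> function of position, velocity and
  momentum, so the action can be differentiated under the integral sign along any family of
  curves. Symmetry of the mixed second derivatives turns the variation of the trivialized velocity
  into \<open>\<eta>' + [\<xi>, \<eta>]\<close>, and the first variation becomes the integral of
  \<open>\<langle>\<delta>\<mu>, \<xi> - D\<^sub>\<mu> h\<rangle> + \<langle>\<mu>, \<eta>'\<rangle> + \<langle>ad\<^sup>*\<^sub>\<xi> \<mu> - \<Phi>\<^sup>* D\<^sub>q h, \<eta>\<rangle>\<close>. Under Hamel's equations this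
  is the derivative of \<open>\<langle>\<mu>, \<eta>\<rangle>\<close>. Conversely, variations \<open>\<eta>\<close>, \<open>\<delta>\<mu>\<close> given by bump functions supported
  in a single chart are realized by moving the curve along a straight line in that chart, and they
  suffice for the fundamental lemma; a bump that is positive at \<open>T\<close> yields \<open>\<mu>(T) = \<mu>\<^sub>1\<close>.
  Each pointwise computation uses the chart that occurs in the definitions of the bracket and of
  the differential, so the chart independence of these notions is not needed.
\<close>

text \<open>Two features of the definitions shape the proof. The bracket and the differential are
  evaluated in a chart chosen anew at every point, so continuity in t of the terms of Hamel's
  equations is not visible from their formulas. It is drawn from the variations instead: in a fixed
  chart the \<epsilon>-derivative of the integrand is jointly continuous, it equals the pointwise
  expression, and dividing by a positive bump transfers continuity to the residual. Moreover a curve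
  need not stay in a single chart, and a family is known only chart by chart. Hence derivatives on
  the whole strip are named by the operator \<open>vector_derivative\<close>, and local statements
  are glued along relatively open covers. A bump times a constant vector of V is an admissible
  variation that lives in one chart, so neither flows nor an exponential map enter.\<close>

lemma continuous_on_local:
  fixes f :: "'a::metric_space \<Rightarrow> 'b::topological_space"
  assumes "\<And>x. x \<in> S \<Longrightarrow> \<exists>U g. open U \<and> x \<in> U \<and> continuous_on (S \<inter> U) g \<and> (\<forall>y\<in>S \<inter> U. g y = f y)"
  shows "continuous_on S f"
  unfolding continuous_on_eq_continuous_within
proof
  fix x assume x: "x \<in> S"
  obtain U g where U: "open U" "x \<in> U" and g: "continuous_on (S \<inter> U) g" "\<forall>y\<in>S \<inter> U. g y = f y"
    using assms[OF x] by blast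
  have "continuous_on (S \<inter> U) f"
    using g continuous_on_cong by fastforce
  then have "continuous (at x within (S \<inter> U)) f"
    using x U by (simp add: continuous_on_eq_continuous_within)
  moreover have "at x within S = at x within (S \<inter> U)"
    by (rule at_within_nhd[OF U(2,1)]) auto
  ultimately show "continuous (at x within S) f" by simp
qed

section \<open>Continuously differentiable functions with a time parameter\<close>

text \<open>The derivative is recorded as a function of time, point and direction, jointly
  continuous in all three, rather than as a continuous map into a space of operators; the chain rule
  then becomes a composition of continuous functions. Explicit time enters only continuously: the
  integrand of the action is never differentiated in it, and at the ends of [0,T] no two-sided time
  derivative is available.\<close>

definition C1_param ::
  "real set \<Rightarrow> 'a::real_normed_vector set \<Rightarrow> (real \<Rightarrow> 'a \<Rightarrow> 'b::real_normed_vector) \<Rightarrow> bool" where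
  "C1_param I S f \<longleftrightarrow>
     (\<exists>f'. (\<forall>t\<in>I. \<forall>z\<in>S. (f t has_derivative f' t z) (at z)) \<and>
        continuous_on (I \<times> S) (\<lambda>(t, z). f t z) \<and>
        continuous_on (I \<times> S \<times> UNIV) (\<lambda>(t, z, w). f' t z w))"

lemma C1_paramE:
  assumes "C1_param I S f"
  obtains f' where "\<And>t z. t \<in> I \<Longrightarrow> z \<in> S \<Longrightarrow> (f t has_derivative f' t z) (at z)"
    and "continuous_on (I \<times> S) (\<lambda>(t, z). f t z)"
    and "continuous_on (I \<times> S \<times> UNIV) (\<lambda>(t, z, w). f' t z w)"
  using assms unfolding C1_param_def by blast

text \<open>Openness of S turns equality on S into equality near each of its points, as a derivative
  requires.\<close>

lemma C1_param_cong:
  assumes S: "open S" and eq: "\<And>t z. t \<in> I \<Longrightarrow> z \<in> S \<Longrightarrow> f t z = g t z" and g: "C1_param I S g"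
  shows "C1_param I S f"
proof -
  obtain g' where g': "\<And>t z. t \<in> I \<Longrightarrow> z \<in> S \<Longrightarrow> (g t has_derivative g' t z) (at z)"
    "continuous_on (I \<times> S) (\<lambda>(t, z). g t z)" "continuous_on (I \<times> S \<times> UNIV) (\<lambda>(t, z, w). g' t z w)"
    by (rule C1_paramE[OF g]) (rule that)
  have "(f t has_derivative g' t z) (at z)" if "t \<in> I" "z \<in> S" for t z
    using has_derivative_transform_within_open[OF g'(1)[OF that] S that(2)] eq that(1) by auto
  moreover have "continuous_on (I \<times> S) (\<lambda>(t, z). f t z)"
    using g'(2) by (rule continuous_on_eq) (auto simp: eq)
  ultimately show ?thesis
    unfolding C1_param_def using g'(3) by blast
qed

lemma C1_param_compose:
  assumes f: "C1_param I S f" and g: "C1_param I R g" and sub: "\<And>t z. t \<in> I \<Longrightarrow> z \<in> R \<Longrightarrow> g t z \<in> S"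
  shows "C1_param I R (\<lambda>t z. f t (g t z))"
proof -
  obtain f' where f': "\<And>t z. t \<in> I \<Longrightarrow> z \<in> S \<Longrightarrow> (f t has_derivative f' t z) (at z)"
    "continuous_on (I \<times> S) (\<lambda>(t, z). f t z)" "continuous_on (I \<times> S \<times> UNIV) (\<lambda>(t, z, w). f' t z w)"
    by (rule C1_paramE[OF f]) (rule that)
  obtain g' where g': "\<And>t z. t \<in> I \<Longrightarrow> z \<in> R \<Longrightarrow> (g t has_derivative g' t z) (at z)"
    "continuous_on (I \<times> R) (\<lambda>(t, z). g t z)" "continuous_on (I \<times> R \<times> UNIV) (\<lambda>(t, z, w). g' t z w)"
    by (rule C1_paramE[OF g]) (rule that)
  have "continuous_on (I \<times> R) (\<lambda>p. (fst p, g (fst p) (snd p)))"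
    using g'(2) by (auto simp: case_prod_unfold intro!: continuous_intros)
  then have "continuous_on (I \<times> R) (\<lambda>p. (\<lambda>(t, z). f t z) (fst p, g (fst p) (snd p)))"
    by (rule continuous_on_compose2[OF f'(2)]) (use sub in auto)
  then have 1: "continuous_on (I \<times> R) (\<lambda>(t, z). f t (g t z))"
    by (simp add: case_prod_unfold)
  have "continuous_on (I \<times> R \<times> UNIV) (\<lambda>p. (\<lambda>(t, z). g t z) (fst p, fst (snd p)))"
    by (rule continuous_on_compose2[OF g'(2)]) (auto intro!: continuous_intros)
  then have "continuous_on (I \<times> R \<times> UNIV) (\<lambda>p. (fst p, g (fst p) (fst (snd p)), g' (fst p) (fst (snd p)) (snd (snd p))))"
    using g'(3) by (auto simp: case_prod_unfold intro!: continuous_intros)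
  then have "continuous_on (I \<times> R \<times> UNIV) (\<lambda>p. (\<lambda>(t, z, w). f' t z w)
      (fst p, g (fst p) (fst (snd p)), g' (fst p) (fst (snd p)) (snd (snd p))))"
    by (rule continuous_on_compose2[OF f'(3)]) (use sub in auto)
  then have 2: "continuous_on (I \<times> R \<times> UNIV) (\<lambda>(t, z, w). f' t (g t z) (g' t z w))"
    by (simp add: case_prod_unfold)
  show ?thesis
    unfolding C1_param_def
    apply (rule exI[of _ "\<lambda>t z w. f' t (g t z) (g' t z w)"])
    using 1 2 has_derivative_compose[OF g'(1) f'(1)[OF _ sub]] by auto
qed

lemma C1_param_linear:
  assumes "bounded_linear A"
  shows "C1_param I S (\<lambda>_. A)"
proof -
  interpret bounded_linear A by fact
  have "(A has_derivative A) (at z)" for z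
    by (rule has_derivative)  (rule has_derivative_ident)
  then show ?thesis
    unfolding C1_param_def
    by (intro exI[of _ "\<lambda>t z. A"]) (auto simp: case_prod_unfold intro!: continuous_intros continuous_on)
qed

lemma C1_param_Pair:
  assumes f: "C1_param I S f" and g: "C1_param I S g"
  shows "C1_param I S (\<lambda>t z. (f t z, g t z))"
proof -
  obtain f' where f': "\<And>t z. t \<in> I \<Longrightarrow> z \<in> S \<Longrightarrow> (f t has_derivative f' t z) (at z)"
    "continuous_on (I \<times> S) (\<lambda>(t, z). f t z)" "continuous_on (I \<times> S \<times> UNIV) (\<lambda>(t, z, w). f' t z w)"
    by (rule C1_paramE[OF f]) (rule that)
  obtain g' where g': "\<And>t z. t \<in> I \<Longrightarrow> z \<in> S \<Longrightarrow> (g t has_derivative g' t z) (at z)"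
    "continuous_on (I \<times> S) (\<lambda>(t, z). g t z)" "continuous_on (I \<times> S \<times> UNIV) (\<lambda>(t, z, w). g' t z w)"
    by (rule C1_paramE[OF g]) (rule that)
  show ?thesis
    unfolding C1_param_def
    apply (rule exI[of _ "\<lambda>t z w. (f' t z w, g' t z w)"])
    using f' g' by (auto simp: case_prod_unfold intro!: continuous_intros has_derivative_Pair)
qed

lemma C1_param_bilinear:
  assumes B: "bounded_bilinear B"
  shows "C1_param I S (\<lambda>_ (x, y). B x y)"
proof -
  interpret bounded_bilinear B by fact
  show ?thesis
    unfolding C1_param_def
    apply (rule exI[of _ "\<lambda>t (x, y) (dx, dy). B x dy + B dx y"])
    apply (auto simp: case_prod_unfold intro!: continuous_intros continuous_on)
    apply (rule has_derivative_eq_rhs[OF FDERIV[OF has_derivative_fst[OF has_derivative_ident]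
            has_derivative_snd[OF has_derivative_ident]]])
    apply (simp add: fun_eq_iff)
    done
qed

lemma C1_param_bilinear2:
  assumes "bounded_bilinear B" "C1_param I S f" "C1_param I S g"
  shows "C1_param I S (\<lambda>t z. B (f t z) (g t z))"
  using C1_param_compose[OF C1_param_bilinear[OF assms(1)] C1_param_Pair[OF assms(2,3)], of UNIV] by simp

lemma C1_param_linear2:
  assumes "bounded_linear A" "C1_param I S f"
  shows "C1_param I S (\<lambda>t z. A (f t z))"
  using C1_param_compose[OF C1_param_linear[OF assms(1)] assms(2), of UNIV] by simp

lemma C1_param_add:
  assumes "C1_param I S f" "C1_param I S g"
  shows "C1_param I S (\<lambda>t z. f t z + g t z)"
  using C1_param_linear2[OF _ C1_param_Pair[OF assms], of "\<lambda>(x, y). x + y"]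
  by (simp add: case_prod_unfold bounded_linear_add bounded_linear_fst bounded_linear_snd)

lemma C1_param_diff:
  assumes "C1_param I S f" "C1_param I S g"
  shows "C1_param I S (\<lambda>t z. f t z - g t z)"
  using C1_param_linear2[OF _ C1_param_Pair[OF assms], of "\<lambda>(x, y). x - y"]
  by (simp add: case_prod_unfold bounded_linear_sub bounded_linear_fst bounded_linear_snd)

lemma C1_param_const: "C1_param I S (\<lambda>_ _. c)"
  unfolding C1_param_def
  by (rule exI[of _ "\<lambda>_ _ _. 0"]) (auto intro!: derivative_eq_intros continuous_intros)

lemma C1_param_sum:
  assumes "finite B" "\<And>b. b \<in> B \<Longrightarrow> C1_param I S (f b)"
  shows "C1_param I S (\<lambda>t z. \<Sum>b\<in>B. f b t z)"
  using assms by (induction B rule: finite_induct) (auto intro!: C1_param_const C1_param_add)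

text \<open>Joint continuity in point and direction is reduced to continuity of finitely many
  directional derivatives, which is what \<open>Ck_on\<close> supplies.\<close>

lemma has_derivative_basis_expansion:
  fixes f :: "'a::euclidean_space \<Rightarrow> 'b::real_normed_vector"
  assumes "(f has_derivative D) F"
  shows "D w = (\<Sum>b\<in>Basis. (w \<bullet> b) *\<^sub>R D b)"
proof -
  interpret bounded_linear D using assms by (rule has_derivative_bounded_linear)
  show ?thesis
    by (subst euclidean_representation[of w, symmetric]) (simp add: sum scaleR)
qed

section \<open>Smooth functions\<close>

lemma smooth_on_cong:
  assumes "\<And>x. x \<in> S \<Longrightarrow> f x = g x" "smooth_on S g"
  shows "smooth_on S f"
  using assms unfolding smooth_on_def by (metis IntD2)

lemma smooth_on_imp_continuous_on:
  assumes "smooth_on S f"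
  shows "continuous_on S f"
proof (rule continuous_on_local)
  fix x assume "x \<in> S"
  then obtain U g where U: "open U" "x \<in> U" "\<forall>k. Ck_on k U g" "\<forall>y\<in>U \<inter> S. g y = f y"
    using assms unfolding smooth_on_def by blast
  from U(3)[rule_format, of 0] have "continuous_on U g" by simp
  then have "continuous_on (S \<inter> U) g" using continuous_on_subset by blast
  with U show "\<exists>U g. open U \<and> x \<in> U \<and> continuous_on (S \<inter> U) g \<and> (\<forall>y\<in>S \<inter> U. g y = f y)"
    by (auto intro!: exI[of _ U] exI[of _ g])
qed

lemma frechet_derivative_transform_open:
  assumes "open U" "x \<in> U" "\<And>y. y \<in> U \<Longrightarrow> f y = g y" "g differentiable (at x)"
  shows "f differentiable (at x)" "frechet_derivative f (at x) = frechet_derivative g (at x)"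
proof -
  have "(f has_derivative frechet_derivative g (at x)) (at x)"
    using has_derivative_transform_within_open[OF _ assms(1,2), of g _ UNIV f] assms(3,4)
    by (auto simp: frechet_derivative_works)
  then show "f differentiable (at x)" "frechet_derivative f (at x) = frechet_derivative g (at x)"
    by (auto intro: differentiableI dest: frechet_derivative_at)
qed

text \<open>A local extension of f, cut down to the open set S, agrees with f on a neighbourhood, so
  both have the same Frechet derivative there. One order of \<open>Ck_on\<close> is spent, and all
  orders remain.\<close>

lemma smooth_on_open_derivative:
  assumes f: "smooth_on S f" and S: "open S"
  shows "\<And>x. x \<in> S \<Longrightarrow> f differentiable (at x)"
    and "smooth_on S (\<lambda>x. frechet_derivative f (at x) v)"
proof -
  have *: "\<exists>U g. open U \<and> U \<subseteq> S \<and> x \<in> U \<and> (\<forall>k. Ck_on k U g) \<and> (\<forall>y\<in>U. f y = g y)" if x: "x \<in> S" for x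
  proof -
    obtain U g where U: "open U" "x \<in> U" "\<forall>k. Ck_on k U g" "\<forall>y\<in>U \<inter> S. g y = f y"
      using bspec[OF f[unfolded smooth_on_def] x] by blast
    have "Ck_on k (U \<inter> S) g" if "Ck_on k U g" for k and g :: "'a \<Rightarrow> 'b"
      using that by (induction k arbitrary: g) (auto intro: continuous_on_subset)
    with U x S show ?thesis by (intro exI[of _ "U \<inter> S"] exI[of _ g]) auto
  qed
  { fix x assume "x \<in> S"
    from *[OF this] obtain U g where U: "open U" "x \<in> U" "\<forall>k. Ck_on k U g" "\<forall>y\<in>U. f y = g y" by blast
    from U(3)[rule_format, of "Suc 0"] U(2) have "g differentiable (at x)" by simp
    with U show "f differentiable (at x)" by (blast intro: frechet_derivative_transform_open(1)) }
  show "smooth_on S (\<lambda>x. frechet_derivative f (at x) v)"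
    unfolding smooth_on_def
  proof
    fix x assume "x \<in> S"
    from *[OF this] obtain U g where U: "open U" "x \<in> U" "\<forall>k. Ck_on k U g" "\<forall>y\<in>U. f y = g y" by blast
    from U(3) have "Ck_on (Suc k) U g" for k by blast
    then have k: "Ck_on k U (\<lambda>x. frechet_derivative g (at x) v)" "\<forall>x\<in>U. g differentiable (at x)" for k
      by auto
    have "frechet_derivative f (at y) v = frechet_derivative g (at y) v" if "y \<in> U" for y
      using frechet_derivative_transform_open(2)[OF U(1) that, of f g] U(4) k(2) that by simp
    with k U show "\<exists>U g. open U \<and> x \<in> U \<and> (\<forall>k. Ck_on k U g) \<and>
        (\<forall>y\<in>U \<inter> S. g y = frechet_derivative f (at y) v)"
      by (intro exI[of _ U] exI[of _ "\<lambda>x. frechet_derivative g (at x) v"]) auto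
  qed
qed

lemma smooth_on_C1_param:
  fixes f :: "'a::euclidean_space \<Rightarrow> 'b::real_normed_vector"
  assumes f: "smooth_on S f" and S: "open S"
  shows "C1_param I S (\<lambda>_. f)"
proof -
  let ?D = "\<lambda>x. frechet_derivative f (at x)"
  have D: "(f has_derivative ?D z) (at z)" if "z \<in> S" for z
    using smooth_on_open_derivative(1)[OF f S that] by (simp add: frechet_derivative_works)
  have c: "continuous_on (I \<times> S \<times> UNIV) (\<lambda>p. g (fst (snd p)))" 
    if "continuous_on S g" for g :: "'a \<Rightarrow> 'b"
    by (rule continuous_on_compose2[OF that]) (auto intro!: continuous_intros)
  have "continuous_on (I \<times> S \<times> UNIV) (\<lambda>p. \<Sum>b\<in>Basis. (snd (snd p) \<bullet> b) *\<^sub>R ?D (fst (snd p)) b)"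
    by (intro continuous_intros c smooth_on_imp_continuous_on smooth_on_open_derivative(2)[OF f S])
  then have "continuous_on (I \<times> S \<times> UNIV) (\<lambda>(t, z, w). ?D z w)"
    apply (rule continuous_on_eq)
    subgoal for p
      using has_derivative_basis_expansion[OF D, of "fst (snd p)" "snd (snd p)"] by (auto simp: case_prod_unfold)
    done
  moreover have "continuous_on (I \<times> S) (\<lambda>p. f (snd p))"
    by (rule continuous_on_compose2[OF smooth_on_imp_continuous_on[OF f]]) (auto intro!: continuous_intros)
  ultimately show ?thesis
    unfolding C1_param_def using D by (intro exI[of _ "\<lambda>_. ?D"]) (auto simp: case_prod_unfold)
qed

text \<open>This second order information about f yields the mixed derivative of a family of curves
  after a change of charts.\<close>

lemma smooth_on_derivative_C1_param:
  fixes f :: "'a::euclidean_space \<Rightarrow> 'b::real_normed_vector"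
  assumes f: "smooth_on S f" and S: "open S"
  shows "C1_param I (S \<times> UNIV) (\<lambda>_ (x, w). frechet_derivative f (at x) w)"
proof -
  let ?D = "\<lambda>x. frechet_derivative f (at x)"
  have "C1_param I (S \<times> UNIV) (\<lambda>_ z. \<Sum>b\<in>Basis. (snd z \<bullet> b) *\<^sub>R ?D (fst z) b)"
  proof (intro C1_param_sum finite_Basis C1_param_bilinear2[OF bounded_bilinear_scaleR])
    fix b
    show "C1_param I (S \<times> UNIV) (\<lambda>_ z::'a \<times> 'a. snd z \<bullet> b)"
      by (rule C1_param_linear) (intro bounded_linear_intros)
    show "C1_param I (S \<times> UNIV) (\<lambda>_ z::'a \<times> 'a. ?D (fst z) b)"
      by (rule C1_param_compose[OF smooth_on_C1_param[OF smooth_on_open_derivative(2)[OF f S] S]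
            C1_param_linear[OF bounded_linear_fst]]) auto
  qed
  moreover have "?D x w = (\<Sum>b\<in>Basis. (w \<bullet> b) *\<^sub>R ?D x b)" if "x \<in> S" for x w
    using has_derivative_basis_expansion smooth_on_open_derivative(1)[OF f S that]
    unfolding frechet_derivative_works by blast
  ultimately show ?thesis
    using C1_param_cong[of "S \<times> UNIV" I "\<lambda>_ (x, w). ?D x w" "\<lambda>_ z. \<Sum>b\<in>Basis. (snd z \<bullet> b) *\<^sub>R ?D (fst z) b"] S
    by (auto simp: open_Times)
qed

text \<open>On a closed time interval f is only the restriction of local extensions g. Freezing t
  leaves an open set of space, so the spatial derivative is determined by f alone, while its
  continuity is inherited from any g. Precomposition with B moves the domain to a Euclidean space,
  where a basis is at hand; it is applied to momenta represented by vectors.\<close>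

lemma smooth_on_time_C1_param:
  fixes f :: "real \<times> 'a::real_normed_vector \<Rightarrow> 'b::real_normed_vector"
    and B :: "'w::euclidean_space \<Rightarrow> 'a"
  assumes f: "smooth_on (I \<times> S) f" and S: "open S" and B: "bounded_linear B"
  shows "C1_param I (B -` S) (\<lambda>t w. f (t, B w))"
proof -
  interpret B: bounded_linear B by fact
  define D where "D t z = frechet_derivative (\<lambda>z. f (t, z)) (at z)" for t z
  have loc: "\<exists>U g. open U \<and> p \<in> U \<and> (\<forall>k. Ck_on k U g) \<and> (\<forall>y\<in>U \<inter> I \<times> S. g y = f y)"
    if "p \<in> I \<times> S" for p
    using f that unfolding smooth_on_def by blast
  \<comment> \<open>Along the slice of fixed t, the derivative of the extension in the direction (0,
    v) is the derivative of f in the direction v.\<close>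
  have der: "((\<lambda>z. f (t, z)) has_derivative (\<lambda>v. frechet_derivative g (at (t, z)) (0, v))) (at z)"
    if U: "open U" "\<forall>k. Ck_on k U g" "\<forall>y\<in>U \<inter> I \<times> S. g y = f y" "(t, z) \<in> U" "t \<in> I" "z \<in> S" for U g t z
  proof (rule has_derivative_transform_within_open)
    from U(2)[rule_format, of "Suc 0"] U(4) have "g differentiable (at (t, z))" by simp
    then have "(g has_derivative frechet_derivative g (at (t, z))) (at (t, z))"
      by (simp add: frechet_derivative_works)
    then show "((\<lambda>z. g (t, z)) has_derivative (\<lambda>v. frechet_derivative g (at (t, z)) (0, v))) (at z)"
      by (rule has_derivative_compose[of "Pair t" "Pair 0", rotated])
        (auto intro!: derivative_eq_intros)
    show "open (Pair t -` U \<inter> S)"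
      by (intro open_Int open_vimage U S continuous_intros)
  qed (use U in auto)
  have D: "((\<lambda>z. f (t, z)) has_derivative D t z) (at z)" if "t \<in> I" "z \<in> S" for t z
    using loc[of "(t, z)"] that der by (metis D_def SigmaI frechet_derivative_at)
  have D_cont: "continuous_on (I \<times> S) (\<lambda>p. D (fst p) (snd p) v)" for v
  proof (rule continuous_on_local)
    fix p assume "p \<in> I \<times> S"
    from loc[OF this] obtain U g where U: "open U" "p \<in> U" "\<forall>k. Ck_on k U g" "\<forall>y\<in>U \<inter> I \<times> S. g y = f y" 
      by blast
    from U(3)[rule_format, of "Suc 0"] have "continuous_on U (\<lambda>p. frechet_derivative g (at p) (0, v))" by auto
    then have "continuous_on (I \<times> S \<inter> U) (\<lambda>p. frechet_derivative g (at p) (0, v))"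
      by (rule continuous_on_subset) auto
    moreover have "frechet_derivative g (at y) (0, v) = D (fst y) (snd y) v" if "y \<in> I \<times> S \<inter> U" for y
      using frechet_derivative_at[OF der[OF U(1,3,4), of "fst y" "snd y"]] that 
      by (auto simp: D_def dest: fun_cong)
    ultimately show "\<exists>U g. open U \<and> p \<in> U \<and> continuous_on (I \<times> S \<inter> U) g \<and>
        (\<forall>y\<in>I \<times> S \<inter> U. g y = D (fst y) (snd y) v)"
      using U(1,2) by blast
  qed
  let ?f' = "\<lambda>t w dw. D t (B w) (B dw)"
  have f': "((\<lambda>w. f (t, B w)) has_derivative ?f' t w) (at w)" if "t \<in> I" "w \<in> B -` S" for t w
    using has_derivative_compose[OF B.has_derivative[OF has_derivative_ident] D] that by simp
  have c: "continuous_on (I \<times> (B -` S) \<times> UNIV) (\<lambda>p. g (fst p, B (fst (snd p))))"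
    if "continuous_on (I \<times> S) g" for g :: "_ \<Rightarrow> 'b"
    by (rule continuous_on_compose2[OF that]) (auto intro!: continuous_intros B.continuous_on)
  have "continuous_on (I \<times> (B -` S) \<times> UNIV)
      (\<lambda>p. \<Sum>b\<in>Basis. (snd (snd p) \<bullet> b) *\<^sub>R (\<lambda>q. D (fst q) (snd q) (B b)) (fst p, B (fst (snd p))))"
    by (intro continuous_intros c D_cont)
  then have "continuous_on (I \<times> (B -` S) \<times> UNIV) (\<lambda>(t, w, dw). ?f' t w dw)"
    apply (rule continuous_on_eq)
    subgoal for p
      using has_derivative_basis_expansion[OF f', of "fst p" "fst (snd p)" "snd (snd p)"]
      by (auto simp: case_prod_unfold)
    done
  moreover have "continuous_on (I \<times> (B -` S)) (\<lambda>p. f (fst p, B (snd p)))"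
    by (rule continuous_on_compose2[OF smooth_on_imp_continuous_on[OF f]])
      (auto intro!: continuous_intros B.continuous_on)
  ultimately show ?thesis
    unfolding C1_param_def using f' by (intro exI[of _ ?f']) (auto simp: case_prod_unfold)
qed

section \<open>Charts and tangent vectors\<close>

locale atlas =
  fixes A :: "('m, 'e::euclidean_space) chart set"
  assumes smooth_atlas: "smooth_atlas A"
begin

lemma charts_atD [dest]: "c \<in> charts_at A p \<Longrightarrow> c \<in> A" "c \<in> charts_at A p \<Longrightarrow> p \<in> fst c"
  by (auto simp: charts_at_def)

lemma charts_atI: "c \<in> A \<Longrightarrow> p \<in> fst c \<Longrightarrow> c \<in> charts_at A p"
  by (auto simp: charts_at_def)

lemma chart_inj_on: "c \<in> A \<Longrightarrow> inj_on (snd c) (fst c)"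
  using smooth_atlas by (auto simp: smooth_atlas_def)

lemma chart_inv_left [simp]: "c \<in> A \<Longrightarrow> p \<in> fst c \<Longrightarrow> chart_inv c (snd c p) = p"
  by (simp add: chart_inj_on)

lemma chart_inv_right: 
  assumes "x \<in> snd c ` fst c"
  shows "snd c (chart_inv c x) = x" "chart_inv c x \<in> fst c"
  using assms by (auto simp: f_inv_into_f inv_into_into)

lemma open_overlap: "c \<in> A \<Longrightarrow> d \<in> A \<Longrightarrow> open (snd c ` (fst c \<inter> fst d))"
  using smooth_atlas by (auto simp: smooth_atlas_def)

lemma open_chart_image: "c \<in> A \<Longrightarrow> open (snd c ` fst c)"
  using open_overlap[of c c] by simp

lemma smooth_transition:
  "c \<in> A \<Longrightarrow> d \<in> A \<Longrightarrow> smooth_on (snd c ` (fst c \<inter> fst d)) (snd d \<circ> chart_inv c)"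
  using smooth_atlas by (auto simp: smooth_atlas_def)

lemma transition_has_derivative:
  assumes "c \<in> charts_at A p" "d \<in> charts_at A p"
  shows "(snd d \<circ> chart_inv c has_derivative transition_deriv c d p) (at (snd c p))"
  unfolding transition_deriv_def frechet_derivative_works[symmetric]
  by (rule smooth_on_open_derivative(1)[OF smooth_transition[of c d] open_overlap[of c d]]) (use assms in auto)

lemma transition_cocycle:
  assumes "c \<in> charts_at A p" "d \<in> charts_at A p" "e \<in> charts_at A p"
  shows "transition_deriv d e p (transition_deriv c d p x) = transition_deriv c e p x"
proof -
  have cA: "c \<in> A" "d \<in> A" "p \<in> fst c" "p \<in> fst d" using assms by auto
  have "((\<lambda>y. (snd e \<circ> chart_inv d) ((snd d \<circ> chart_inv c) y)) has_derivative
      (\<lambda>x. transition_deriv d e p (transition_deriv c d p x))) (at (snd c p))"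
    by (rule has_derivative_compose[OF transition_has_derivative]) 
      (use assms cA transition_has_derivative[of d p e] in \<open>auto simp: o_def\<close>)
  then have "(snd e \<circ> chart_inv c has_derivative
      (\<lambda>x. transition_deriv d e p (transition_deriv c d p x))) (at (snd c p))"
    by (rule has_derivative_transform_within_open[OF _ open_overlap[OF cA(1,2)]]) (use cA in auto)
  from has_derivative_unique[OF this transition_has_derivative[OF assms(1,3)]]
  show ?thesis by (rule fun_cong)
qed

lemma transition_self:
  assumes "c \<in> charts_at A p"
  shows "transition_deriv c c p x = x"
proof -
  have cA: "c \<in> A" "p \<in> fst c" using assms by auto
  have "(snd c \<circ> chart_inv c has_derivative (\<lambda>x. x)) (at (snd c p))"
    by (rule has_derivative_transform_within_open[OF has_derivative_ident open_chart_image[OF cA(1)]])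
      (use cA in auto)
  from has_derivative_unique[OF this transition_has_derivative[OF assms assms]]
  show ?thesis by (metis)
qed

lemma tvec_of_tangent: "c \<in> charts_at A p \<Longrightarrow> tvec_of A c p x \<in> tangent_space A p"
  by (auto simp: tangent_space_def tvec_of_def transition_cocycle)

lemma tvec_of_coord [simp]: "c \<in> charts_at A p \<Longrightarrow> tvec_of A c p x c = x"
  by (simp add: tvec_of_def transition_self)

text \<open>Injectivity of the charts of the tangent and cotangent bundles rests on this: one
  coordinate vector fixes all the others.\<close>

lemma tvec_of_eq: 
  assumes "c \<in> charts_at A p" "v \<in> tangent_space A p"
  shows "tvec_of A c p (v c) = v"
proof
  fix d
  show "tvec_of A c p (v c) d = v d"
  proof (cases "d \<in> charts_at A p")
    case True
    then have "v d = transition_deriv c d p (v c)"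
      using assms unfolding tangent_space_def by blast
    with True show ?thesis by (simp only: tvec_of_def if_True)
  next
    case False
    then have "v d = 0" using assms unfolding tangent_space_def by blast
    with False show ?thesis by (simp add: tvec_of_def)
  qed
qed

lemma chart_at_charts_at: "p \<in> points A \<Longrightarrow> chart_at A p \<in> charts_at A p"
  unfolding chart_at_def by (rule someI_ex) (auto simp: points_def charts_at_def)

text \<open>All entries of the velocity follow from the derivative in one chart by the chain rule
  with the transition map. This covers time derivatives within [0,T] as well as
  \<epsilon>-derivatives within an open interval, and the curve has to stay in the chart only near
  s.\<close>

lemma velocity_eq:
  assumes c: "c \<in> charts_at A (\<gamma> s)"
    and y: "((snd c \<circ> \<gamma>) has_vector_derivative y) (at s within I)"
    and ev: "eventually (\<lambda>r. \<gamma> r \<in> fst c) (at s within I)"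
    and s: "s \<in> I" "at s within I \<noteq> bot"
  shows "velocity A I \<gamma> s = tvec_of A c (\<gamma> s) y"
proof
  fix d
  have cA: "c \<in> A" "\<gamma> s \<in> fst c" using c by auto
  show "velocity A I \<gamma> s d = tvec_of A c (\<gamma> s) y d"
  proof (cases "d \<in> charts_at A (\<gamma> s)")
    case True
    let ?D = "transition_deriv c d (\<gamma> s)"
    note D = transition_has_derivative[OF c True]
    interpret D: bounded_linear ?D using D by (rule has_derivative_bounded_linear)
    have "((\<lambda>r. (snd d \<circ> chart_inv c) ((snd c \<circ> \<gamma>) r)) has_derivative (\<lambda>h. ?D (h *\<^sub>R y))) (at s within I)"
      by (rule has_derivative_compose[OF y[unfolded has_vector_derivative_def]]) (use D cA in \<open>simp add: o_def\<close>)
    then have "((snd d \<circ> \<gamma>) has_derivative (\<lambda>h. ?D (h *\<^sub>R y))) (at s within I)"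
      by (rule has_derivative_transform_eventually)
        (use ev cA s in \<open>auto elim!: eventually_mono\<close>)
    then have "((snd d \<circ> \<gamma>) has_vector_derivative ?D y) (at s within I)"
      by (simp add: has_vector_derivative_def D.scaleR)
    then show ?thesis
      using True vector_derivative_within[OF s(2)] by (simp add: velocity_def tvec_of_def)
  qed (simp add: velocity_def tvec_of_def)
qed

section \<open>The topology induced by the atlas\<close>

lemma openin_atlas_topology:
  "openin (atlas_topology A) W \<longleftrightarrow> W \<subseteq> points A \<and> (\<forall>c\<in>A. open (snd c ` (W \<inter> fst c)))"
proof -
  \<comment> \<open>\<open>topology\<close> has the prescribed open sets only for a predicate that
    is closed under binary intersections and arbitrary unions.\<close>
  have "istopology (\<lambda>W. W \<subseteq> points A \<and> (\<forall>c\<in>A. open (snd c ` (W \<inter> fst c))))"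
    unfolding istopology_def
  proof (intro conjI allI impI ballI)
    fix V W c assume V: "V \<subseteq> points A \<and> (\<forall>c\<in>A. open (snd c ` (V \<inter> fst c)))"
      and W: "W \<subseteq> points A \<and> (\<forall>c\<in>A. open (snd c ` (W \<inter> fst c)))"
    show "V \<inter> W \<subseteq> points A" using V by auto
    assume c: "c \<in> A"
    have "snd c ` (V \<inter> W \<inter> fst c) = snd c ` (V \<inter> fst c) \<inter> snd c ` (W \<inter> fst c)"
      using inj_on_image_Int[OF chart_inj_on[OF c], of "V \<inter> fst c" "W \<inter> fst c"]
      by (simp add: Int_ac)
    then show "open (snd c ` (V \<inter> W \<inter> fst c))" using V W c by auto
  next
    fix \<W> c assume W: "\<forall>W\<in>\<W>. W \<subseteq> points A \<and> (\<forall>c\<in>A. open (snd c ` (W \<inter> fst c)))"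
    show "\<Union> \<W> \<subseteq> points A" using W by auto
    assume c: "c \<in> A"
    have "snd c ` (\<Union> \<W> \<inter> fst c) = (\<Union>W\<in>\<W>. snd c ` (W \<inter> fst c))" by auto
    then show "open (snd c ` (\<Union> \<W> \<inter> fst c))" using W c by auto
  qed
  then show ?thesis
    unfolding atlas_topology_def by simp
qed

lemma topspace_atlas_topology [simp]: "topspace (atlas_topology A) = points A"
proof (rule antisym)
  show "topspace (atlas_topology A) \<subseteq> points A"
    using openin_atlas_topology[of "topspace (atlas_topology A)"] by simp
  have "openin (atlas_topology A) (points A)"
    unfolding openin_atlas_topology
  proof (intro conjI ballI)
    fix c assume c: "c \<in> A"
    then have "points A \<inter> fst c = fst c" by (auto simp: points_def)
    then show "open (snd c ` (points A \<inter> fst c))" using open_chart_image[OF c] by simp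
  qed simp
  then show "points A \<subseteq> topspace (atlas_topology A)"
    by (rule openin_subset)
qed

lemma openin_chart_domain: "c \<in> A \<Longrightarrow> openin (atlas_topology A) (fst c)"
  using open_overlap by (auto simp: openin_atlas_topology points_def Int_commute)

end

section \<open>Local representatives of the trivialization\<close>

locale trivialized_atlas = atlas A for A :: "('m, 'e::euclidean_space) chart set" +
  fixes \<Phi> :: "'m \<Rightarrow> 'v::euclidean_space \<Rightarrow> ('m, 'e) tvec"
  assumes triv: "trivialization A \<Phi>"
begin

text \<open>\<open>loc c x\<close> is the matrix of \<Phi> at the point with coordinates x, and
  \<open>loc_inv c x\<close> is its inverse. Both are functions of the coordinates, so that they can
  be differentiated in x.\<close>

definition loc :: "('m, 'e) chart \<Rightarrow> 'e \<Rightarrow> 'v \<Rightarrow> 'e" where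
  "loc c x u = \<Phi> (chart_inv c x) u c"

definition loc_inv :: "('m, 'e) chart \<Rightarrow> 'e \<Rightarrow> 'e \<Rightarrow> 'v" where
  "loc_inv c x y = inv (\<Phi> (chart_inv c x)) (tvec_of A c (chart_inv c x) y)"

lemma bij_triv: "p \<in> points A \<Longrightarrow> bij_betw (\<Phi> p) UNIV (tangent_space A p)"
  using triv by (auto simp: trivialization_def)

lemma triv_add: "p \<in> points A \<Longrightarrow> \<Phi> p (u + v) = tv_add (\<Phi> p u) (\<Phi> p v)"
  using triv by (auto simp: trivialization_def)

lemma triv_scale: "p \<in> points A \<Longrightarrow> \<Phi> p (r *\<^sub>R u) = tv_scale r (\<Phi> p u)"
  using triv by (auto simp: trivialization_def)

lemma triv_tangent: "p \<in> points A \<Longrightarrow> \<Phi> p u \<in> tangent_space A p"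
  using bij_triv by (auto simp: bij_betw_def)

lemma inv_triv [simp]: "p \<in> points A \<Longrightarrow> inv (\<Phi> p) (\<Phi> p u) = u"
  using bij_triv[of p] by (auto simp: bij_betw_def)

lemma triv_inv: "p \<in> points A \<Longrightarrow> v \<in> tangent_space A p \<Longrightarrow> \<Phi> p (inv (\<Phi> p) v) = v"
  using bij_triv[of p] by (metis bij_betw_def f_inv_into_f)

lemma points_chart: "c \<in> charts_at A p \<Longrightarrow> p \<in> points A"
  by (auto simp: charts_at_def points_def)

lemma loc_at: "c \<in> charts_at A p \<Longrightarrow> loc c (snd c p) u = \<Phi> p u c"
  by (auto simp: loc_def charts_at_def)

lemma triv_eq_tvec_of: "c \<in> charts_at A p \<Longrightarrow> \<Phi> p u = tvec_of A c p (loc c (snd c p) u)"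
  by (simp add: loc_at tvec_of_eq triv_tangent points_chart)

lemma loc_inv_at: "c \<in> charts_at A p \<Longrightarrow> loc_inv c (snd c p) y = inv (\<Phi> p) (tvec_of A c p y)"
  by (auto simp: loc_inv_def charts_at_def)

lemma loc_inv_loc: "c \<in> charts_at A p \<Longrightarrow> loc_inv c (snd c p) (loc c (snd c p) u) = u"
  by (simp add: loc_inv_at triv_eq_tvec_of[symmetric] points_chart)

lemma loc_loc_inv: "c \<in> charts_at A p \<Longrightarrow> loc c (snd c p) (loc_inv c (snd c p) y) = y"
  by (simp add: loc_inv_at loc_at triv_inv tvec_of_tangent points_chart)

lemma linear_loc: "c \<in> charts_at A p \<Longrightarrow> linear (loc c (snd c p))"
  by (rule linearI)
    (simp_all add: loc_at triv_add triv_scale points_chart tv_add_def tv_scale_def)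

lemma linear_loc_inv: 
  assumes "c \<in> charts_at A p"
  shows "linear (loc_inv c (snd c p))"
proof (rule linearI)
  interpret linear "loc c (snd c p)" by (rule linear_loc[OF assms])
  fix x y r
  show "loc_inv c (snd c p) (x + y) = loc_inv c (snd c p) x + loc_inv c (snd c p) y"
    by (metis assms add loc_inv_loc loc_loc_inv)
  show "loc_inv c (snd c p) (r *\<^sub>R x) = r *\<^sub>R loc_inv c (snd c p) x"
    by (metis assms scale loc_inv_loc loc_loc_inv)
qed

abbreviation "total_map \<equiv> (\<lambda>(p, u). (p, \<Phi> p u))"

lemma points_times_atlas: "points (times_atlas A :: ('m \<times> 'w::real_normed_vector, 'e \<times> 'w) chart set) = points A \<times> UNIV"
  by (auto simp: points_def times_atlas_def)

text \<open>The hypothesis on \<Phi> concerns the map of total spaces. In the product chart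
  \<open>c1\<close> and the bundle chart \<open>c2\<close> that map sends (x, u) to
  \<open>(x, loc c x u)\<close>, and its inverse sends (x, y) to \<open>(x, loc_inv c x y)\<close>.
  Smoothness is kept for the pair; the second component is extracted on the C1 level.\<close>

lemma
  assumes c: "c \<in> A"
  shows smooth_loc: "smooth_on (snd c ` fst c \<times> UNIV) (\<lambda>(x, u). (x, loc c x u))"
    and smooth_loc_inv: "smooth_on (snd c ` fst c \<times> UNIV) (\<lambda>(x, y). (x, loc_inv c x y))"
proof -
  define c1 where "c1 = (fst c \<times> (UNIV :: 'v set), \<lambda>(q, w). (snd c q, w :: 'v))"
  define c2 where "c2 = ({(q, v). q \<in> fst c \<and> v \<in> tangent_space A q}, \<lambda>(q, v :: ('m, 'e) tvec). (snd c q, v c))"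
  have c1: "c1 \<in> times_atlas A" and c2: "c2 \<in> tangent_atlas A"
    using c by (auto simp: times_atlas_def tangent_atlas_def c1_def c2_def)
  have pts: "p \<in> points A" "c \<in> charts_at A p" if "p \<in> fst c" for p
    using c that by (auto simp: points_def charts_at_def)
  have diffeo: "diffeomorphism (times_atlas A) (tangent_atlas A) total_map"
    using triv by (simp add: trivialization_def)
  have inj1: "inj_on (snd c1) (fst c1)"
    using chart_inj_on[OF c] by (auto simp: c1_def inj_on_def)
  have inj2: "inj_on (snd c2) (fst c2)"
  proof (rule inj_onI)
    fix a b assume ab: "a \<in> fst c2" "b \<in> fst c2" "snd c2 a = snd c2 b"
    obtain p v p' w where ab_eq: "a = (p, v)" "b = (p', w)" by (cases a, cases b)
    have p: "p' = p" "p \<in> fst c" "v \<in> tangent_space A p" "w \<in> tangent_space A p" "v c = w c"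
      using ab inj_onD[OF chart_inj_on[OF c]] by (auto simp: c2_def ab_eq)
    have "v = w"
      using tvec_of_eq[OF pts(2)[OF p(2)] p(3)] tvec_of_eq[OF pts(2)[OF p(2)] p(4)] p(5) by metis
    then show "a = b" using p(1) by (simp add: ab_eq)
  qed
  have inv1: "chart_inv c1 (snd c p, u) = (p, u)" if "p \<in> fst c" for p u
    by (rule inv_into_f_eq[OF inj1]) (use that in \<open>auto simp: c1_def\<close>)
  have inv2: "chart_inv c2 (snd c p, y) = (p, tvec_of A c p y)" if "p \<in> fst c" for p y
    by (rule inv_into_f_eq[OF inj2]) 
      (use that in \<open>auto simp: c2_def tvec_of_tangent[OF pts(2)] tvec_of_coord[OF pts(2)]\<close>)
  \<comment> \<open>Fibres over \<open>fst c\<close> go to fibres over \<open>fst c\<close>, so the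
    overlap in the definition of \<open>smooth_map\<close> is the whole chart domain.\<close>
  have "{p \<in> fst c1. total_map p \<in> fst c2} = fst c1"
    using pts by (auto simp: c1_def c2_def triv_tangent)
  moreover have "snd c1 ` fst c1 = snd c ` fst c \<times> UNIV"
    by (auto simp: c1_def image_iff)
  moreover have "smooth_on (snd c1 ` {p \<in> fst c1. total_map p \<in> fst c2}) (snd c2 \<circ> total_map \<circ> chart_inv c1)"
    using diffeo c1 c2 by (auto simp: diffeomorphism_def smooth_map_def)
  ultimately have "smooth_on (snd c ` fst c \<times> UNIV) (snd c2 \<circ> total_map \<circ> chart_inv c1)" by simp
  then show "smooth_on (snd c ` fst c \<times> UNIV) (\<lambda>(x, u). (x, loc c x u))"
    by (rule smooth_on_cong[rotated]) (use c in \<open>auto simp: inv1 c2_def loc_def\<close>)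
  let ?g = "inv_into (points (times_atlas A)) total_map"
  have inj: "inj_on total_map (points (times_atlas A))"
    using diffeo by (auto simp: diffeomorphism_def bij_betw_def)
  have g: "?g (p, v) = (p, inv (\<Phi> p) v)" if "p \<in> points A" "v \<in> tangent_space A p" for p v
    by (rule inv_into_f_eq[OF inj]) (use that in \<open>auto simp: points_times_atlas triv_inv\<close>)
  have "{p \<in> fst c2. ?g p \<in> fst c1} = fst c2"
    using pts by (auto simp: c1_def c2_def g)
  moreover have "snd c2 ` fst c2 = snd c ` fst c \<times> UNIV"
  proof (intro equalityI subsetI)
    fix z assume "z \<in> snd c ` fst c \<times> (UNIV :: 'e set)"
    then obtain p y where p: "p \<in> fst c" and z: "z = (snd c p, y)" by auto
    have "(p, tvec_of A c p y) \<in> fst c2" "snd c2 (p, tvec_of A c p y) = z"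
      using p z pts by (auto simp: c2_def tvec_of_tangent[OF pts(2)] tvec_of_coord[OF pts(2)])
    then show "z \<in> snd c2 ` fst c2" by (metis imageI)
  qed (auto simp: c2_def)
  moreover have "smooth_on (snd c2 ` {p \<in> fst c2. ?g p \<in> fst c1}) (snd c1 \<circ> ?g \<circ> chart_inv c2)"
    using diffeo c1 c2 by (auto simp: diffeomorphism_def smooth_map_def)
  ultimately have "smooth_on (snd c ` fst c \<times> UNIV) (snd c1 \<circ> ?g \<circ> chart_inv c2)" by simp
  then show "smooth_on (snd c ` fst c \<times> UNIV) (\<lambda>(x, y). (x, loc_inv c x y))"
    by (rule smooth_on_cong[rotated]) 
      (use c pts in \<open>auto simp: inv2 c1_def loc_inv_def g tvec_of_tangent[OF pts(2)]\<close>)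
qed

lemma
  assumes c: "c \<in> A"
  shows C1_param_loc: "C1_param I (snd c ` fst c \<times> UNIV) (\<lambda>_ (x, u). loc c x u)"
    and C1_param_loc_inv: "C1_param I (snd c ` fst c \<times> UNIV) (\<lambda>_ (x, y). loc_inv c x y)"
proof -
  have o: "open (snd c ` fst c \<times> (UNIV :: 'w::topological_space set))"
    using open_chart_image[OF c] by (simp add: open_Times)
  from C1_param_linear2[OF bounded_linear_snd smooth_on_C1_param[OF smooth_loc[OF c] o]]
  show "C1_param I (snd c ` fst c \<times> UNIV) (\<lambda>_ (x, u). loc c x u)" 
    by (simp add: case_prod_unfold)
  from C1_param_linear2[OF bounded_linear_snd smooth_on_C1_param[OF smooth_loc_inv[OF c] o]]
  show "C1_param I (snd c ` fst c \<times> UNIV) (\<lambda>_ (x, y). loc_inv c x y)" 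
    by (simp add: case_prod_unfold)
qed

end

section \<open>The local Hamiltonian\<close>

text \<open>
  \<^typ>\<open>'v \<Rightarrow>\<^sub>L real\<close> is not of class \<^class>\<open>euclidean_space\<close>, which the passage from continuous partial
  derivatives to joint continuity of the derivative needs. Momenta are therefore represented by
  vectors of \<open>'v\<close> in local coordinates.
\<close>

definition riesz :: "('v::euclidean_space \<Rightarrow>\<^sub>L real) \<Rightarrow> 'v" where
  "riesz \<nu> = (\<Sum>b\<in>Basis. blinfun_apply \<nu> b *\<^sub>R b)"

lemma inner_riesz: "w \<bullet> riesz \<nu> = blinfun_apply \<nu> w"
proof -
  have "blinfun_apply \<nu> (\<Sum>b\<in>Basis. (w \<bullet> b) *\<^sub>R b) = (\<Sum>b\<in>Basis. (w \<bullet> b) * blinfun_apply \<nu> b)"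
    by (simp add: blinfun.sum_right blinfun.scaleR_right)
  then show ?thesis
    by (simp add: riesz_def inner_sum_right mult.commute euclidean_representation)
qed

lemma blinfun_inner_left_riesz [simp]: "blinfun_inner_left (riesz \<nu>) = \<nu>"
  by (rule blinfun_eqI) (simp add: inner_riesz)

lemma bounded_linear_riesz: "bounded_linear riesz"
  unfolding riesz_def[abs_def]
  by (intro bounded_linear_sum bounded_linear_scaleR_const bounded_linear_intros
      blinfun.bounded_linear_left)

locale hamiltonian_system = trivialized_atlas A \<Phi>
  for A :: "('m, 'e::euclidean_space) chart set"
    and \<Phi> :: "'m \<Rightarrow> 'v::euclidean_space \<Rightarrow> ('m, 'e) tvec" +
  fixes T :: real and H :: "real \<Rightarrow> 'm \<times> ('m, 'e) covec \<Rightarrow> real"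
    and h :: "real \<Rightarrow> 'm \<Rightarrow> ('v \<Rightarrow>\<^sub>L real) \<Rightarrow> real"
  assumes T_pos: "T > 0" and smooth_H: "smooth_hamiltonian A T H"
    and h_def: "h = triv_hamiltonian A \<Phi> H"
begin

definition loc_ham :: "('m, 'e) chart \<Rightarrow> real \<Rightarrow> 'e \<times> 'v \<Rightarrow> real" where
  "loc_ham c t = (\<lambda>(x, m). h t (chart_inv c x) (blinfun_inner_left m))"

text \<open>H is smooth in cotangent coordinates, whereas h takes a momentum in the dual of V. In
  coordinates, passing from the momentum to the covector is the transpose of
  \<open>loc_inv c x\<close>, which is C1 in x and m together. The local Hamiltonian is thus the
  local form of H composed with a C1 map.\<close>

lemma C1_param_loc_ham:
  assumes c: "c \<in> A"
  shows "C1_param {0..T} (snd c ` fst c \<times> UNIV) (loc_ham c)"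
proof -
  let ?U = "snd c ` fst c"
  define c3 where "c3 = ({(q, \<alpha>). q \<in> fst c \<and> \<alpha> \<in> cotangent_space A q},
           \<lambda>(q, \<alpha>). (snd c q, Blinfun (\<lambda>x. \<alpha> (tvec_of A c q x)) :: 'e \<Rightarrow>\<^sub>L real))"
  have c3: "c3 \<in> cotangent_atlas A"
    using c by (auto simp: cotangent_atlas_def c3_def)
  have pts: "p \<in> points A" "c \<in> charts_at A p" if "p \<in> fst c" for p
    using c that by (auto simp: points_def charts_at_def)
  have tvec_of_add: "tvec_of A c p (x + y) = tv_add (tvec_of A c p x) (tvec_of A c p y)"
    and tvec_of_scale: "tvec_of A c p (r *\<^sub>R x) = tv_scale r (tvec_of A c p x)" 
    if "p \<in> fst c" for p x y r
  proof -
    have "linear (transition_deriv c d p)" if "d \<in> charts_at A p" for d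
      using transition_has_derivative[OF pts(2)[OF \<open>p \<in> fst c\<close>] that] 
      by (rule has_derivative_linear)
    then show "tvec_of A c p (x + y) = tv_add (tvec_of A c p x) (tvec_of A c p y)"
       "tvec_of A c p (r *\<^sub>R x) = tv_scale r (tvec_of A c p x)"
      by (auto simp: tvec_of_def tv_add_def tv_scale_def linear_add linear_scale)
  qed
  \<comment> \<open>\<open>Blinfun\<close> is faithful only on bounded linear maps, so linearity in
    coordinates comes before any use of the cotangent chart.\<close>
  have cov_lin: "bounded_linear (\<lambda>x. \<alpha> (tvec_of A c p x))" 
    if p: "p \<in> fst c" and \<alpha>: "\<alpha> \<in> cotangent_space A p" for p \<alpha>
    unfolding linear_conv_bounded_linear[symmetric]
    using \<alpha> by (intro linearI)
      (auto simp: cotangent_space_def tvec_of_add[OF p] tvec_of_scale[OF p] tvec_of_tangent[OF pts(2)[OF p]])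
  have inj3: "inj_on (snd c3) (fst c3)"
  proof (rule inj_onI)
    fix a b assume ab: "a \<in> fst c3" "b \<in> fst c3" "snd c3 a = snd c3 b"
    obtain p \<alpha> p' \<beta> where ab_eq: "a = (p, \<alpha>)" "b = (p', \<beta>)" by (cases a, cases b)
    have p: "p' = p" "p \<in> fst c" "\<alpha> \<in> cotangent_space A p" "\<beta> \<in> cotangent_space A p"
      using ab inj_onD[OF chart_inj_on[OF c]] by (auto simp: c3_def ab_eq)
    have "Blinfun (\<lambda>x. \<alpha> (tvec_of A c p x)) = Blinfun (\<lambda>x. \<beta> (tvec_of A c p x))"
      using ab p(1) by (auto simp: c3_def ab_eq)
    then have eq: "\<alpha> (tvec_of A c p x) = \<beta> (tvec_of A c p x)" for x
      using bounded_linear_Blinfun_apply[OF cov_lin[OF p(2,3)]] 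
        bounded_linear_Blinfun_apply[OF cov_lin[OF p(2,4)]] by metis
    have "\<alpha> v = \<beta> v" for v
    proof (cases "v \<in> tangent_space A p")
      case True
      from eq[of "v c"] show ?thesis by (simp add: tvec_of_eq[OF pts(2)[OF p(2)] True])
    next
      case False
      then show ?thesis using p(3,4) by (auto simp: cotangent_space_def)
    qed
    then show "a = b" using p(1) by (auto simp: ab_eq)
  qed
  \<comment> \<open>Every functional \<pi> on coordinates is attained: it is pulled back to the
    tangent space at p and extended by 0, as covectors are.\<close>
  have image3: "snd c3 ` fst c3 = ?U \<times> UNIV"
  proof (intro equalityI subsetI)
    fix z assume "z \<in> ?U \<times> (UNIV :: ('e \<Rightarrow>\<^sub>L real) set)"
    then obtain p \<pi> where p: "p \<in> fst c" and z: "z = (snd c p, \<pi>)" by auto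
    define \<alpha> where "\<alpha> v = (if v \<in> tangent_space A p then blinfun_apply \<pi> (v c) else 0)" for v
    have closed: "tv_add v w \<in> tangent_space A p" "tv_scale r v \<in> tangent_space A p"
      if "v \<in> tangent_space A p" "w \<in> tangent_space A p" for v w r
      using that tvec_of_add[OF p, of "v c" "w c"] tvec_of_scale[OF p, of r "v c"]
        tvec_of_tangent[OF pts(2)[OF p]] tvec_of_eq[OF pts(2)[OF p]] by metis+
    have "\<alpha> \<in> cotangent_space A p"
      using closed by (auto simp: cotangent_space_def \<alpha>_def tv_add_def tv_scale_def 
          blinfun.add_right blinfun.scaleR_right)
    moreover have "Blinfun (\<lambda>x. \<alpha> (tvec_of A c p x)) = \<pi>"
      by (simp add: \<alpha>_def tvec_of_tangent[OF pts(2)[OF p]] tvec_of_coord[OF pts(2)[OF p]] blinfun_apply_inverse)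
    ultimately have "(p, \<alpha>) \<in> fst c3" "snd c3 (p, \<alpha>) = z"
      using p z by (auto simp: c3_def)
    then show "z \<in> snd c3 ` fst c3" by (metis imageI)
  qed (auto simp: c3_def)
  \<comment> \<open>The transpose of the inverse matrix, written in the standard basis:
    \<open>y \<bullet> S (x, m) = loc_inv c x y \<bullet> m\<close>.\<close>
  define S where "S = (\<lambda>(x, m). \<Sum>b\<in>Basis. (m \<bullet> loc_inv c x b) *\<^sub>R b)"
  have inv3: "chart_inv c3 (snd c p, blinfun_inner_left (S (snd c p, m))) 
      = (p, triv_dual_inv A \<Phi> p (blinfun_inner_left m))" if p: "p \<in> fst c" for p m
  proof (rule inv_into_f_eq[OF inj3])
    let ?\<alpha> = "triv_dual_inv A \<Phi> p (blinfun_inner_left m)"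
    interpret linear "loc_inv c (snd c p)" by (rule linear_loc_inv[OF pts(2)[OF p]])
    have \<alpha>: "?\<alpha> v = loc_inv c (snd c p) (v c) \<bullet> m" if "v \<in> tangent_space A p" for v
      using that by (simp add: triv_dual_inv_def loc_inv_at[OF pts(2)[OF p]] tvec_of_eq[OF pts(2)[OF p]])
    have closed: "tv_add v w \<in> tangent_space A p" "tv_scale r v \<in> tangent_space A p"
      if "v \<in> tangent_space A p" "w \<in> tangent_space A p" for v w r
      using that tvec_of_add[OF p, of "v c" "w c"] tvec_of_scale[OF p, of r "v c"]
        tvec_of_tangent[OF pts(2)[OF p]] tvec_of_eq[OF pts(2)[OF p]] by metis+
    have "?\<alpha> \<in> cotangent_space A p"
      unfolding cotangent_space_def using closed
      by (auto simp: \<alpha>) (auto simp: tv_add_def tv_scale_def triv_dual_inv_def add scale inner_add_left)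
    then show "(p, ?\<alpha>) \<in> fst c3" using p by (simp add: c3_def)
    have bl: "bounded_linear (\<lambda>y. loc_inv c (snd c p) y \<bullet> m)"
      unfolding linear_conv_bounded_linear[symmetric] by (rule linearI) (simp_all add: add scale inner_add_left)
    have "y \<bullet> S (snd c p, m) = loc_inv c (snd c p) (\<Sum>b\<in>Basis. (y \<bullet> b) *\<^sub>R b) \<bullet> m" for y
      by (simp add: S_def inner_sum_right inner_sum_left sum scale inner_commute mult.commute)
    then have "Blinfun (\<lambda>x. ?\<alpha> (tvec_of A c p x)) = blinfun_inner_left (S (snd c p, m))"
      by (intro blinfun_eqI)
        (simp add: bounded_linear_Blinfun_apply[OF bl] \<alpha> tvec_of_tangent[OF pts(2)[OF p]] 
         tvec_of_coord[OF pts(2)[OF p]] euclidean_representation)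
    then show "snd c3 (p, ?\<alpha>) = (snd c p, blinfun_inner_left (S (snd c p, m)))"
      by (simp add: c3_def)
  qed
  \<comment> \<open>Momentum coordinates are parametrized by vectors, to meet the Euclidean domain
    in \<open>smooth_on_time_C1_param\<close>.\<close>
  let ?B = "\<lambda>z::'e \<times> 'e. (fst z, blinfun_inner_left (snd z))"
  have "smooth_on ({0..T} \<times> (?U \<times> UNIV)) (\<lambda>(t, z). H t (chart_inv c3 z))"
    using bspec[OF smooth_H[unfolded smooth_hamiltonian_def] c3] by (simp add: image3)
  moreover have "open (?U \<times> (UNIV :: ('e \<Rightarrow>\<^sub>L real) set))"
    using open_chart_image[OF c] by (simp add: open_Times)
  moreover have B: "bounded_linear ?B"
    by (intro bounded_linear_intros bounded_linear_compose[OF bounded_linear_blinfun_inner_left])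
  ultimately have "C1_param {0..T} (?B -` (?U \<times> UNIV)) (\<lambda>t z. (\<lambda>(t, z). H t (chart_inv c3 z)) (t, ?B z))"
    by (rule smooth_on_time_C1_param)
  moreover have "?B -` (?U \<times> UNIV) = ?U \<times> UNIV" by auto
  ultimately have G: "C1_param {0..T} (?U \<times> UNIV) (\<lambda>t z. H t (chart_inv c3 (?B z)))"
    by simp
  have S: "C1_param {0..T} (?U \<times> UNIV) (\<lambda>_. S)"
  proof -
    have "C1_param {0..T} (?U \<times> UNIV) (\<lambda>_ z. \<Sum>b\<in>Basis. (snd z \<bullet> loc_inv c (fst z) b) *\<^sub>R b)"
    proof (intro C1_param_sum finite_Basis C1_param_bilinear2[OF bounded_bilinear_scaleR]
        C1_param_bilinear2[OF bounded_bilinear_inner] C1_param_const)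
      fix b :: 'e
      show "C1_param {0..T} (?U \<times> UNIV) (\<lambda>_ z::'e \<times> 'v. snd z)"
        by (intro C1_param_linear bounded_linear_intros)
      have "C1_param {0..T} (?U \<times> UNIV) (\<lambda>_ z::'e \<times> 'v. (fst z, b))"
        by (intro C1_param_Pair C1_param_linear C1_param_const bounded_linear_intros)
      from C1_param_compose[OF C1_param_loc_inv[OF c] this]
      show "C1_param {0..T} (?U \<times> UNIV) (\<lambda>_ z::'e \<times> 'v. loc_inv c (fst z) b)"
        by auto
    qed
    then show ?thesis by (simp add: S_def case_prod_unfold)
  qed
  have "C1_param {0..T} (?U \<times> UNIV) (\<lambda>t z. H t (chart_inv c3 (?B (fst z, S z))))"
    by (rule C1_param_compose[OF G C1_param_Pair[OF _ S]]) (auto intro!: C1_param_linear bounded_linear_intros)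
  moreover have "loc_ham c t z = H t (chart_inv c3 (?B (fst z, S z)))" if "z \<in> ?U \<times> UNIV" for t z
    using that c unfolding loc_ham_def by (auto simp: h_def triv_hamiltonian_def inv3)
  ultimately show ?thesis
    by (intro C1_param_cong[of "?U \<times> UNIV" _ "loc_ham c"]) 
      (use open_chart_image[OF c] in \<open>auto simp: open_Times\<close>)
qed

text \<open>The functional \<nu> \<mapsto> D (0, riesz \<nu>) is evaluation at the vector w
  assembled from the values of D on the basis of momenta. Evaluations at different vectors are
  different functionals, so the description by \<open>THE\<close> picks out this w.\<close>

lemma D_mu_eq:
  assumes t: "t \<in> {0..T}" and c: "c \<in> charts_at A p" 
    and D: "(loc_ham c t has_derivative D) (at (snd c p, riesz \<mu>))"
  shows "blinfun_apply \<nu> (D_mu h t p \<mu>) = D (0, riesz \<nu>)"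
proof -
  interpret D: bounded_linear D using D by (rule has_derivative_bounded_linear)
  define w where "w = (\<Sum>b\<in>Basis. D (0, b) *\<^sub>R b)"
  have D_riesz: "D (0, riesz \<nu>) = blinfun_apply \<nu> w" for \<nu>
  proof -
    have "(0, riesz \<nu>) = (\<Sum>b\<in>Basis. blinfun_apply \<nu> b *\<^sub>R (0 :: 'e, b))"
      by (simp add: riesz_def sum_prod prod_eq_iff fst_sum snd_sum)
    then have "D (0, riesz \<nu>) = (\<Sum>b\<in>Basis. blinfun_apply \<nu> b * D (0, b))"
      by (simp only: D.sum D.scaleR real_scaleR_def)
    then show ?thesis 
      by (simp add: w_def blinfun.sum_right blinfun.scaleR_right mult.commute)
  qed
  have "((\<lambda>\<nu>. loc_ham c t (snd c p, riesz \<nu>)) has_derivative (\<lambda>\<nu>. D (0, riesz \<nu>))) (at \<mu>)"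
    by (rule has_derivative_compose[OF has_derivative_Pair[OF has_derivative_const 
       bounded_linear.has_derivative[OF bounded_linear_riesz has_derivative_ident]] D])
  then have *: "((\<lambda>\<nu>. h t p \<nu>) has_derivative (\<lambda>\<nu>. blinfun_apply \<nu> w)) (at \<mu>)"
    using c by (auto simp: loc_ham_def D_riesz charts_at_def)
  have "D_mu h t p \<mu> = w"
    unfolding D_mu_def
  proof (rule the_equality[where P = "\<lambda>w. ((\<lambda>\<nu>. h t p \<nu>) has_derivative (\<lambda>\<nu>. blinfun_apply \<nu> w)) (at \<mu>)", OF *])
    fix w' assume "((\<lambda>\<nu>. h t p \<nu>) has_derivative (\<lambda>\<nu>. blinfun_apply \<nu> w')) (at \<mu>)"
    from has_derivative_unique[OF this *] 
    have "blinfun_apply (blinfun_inner_left x) w' = blinfun_apply (blinfun_inner_left x) w" for x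
      by (rule fun_cong)
    then show "w' = w" by (simp add: inner_commute euclidean_eq_iff[of w'])
  qed
  then show ?thesis by (simp add: D_riesz)
qed

lemma D_q_eq:
  assumes t: "t \<in> {0..T}" and p: "p \<in> points A" and c: "c = chart_at A p"
    and D: "(loc_ham c t has_derivative D) (at (snd c p, riesz \<mu>))" and v: "v \<in> tangent_space A p"
  shows "D_q A h t p \<mu> v = D (v c, 0)"
proof -
  have "((\<lambda>x. loc_ham c t (x, riesz \<mu>)) has_derivative (\<lambda>x. D (x, 0))) (at (snd c p))"
    by (rule has_derivative_compose[OF has_derivative_Pair[OF has_derivative_ident has_derivative_const] D])
  then have "(((\<lambda>x. h t x \<mu>) \<circ> chart_inv c) has_derivative (\<lambda>x. D (x, 0))) (at (snd c p))"
    by (simp add: loc_ham_def o_def)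
  from fun_cong[OF frechet_derivative_at[OF this], of "v c"] v
  show ?thesis by (simp add: D_q_def differential_def Let_def c)
qed

end

section \<open>Families of curves\<close>

text \<open>Uniqueness of derivatives within [0,T], also at both endpoints, depends on this.\<close>

lemma at_within_Icc_0_nontrivial:
  assumes "t \<in> {0..T}" "0 < (T::real)"
  shows "at t within {0..T} \<noteq> bot"
proof -
  have "t islimpt {0..T}"
  proof (cases "t < T")
    case True
    then show ?thesis 
      using islimpt_subset[OF islimpt_greaterThanLessThan1[OF True], of "{0..T}"] assms by fastforce
  next
    case False
    then have "0 < t" using assms by simp
    then show ?thesis 
      using islimpt_subset[OF islimpt_greaterThanLessThan2, of 0 t "{0..T}"] assms by fastforce
  qed
  then show ?thesis by (simp add: trivial_limit_within)
qed

abbreviation strip :: "real \<Rightarrow> real \<Rightarrow> (real \<times> real) set" where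
  "strip a T \<equiv> {-a<..<a} \<times> {0..T}"

text \<open>A slice of a relatively open D is a neighbourhood of each of its points in the slice of
  the strip. The \<epsilon>-range is open, so \<epsilon>-derivatives are two-sided; the t-range is
  closed, so time derivatives stay one-sided at 0 and T.\<close>

lemma strip_slices:
  assumes D: "openin (top_of_set (strip a T)) D" and p: "(\<epsilon>, t) \<in> D"
  shows "at t within {s. (\<epsilon>, s) \<in> D} = at t within {0..T}"
    and "at \<epsilon> within {r. (r, t) \<in> D} = at \<epsilon>"
    and "eventually (\<lambda>s. (\<epsilon>, s) \<in> D) (at t within {0..T})"
    and "eventually (\<lambda>r. (r, t) \<in> D) (at \<epsilon>)"
proof -
  obtain U where U: "open U" "D = strip a T \<inter> U" using D by (auto simp: openin_open)
  have o1: "open (Pair \<epsilon> -` U)" by (intro open_vimage U continuous_intros)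
  have o2: "open ((\<lambda>r. (r, t)) -` U \<inter> {-a<..<a})" by (intro open_Int open_vimage U continuous_intros)
  show "at t within {s. (\<epsilon>, s) \<in> D} = at t within {0..T}"
    by (rule at_within_nhd[OF _ o1]) (use p U in auto)
  show "at \<epsilon> within {r. (r, t) \<in> D} = at \<epsilon>"
    by (rule at_within_nhd[OF _ o2]) (use p U in auto)
  show "eventually (\<lambda>s. (\<epsilon>, s) \<in> D) (at t within {0..T})"
    unfolding eventually_at_topological
    using o1 p U by (intro exI[of _ "Pair \<epsilon> -` U"]) auto
  show "eventually (\<lambda>r. (r, t) \<in> D) (at \<epsilon>)"
    unfolding eventually_at_topological
    using o2 p U by (intro exI[of _ "(\<lambda>r. (r, t)) -` U \<inter> {-a<..<a}"]) auto
qed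

lemma C1_family_on_strip:
  assumes D: "openin (top_of_set (strip a T)) D"
  shows "C1_family_on D x \<longleftrightarrow>
     (\<exists>xt xe xet.
        (\<forall>(\<epsilon>, t)\<in>D.
           ((\<lambda>s. x \<epsilon> s) has_vector_derivative xt \<epsilon> t) (at t within {0..T}) \<and>
           ((\<lambda>r. x r t) has_vector_derivative xe \<epsilon> t) (at \<epsilon>) \<and>
           ((\<lambda>r. xt r t) has_vector_derivative xet \<epsilon> t) (at \<epsilon>)) \<and>
        continuous_on D (\<lambda>(\<epsilon>, t). x \<epsilon> t) \<and> continuous_on D (\<lambda>(\<epsilon>, t). xt \<epsilon> t) \<and>
        continuous_on D (\<lambda>(\<epsilon>, t). xe \<epsilon> t) \<and> continuous_on D (\<lambda>(\<epsilon>, t). xet \<epsilon> t))"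
proof -
  have *: "(\<forall>(\<epsilon>, t)\<in>D. P \<epsilon> t (at t within {s. (\<epsilon>, s) \<in> D}) (at \<epsilon> within {r. (r, t) \<in> D})) \<longleftrightarrow>
      (\<forall>(\<epsilon>, t)\<in>D. P \<epsilon> t (at t within {0..T}) (at \<epsilon>))" for P
    using strip_slices(1,2)[OF D] by fastforce
  show ?thesis
    unfolding C1_family_on_def
    by (subst *[where P = "\<lambda>\<epsilon> t F G. (x \<epsilon> has_vector_derivative _ \<epsilon> t) F \<and>
           ((\<lambda>r. x r t) has_vector_derivative _ \<epsilon> t) G \<and>
           ((\<lambda>r. _ r t) has_vector_derivative _ \<epsilon> t) G"]) (rule refl)
qed

text \<open>
  Only the derivative of \<open>xt\<close> in \<open>\<epsilon>\<close> is given; writing \<open>x \<epsilon> s - x \<epsilon> l\<close> as the integral of \<open>xt \<epsilon>\<close>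
  and differentiating under the integral sign gives the derivative of \<open>xe\<close> in time.
\<close>

lemma mixed_partial:
  fixes x :: "real \<Rightarrow> real \<Rightarrow> 'b::banach"
  assumes D: "openin (top_of_set (strip a T)) D" and p: "(\<epsilon>, t) \<in> D"
    and der: "\<And>\<epsilon> t. (\<epsilon>, t) \<in> D \<Longrightarrow> ((\<lambda>s. x \<epsilon> s) has_vector_derivative xt \<epsilon> t) (at t within {0..T})"
      "\<And>\<epsilon> t. (\<epsilon>, t) \<in> D \<Longrightarrow> ((\<lambda>r. x r t) has_vector_derivative xe \<epsilon> t) (at \<epsilon>)"
      "\<And>\<epsilon> t. (\<epsilon>, t) \<in> D \<Longrightarrow> ((\<lambda>r. xt r t) has_vector_derivative xet \<epsilon> t) (at \<epsilon>)"
    and cont: "continuous_on D (\<lambda>(\<epsilon>, t). xt \<epsilon> t)" "continuous_on D (\<lambda>(\<epsilon>, t). xet \<epsilon> t)"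
  shows "((\<lambda>s. xe \<epsilon> s) has_vector_derivative xet \<epsilon> t) (at t within {0..T})"
proof -
  obtain V where V: "open V" "D = strip a T \<inter> V" using D by (auto simp: openin_open)
  have "open (V \<inter> {-a<..<a} \<times> UNIV)" using V by (intro open_Int open_Times) auto
  moreover have "(\<epsilon>, t) \<in> V \<inter> {-a<..<a} \<times> UNIV" using p V by auto
  ultimately obtain A B where "open A" "open B" "(\<epsilon>, t) \<in> A \<times> B" "A \<times> B \<subseteq> V \<inter> {-a<..<a} \<times> UNIV"
    by (rule open_prod_elim)
  then have AB: "open A" "open B" "\<epsilon> \<in> A" "t \<in> B" "A \<times> B \<subseteq> V \<inter> {-a<..<a} \<times> UNIV" by auto
  obtain d1 where d1: "d1 > 0" "cball \<epsilon> d1 \<subseteq> A" using AB open_contains_cball by metis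
  obtain d2 where d2: "d2 > 0" "cball t d2 \<subseteq> B" using AB open_contains_cball by metis
  \<comment> \<open>Clipping the ball around t to [0,T] leaves a closed interval whose filter at t
    is still that of [0,T].\<close>
  define l u where "l = max 0 (t - d2)" and "u = min T (t + d2)"
  have t: "t \<in> {0..T}" using p V by auto
  then have tJ: "t \<in> {l..u}" using d2 by (auto simp: l_def u_def)
  \<comment> \<open>The Leibniz rule asks for a convex set of parameters, and its product with [l,u]
    has to lie in D.\<close>
  define U where "U = {\<epsilon> - d1..\<epsilon> + d1}"
  have UJ: "(r, s) \<in> D" if "r \<in> U" "s \<in> {l..u}" for r s
  proof -
    have "r \<in> A" using that(1) d1(2) by (auto simp: U_def cball_def dist_real_def subset_iff)
    moreover have "s \<in> B" using that(2) d2(2) by (auto simp: l_def u_def cball_def dist_real_def subset_iff)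
    moreover have "s \<in> {0..T}" using that(2) by (auto simp: l_def u_def)
    ultimately show ?thesis using AB(5) V(2) by auto
  qed
  have J: "{l..u} \<subseteq> {0..T}" by (auto simp: l_def u_def)
  have slice: "continuous_on {l..s} (g r)" 
    if "continuous_on D (\<lambda>(\<epsilon>, t). g \<epsilon> t)" "r \<in> U" "s \<in> {l..u}" for g :: "real \<Rightarrow> real \<Rightarrow> 'b" and r s
  proof -
    have "continuous_on {l..s} (\<lambda>w. (\<lambda>(\<epsilon>, t). g \<epsilon> t) (r, w))"
      by (rule continuous_on_compose2[OF that(1)]) (use that UJ in \<open>auto intro!: continuous_intros\<close>)
    then show ?thesis by simp
  qed
  have \<epsilon>U: "\<epsilon> \<in> U" using d1 by (auto simp: U_def)
  have eq: "xe \<epsilon> s = xe \<epsilon> l + integral {l..s} (xet \<epsilon>)" if s: "s \<in> {l..u}" for s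
  proof -
    have lJ: "l \<in> {l..u}" using tJ by auto
    have int: "integral {l..s} (xt r) = x r s - x r l" if r: "r \<in> U" for r
    proof (rule integral_unique, rule fundamental_theorem_of_calculus)
      show "l \<le> s" using s by auto
      fix w assume w: "w \<in> {l..s}"
      then have "{l..s} \<subseteq> {0..T}" "(r, w) \<in> D" using J s UJ[OF r] by auto
      then show "(x r has_vector_derivative xt r w) (at w within {l..s})"
        using has_vector_derivative_within_subset[OF der(1)] by blast
    qed
    have "continuous_on (U \<times> cbox l s) (\<lambda>(r, t). xet r t)"
      by (rule continuous_on_subset[OF cont(2)]) (use UJ s in \<open>auto simp: subset_iff\<close>)
    then have "((\<lambda>r. integral (cbox l s) (xt r)) has_vector_derivative integral (cbox l s) (xet \<epsilon>)) (at \<epsilon> within U)"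
    proof (rule leibniz_rule_vector_derivative[rotated 2])
      show "((\<lambda>r. xt r w) has_vector_derivative xet r w) (at r within U)" 
        if "r \<in> U" "w \<in> cbox l s" for r w
        using der(3)[OF UJ] that s by (auto intro: has_vector_derivative_at_within)
      show "xt r integrable_on cbox l s" if "r \<in> U" for r
        using slice[OF cont(1) that s] by (auto intro: integrable_continuous_interval)
    qed (use \<epsilon>U in \<open>auto simp: U_def\<close>)
    then have "((\<lambda>r. x r s - x r l) has_vector_derivative integral {l..s} (xet \<epsilon>)) (at \<epsilon> within U)"
      using has_vector_derivative_transform[OF \<epsilon>U int[symmetric]] by simp
    moreover have "at \<epsilon> within U = at \<epsilon>"
      by (rule at_within_interior) (use d1 in \<open>auto simp: U_def\<close>)
    moreover have "((\<lambda>r. x r s - x r l) has_vector_derivative xe \<epsilon> s - xe \<epsilon> l) (at \<epsilon>)"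
      by (intro has_vector_derivative_diff der(2) UJ \<epsilon>U s lJ)
    ultimately have "xe \<epsilon> s - xe \<epsilon> l = integral {l..s} (xet \<epsilon>)"
      using vector_derivative_unique_at by metis
    then show ?thesis by (simp add: algebra_simps)
  qed
  have "((\<lambda>s. xe \<epsilon> l + integral {l..s} (xet \<epsilon>)) has_vector_derivative 0 + xet \<epsilon> t) (at t within {l..u})"
    by (intro has_vector_derivative_add has_vector_derivative_const 
        integral_has_vector_derivative slice[OF cont(2) \<epsilon>U] tJ) (use tJ in auto)
  then have "((\<lambda>s. xe \<epsilon> s) has_vector_derivative xet \<epsilon> t) (at t within {l..u})"
    using has_vector_derivative_transform[OF tJ eq] by simp
  moreover have "at t within {l..u} = at t within {0..T}"
    by (rule at_within_nhd[OF _ open_ball, of _ t d2]) 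
      (use d2 in \<open>auto simp: l_def u_def ball_def dist_real_def\<close>)
  ultimately show ?thesis by simp
qed

section \<open>The integrand of the action and differentiation under the integral sign\<close>

context hamiltonian_system
begin

definition lagr :: "(real \<Rightarrow> 'm) \<Rightarrow> (real \<Rightarrow> 'v \<Rightarrow>\<^sub>L real) \<Rightarrow> real \<Rightarrow> real" where
  "lagr q \<mu> t = blinfun_apply (\<mu> t) (triv_velocity A \<Phi> T q t) - h t (q t) (\<mu> t)"

definition loc_lagr :: "('m, 'e) chart \<Rightarrow> real \<Rightarrow> 'e \<times> 'e \<times> 'v \<Rightarrow> real" where
  "loc_lagr c t = (\<lambda>(x, y, m). loc_inv c x y \<bullet> m - loc_ham c t (x, m))"

lemma C1_param_loc_lagr:
  assumes c: "c \<in> A"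
  shows "C1_param {0..T} (snd c ` fst c \<times> UNIV \<times> UNIV) (loc_lagr c)"
proof -
  let ?R = "snd c ` fst c \<times> (UNIV :: 'e set) \<times> (UNIV :: 'v set)"
  have 1: "C1_param {0..T} ?R (\<lambda>_ z. (fst z, fst (snd z)))" "C1_param {0..T} ?R (\<lambda>_ z. (fst z, snd (snd z)))"
    "C1_param {0..T} ?R (\<lambda>_ z. snd (snd z))"
    by (intro C1_param_linear bounded_linear_intros)+
  from C1_param_compose[OF C1_param_loc_inv[OF c] 1(1)] C1_param_compose[OF C1_param_loc_ham[OF c] 1(2)]
  have "C1_param {0..T} ?R (\<lambda>t z. loc_inv c (fst z) (fst (snd z)) \<bullet> snd (snd z) - loc_ham c t (fst z, snd (snd z)))"
    by (intro C1_param_diff C1_param_bilinear2[OF bounded_bilinear_inner] 1) auto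
  then show ?thesis
    unfolding loc_lagr_def[abs_def] by (simp add: case_prod_unfold)
qed

lemma triv_velocity_eq:
  assumes c: "c \<in> charts_at A (\<gamma> t)" and t: "t \<in> {0..T}"
    and y: "((\<lambda>s. snd c (\<gamma> s)) has_vector_derivative y) (at t within {0..T})"
    and ev: "eventually (\<lambda>s. \<gamma> s \<in> fst c) (at t within {0..T})"
  shows "velocity A {0..T} \<gamma> t = tvec_of A c (\<gamma> t) y"
    and "triv_velocity A \<Phi> T \<gamma> t = loc_inv c (snd c (\<gamma> t)) y"
proof -
  show *: "velocity A {0..T} \<gamma> t = tvec_of A c (\<gamma> t) y"
    by (rule velocity_eq[OF c _ ev t at_within_Icc_0_nontrivial[OF t T_pos]]) (use y in \<open>simp add: o_def\<close>)
  show "triv_velocity A \<Phi> T \<gamma> t = loc_inv c (snd c (\<gamma> t)) y"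
    by (simp add: triv_velocity_def * loc_inv_at[OF c])
qed

definition chart_part :: "real \<Rightarrow> (real \<Rightarrow> real \<Rightarrow> 'm) \<Rightarrow> ('m, 'e) chart \<Rightarrow> (real \<times> real) set" where
  "chart_part a qf c = {(\<epsilon>, t). \<epsilon> \<in> {-a<..<a} \<and> t \<in> {0..T} \<and> qf \<epsilon> t \<in> fst c}"

lemma openin_chart_part:
  assumes "continuous_map (top_of_set (strip a T)) (atlas_topology A) (\<lambda>(\<epsilon>, t). qf \<epsilon> t)" "c \<in> A"
  shows "openin (top_of_set (strip a T)) (chart_part a qf c)"
proof -
  have "chart_part a qf c = {p \<in> topspace (top_of_set (strip a T)). (case p of (\<epsilon>, t) \<Rightarrow> qf \<epsilon> t) \<in> fst c}"
    by (auto simp: chart_part_def)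
  then show ?thesis
    using openin_continuous_map_preimage[OF assms(1) openin_chart_domain[OF assms(2)]] by simp
qed

lemma family_chartE:
  assumes fam: "variation_family A \<Phi> T q\<^sub>0 q \<mu> \<eta> \<delta>\<mu> a qf \<mu>f" and c: "c \<in> A"
  obtains xt xe xet \<mu>e where
    "\<And>\<epsilon> t. (\<epsilon>, t) \<in> chart_part a qf c \<Longrightarrow> 
        ((\<lambda>s. snd c (qf \<epsilon> s)) has_vector_derivative xt \<epsilon> t) (at t within {0..T})"
    "\<And>\<epsilon> t. (\<epsilon>, t) \<in> chart_part a qf c \<Longrightarrow> ((\<lambda>r. snd c (qf r t)) has_vector_derivative xe \<epsilon> t) (at \<epsilon>)"
    "\<And>\<epsilon> t. (\<epsilon>, t) \<in> chart_part a qf c \<Longrightarrow> ((\<lambda>r. xt r t) has_vector_derivative xet \<epsilon> t) (at \<epsilon>)"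
    "\<And>\<epsilon> t. (\<epsilon>, t) \<in> chart_part a qf c \<Longrightarrow> ((\<lambda>r. \<mu>f r t) has_vector_derivative \<mu>e \<epsilon> t) (at \<epsilon>)"
    "continuous_on (chart_part a qf c) (\<lambda>(\<epsilon>, t). snd c (qf \<epsilon> t))"
    "continuous_on (chart_part a qf c) (\<lambda>(\<epsilon>, t). xt \<epsilon> t)"
    "continuous_on (chart_part a qf c) (\<lambda>(\<epsilon>, t). xe \<epsilon> t)"
    "continuous_on (chart_part a qf c) (\<lambda>(\<epsilon>, t). xet \<epsilon> t)"
    "continuous_on (chart_part a qf c) (\<lambda>(\<epsilon>, t). \<mu>f \<epsilon> t)"
    "continuous_on (chart_part a qf c) (\<lambda>(\<epsilon>, t). \<mu>e \<epsilon> t)"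
    "\<And>\<epsilon> t. (\<epsilon>, t) \<in> chart_part a qf c \<Longrightarrow> 
        triv_velocity A \<Phi> T (qf \<epsilon>) t = loc_inv c (snd c (qf \<epsilon> t)) (xt \<epsilon> t)"
proof -
  let ?D = "chart_part a qf c"
  have cont: "continuous_map (top_of_set (strip a T)) (atlas_topology A) (\<lambda>(\<epsilon>, t). qf \<epsilon> t)"
    and x: "C1_family_on ?D (\<lambda>\<epsilon> t. snd c (qf \<epsilon> t))" and \<mu>: "C1_family_on (strip a T) \<mu>f"
    using fam c by (auto simp: variation_family_def chart_part_def)
  note D = openin_chart_part[OF cont c]
  obtain xt xe xet where X: "\<forall>(\<epsilon>, t)\<in>?D.
           ((\<lambda>s. snd c (qf \<epsilon> s)) has_vector_derivative xt \<epsilon> t) (at t within {0..T}) \<and>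
           ((\<lambda>r. snd c (qf r t)) has_vector_derivative xe \<epsilon> t) (at \<epsilon>) \<and>
           ((\<lambda>r. xt r t) has_vector_derivative xet \<epsilon> t) (at \<epsilon>)"
     "continuous_on ?D (\<lambda>(\<epsilon>, t). snd c (qf \<epsilon> t))" "continuous_on ?D (\<lambda>(\<epsilon>, t). xt \<epsilon> t)"
     "continuous_on ?D (\<lambda>(\<epsilon>, t). xe \<epsilon> t)" "continuous_on ?D (\<lambda>(\<epsilon>, t). xet \<epsilon> t)"
    using x unfolding C1_family_on_strip[OF D] by blast
  have "openin (top_of_set (strip a T)) (strip a T)" by simp
  from \<mu>[unfolded C1_family_on_strip[OF this]]
  obtain \<mu>t \<mu>e \<mu>et where M: "\<forall>(\<epsilon>, t)\<in>strip a T.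
           ((\<lambda>s. \<mu>f \<epsilon> s) has_vector_derivative \<mu>t \<epsilon> t) (at t within {0..T}) \<and>
           ((\<lambda>r. \<mu>f r t) has_vector_derivative \<mu>e \<epsilon> t) (at \<epsilon>) \<and>
           ((\<lambda>r. \<mu>t r t) has_vector_derivative \<mu>et \<epsilon> t) (at \<epsilon>)"
      "continuous_on (strip a T) (\<lambda>(\<epsilon>, t). \<mu>f \<epsilon> t)" "continuous_on (strip a T) (\<lambda>(\<epsilon>, t). \<mu>e \<epsilon> t)"
    by blast
  have sub: "?D \<subseteq> strip a T" by (auto simp: chart_part_def)
  show ?thesis
  proof (rule that[of xt xe xet \<mu>e])
    fix \<epsilon> t assume p: "(\<epsilon>, t) \<in> ?D"
    show x: "((\<lambda>s. snd c (qf \<epsilon> s)) has_vector_derivative xt \<epsilon> t) (at t within {0..T})"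
      "((\<lambda>r. snd c (qf r t)) has_vector_derivative xe \<epsilon> t) (at \<epsilon>)"
      "((\<lambda>r. xt r t) has_vector_derivative xet \<epsilon> t) (at \<epsilon>)"
      using X(1) p by auto
    show "((\<lambda>r. \<mu>f r t) has_vector_derivative \<mu>e \<epsilon> t) (at \<epsilon>)" 
      using M(1) p sub by auto
    show "triv_velocity A \<Phi> T (qf \<epsilon>) t = loc_inv c (snd c (qf \<epsilon> t)) (xt \<epsilon> t)"
      by (rule triv_velocity_eq[OF _ _ x(1)])
        (use p c strip_slices(3)[OF D p] in \<open>auto simp: chart_part_def charts_at_def elim: eventually_mono\<close>)
  qed (use X M sub continuous_on_subset in blast)+
qed

text \<open>In one chart the integrand is \<open>loc_lagr\<close> along position, velocity and
  momentum of the family, so its \<epsilon>-derivative is the derivative of \<open>loc_lagr\<close>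
  applied to \<open>(xe, xet, riesz \<mu>e)\<close>. The mixed derivative \<open>xet\<close> enters
  as the \<epsilon>-derivative of the velocity. Joint continuity is the aim here; the formula in
  terms of \<eta> follows in \<open>lagr_first_variation\<close>.\<close>

lemma lagr_family:
  assumes fam: "variation_family A \<Phi> T q\<^sub>0 q \<mu> \<eta> \<delta>\<mu> a qf \<mu>f" and c: "c \<in> A"
  obtains fe where 
    "\<And>\<epsilon> t. (\<epsilon>, t) \<in> chart_part a qf c \<Longrightarrow> ((\<lambda>r. lagr (qf r) (\<mu>f r) t) has_vector_derivative fe \<epsilon> t) (at \<epsilon>)"
    "continuous_on (chart_part a qf c) (\<lambda>(\<epsilon>, t). lagr (qf \<epsilon>) (\<mu>f \<epsilon>) t)"
    "continuous_on (chart_part a qf c) (\<lambda>(\<epsilon>, t). fe \<epsilon> t)"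
proof -
  let ?D = "chart_part a qf c"
  have cont: "continuous_map (top_of_set (strip a T)) (atlas_topology A) (\<lambda>(\<epsilon>, t). qf \<epsilon> t)"
    using fam by (auto simp: variation_family_def)
  note D = openin_chart_part[OF cont c]
  obtain xt xe xet \<mu>e where X: 
    "\<And>\<epsilon> t. (\<epsilon>, t) \<in> ?D \<Longrightarrow> ((\<lambda>s. snd c (qf \<epsilon> s)) has_vector_derivative xt \<epsilon> t) (at t within {0..T})"
    "\<And>\<epsilon> t. (\<epsilon>, t) \<in> ?D \<Longrightarrow> ((\<lambda>r. snd c (qf r t)) has_vector_derivative xe \<epsilon> t) (at \<epsilon>)"
    "\<And>\<epsilon> t. (\<epsilon>, t) \<in> ?D \<Longrightarrow> ((\<lambda>r. xt r t) has_vector_derivative xet \<epsilon> t) (at \<epsilon>)"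
    "\<And>\<epsilon> t. (\<epsilon>, t) \<in> ?D \<Longrightarrow> ((\<lambda>r. \<mu>f r t) has_vector_derivative \<mu>e \<epsilon> t) (at \<epsilon>)"
    "continuous_on ?D (\<lambda>(\<epsilon>, t). snd c (qf \<epsilon> t))" "continuous_on ?D (\<lambda>(\<epsilon>, t). xt \<epsilon> t)"
    "continuous_on ?D (\<lambda>(\<epsilon>, t). xe \<epsilon> t)" "continuous_on ?D (\<lambda>(\<epsilon>, t). xet \<epsilon> t)"
    "continuous_on ?D (\<lambda>(\<epsilon>, t). \<mu>f \<epsilon> t)" "continuous_on ?D (\<lambda>(\<epsilon>, t). \<mu>e \<epsilon> t)"
    "\<And>\<epsilon> t. (\<epsilon>, t) \<in> ?D \<Longrightarrow> triv_velocity A \<Phi> T (qf \<epsilon>) t = loc_inv c (snd c (qf \<epsilon> t)) (xt \<epsilon> t)"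
    by (rule family_chartE[OF fam c]) (rule that)
  let ?S = "snd c ` fst c \<times> (UNIV :: 'e set) \<times> (UNIV :: 'v set)"
  obtain L' where L': "\<And>t z. t \<in> {0..T} \<Longrightarrow> z \<in> ?S \<Longrightarrow> (loc_lagr c t has_derivative L' t z) (at z)"
    "continuous_on ({0..T} \<times> ?S) (\<lambda>(t, z). loc_lagr c t z)"
    "continuous_on ({0..T} \<times> ?S \<times> UNIV) (\<lambda>(t, z, w). L' t z w)"
    by (rule C1_paramE[OF C1_param_loc_lagr[OF c]]) (rule that)
  define z where "z \<epsilon> t = (snd c (qf \<epsilon> t), xt \<epsilon> t, riesz (\<mu>f \<epsilon> t))" for \<epsilon> t
  define ze where "ze \<epsilon> t = (xe \<epsilon> t, xet \<epsilon> t, riesz (\<mu>e \<epsilon> t))" for \<epsilon> t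
  have zS: "t \<in> {0..T}" "z \<epsilon> t \<in> ?S" if "(\<epsilon>, t) \<in> ?D" for \<epsilon> t
    using that by (auto simp: z_def chart_part_def)
  have img: "(\<lambda>p. (snd p, z (fst p) (snd p))) ` ?D \<subseteq> {0..T} \<times> ?S"
    "(\<lambda>p. (snd p, z (fst p) (snd p), ze (fst p) (snd p))) ` ?D \<subseteq> {0..T} \<times> ?S \<times> UNIV"
    using zS by (simp_all add: image_subset_iff split_paired_all Ball_def)
  have z: "((\<lambda>r. z r t) has_vector_derivative ze \<epsilon> t) (at \<epsilon>)" if "(\<epsilon>, t) \<in> ?D" for \<epsilon> t
    unfolding z_def ze_def using X(2-4)[OF that]
    by (intro has_vector_derivative_Pair bounded_linear.has_vector_derivative[OF bounded_linear_riesz])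
  have riesz_cont: "continuous_on ?D (\<lambda>p. riesz (g (fst p) (snd p)))" 
    if "continuous_on ?D (\<lambda>(\<epsilon>, t). g \<epsilon> t)" for g :: "real \<Rightarrow> real \<Rightarrow> 'v \<Rightarrow>\<^sub>L real"
    using that by (intro bounded_linear.continuous_on[OF bounded_linear_riesz]) (simp add: case_prod_unfold)
  have zc: "continuous_on ?D (\<lambda>p. z (fst p) (snd p))" "continuous_on ?D (\<lambda>p. ze (fst p) (snd p))"
    using X(5-8) riesz_cont[OF X(9)] riesz_cont[OF X(10)] unfolding z_def ze_def
    by (auto intro!: continuous_on_Pair simp: case_prod_unfold)
  have lagr: "lagr (qf \<epsilon>) (\<mu>f \<epsilon>) t = loc_lagr c t (z \<epsilon> t)" if p: "(\<epsilon>, t) \<in> ?D" for \<epsilon> t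
    using p c by (auto simp: lagr_def loc_lagr_def loc_ham_def z_def X(11)[OF p] inner_riesz chart_part_def)
  show ?thesis
  proof (rule that[of "\<lambda>\<epsilon> t. L' t (z \<epsilon> t) (ze \<epsilon> t)"])
    fix \<epsilon> t assume p: "(\<epsilon>, t) \<in> ?D"
    have L: "(loc_lagr c t has_derivative L' t (z \<epsilon> t)) (at (z \<epsilon> t))"
      by (rule L'(1)[OF zS[OF p]])
    have "((\<lambda>r. loc_lagr c t (z r t)) has_vector_derivative L' t (z \<epsilon> t) (ze \<epsilon> t)) (at \<epsilon>)"
      using vector_derivative_diff_chain_within[OF z[OF p] has_derivative_at_withinI[OF L]] 
      by (simp add: o_def)
    moreover have "eventually (\<lambda>r. loc_lagr c t (z r t) = lagr (qf r) (\<mu>f r) t) (at \<epsilon>)"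
      using strip_slices(4)[OF D p] by (rule eventually_mono) (simp add: lagr)
    ultimately show "((\<lambda>r. lagr (qf r) (\<mu>f r) t) has_vector_derivative L' t (z \<epsilon> t) (ze \<epsilon> t)) (at \<epsilon>)"
      unfolding has_vector_derivative_def
      by (rule has_derivative_transform_eventually) (simp_all add: lagr p)
  next
    have "continuous_on ?D (\<lambda>p. (\<lambda>(t, z). loc_lagr c t z) (snd p, z (fst p) (snd p)))"
      by (rule continuous_on_compose2[OF L'(2) _ img(1)]) (intro continuous_intros zc)
    then show "continuous_on ?D (\<lambda>(\<epsilon>, t). lagr (qf \<epsilon>) (\<mu>f \<epsilon>) t)"
      by (rule continuous_on_eq) (auto simp: lagr)
    have "continuous_on ?D (\<lambda>p. (\<lambda>(t, z, w). L' t z w) (snd p, z (fst p) (snd p), ze (fst p) (snd p)))"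
      by (rule continuous_on_compose2[OF L'(3) _ img(2)]) (intro continuous_intros zc)
    then show "continuous_on ?D (\<lambda>(\<epsilon>, t). L' t (z \<epsilon> t) (ze \<epsilon> t))"
      by (simp add: case_prod_unfold)
  qed
qed

text \<open>The second conclusion is the source of continuity for the terms of Hamel's equations:
  \<open>f0\<close> may be any pointwise formula for the \<epsilon>-derivative at 0, and uniqueness
  identifies it with the continuous function found in charts.\<close>

lemma action_has_derivative:
  assumes fam: "variation_family A \<Phi> T q\<^sub>0 q \<mu> \<eta> \<delta>\<mu> a qf \<mu>f"
    and f0: "\<And>t. t \<in> {0..T} \<Longrightarrow> ((\<lambda>r. lagr (qf r) (\<mu>f r) t) has_vector_derivative f0 t) (at 0)"
  shows "((\<lambda>\<epsilon>. action A \<Phi> h T (qf \<epsilon>) (\<mu>f \<epsilon>)) has_real_derivative integral {0..T} f0) (at 0)"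
    and "continuous_on {0..T} f0"
proof -
  let ?S = "strip a T"
  have cont: "continuous_map (top_of_set ?S) (atlas_topology A) (\<lambda>(\<epsilon>, t). qf \<epsilon> t)" and a: "a > 0"
    using fam by (auto simp: variation_family_def)
  \<comment> \<open>\<open>vector_derivative\<close> names the derivative without reference to a
    chart, so the chartwise derivatives fit together on the whole strip.\<close>
  define fe where "fe \<epsilon> t = vector_derivative (\<lambda>r. lagr (qf r) (\<mu>f r) t) (at \<epsilon>)" for \<epsilon> t
  have loc: "\<exists>U. open U \<and> p \<in> U \<and> (\<forall>(\<epsilon>, t) \<in> ?S \<inter> U. ((\<lambda>r. lagr (qf r) (\<mu>f r) t) has_vector_derivative fe \<epsilon> t) (at \<epsilon>)) \<and>
      continuous_on (?S \<inter> U) (\<lambda>(\<epsilon>, t). lagr (qf \<epsilon>) (\<mu>f \<epsilon>) t) \<and>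
      continuous_on (?S \<inter> U) (\<lambda>(\<epsilon>, t). fe \<epsilon> t)" if p: "p \<in> ?S" for p
  proof -
    obtain \<epsilon> t where p_eq: "p = (\<epsilon>, t)" by (cases p)
    have "qf \<epsilon> t \<in> points A"
      using cont p by (auto simp: continuous_map_def p_eq Pi_iff)
    then obtain c where c: "c \<in> A" "qf \<epsilon> t \<in> fst c" by (auto simp: points_def)
    obtain U where U: "open U" "chart_part a qf c = ?S \<inter> U"
      using openin_chart_part[OF cont c(1)] by (auto simp: openin_open)
    obtain g where g: "\<And>\<epsilon> t. (\<epsilon>, t) \<in> chart_part a qf c \<Longrightarrow> ((\<lambda>r. lagr (qf r) (\<mu>f r) t) has_vector_derivative g \<epsilon> t) (at \<epsilon>)"
      "continuous_on (chart_part a qf c) (\<lambda>(\<epsilon>, t). lagr (qf \<epsilon>) (\<mu>f \<epsilon>) t)"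
      "continuous_on (chart_part a qf c) (\<lambda>(\<epsilon>, t). g \<epsilon> t)"
      by (rule lagr_family[OF fam c(1)]) (rule that)
    have fe: "fe \<epsilon> t = g \<epsilon> t" if "(\<epsilon>, t) \<in> chart_part a qf c" for \<epsilon> t
      unfolding fe_def using g(1)[OF that] by (rule vector_derivative_at)
    have "continuous_on (chart_part a qf c) (\<lambda>(\<epsilon>, t). fe \<epsilon> t)"
      using g(3) by (rule continuous_on_eq) (auto simp: fe)
    moreover have "p \<in> U" using U(2) p c by (auto simp: p_eq chart_part_def)
    ultimately show ?thesis
      using U g fe by (intro exI[of _ U]) auto
  qed
  have fe: "((\<lambda>r. lagr (qf r) (\<mu>f r) t) has_vector_derivative fe \<epsilon> t) (at \<epsilon>)" if "(\<epsilon>, t) \<in> ?S" for \<epsilon> t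
    using loc[OF that] that by blast
  have lc: "continuous_on ?S (\<lambda>(\<epsilon>, t). lagr (qf \<epsilon>) (\<mu>f \<epsilon>) t)"
    by (rule continuous_on_local) (use loc in blast)
  have fc: "continuous_on ?S (\<lambda>(\<epsilon>, t). fe \<epsilon> t)"
    by (rule continuous_on_local) (use loc in blast)
  have slice: "continuous_on {0..T} (g \<epsilon>)" if "continuous_on ?S (\<lambda>(\<epsilon>, t). g \<epsilon> t)" "\<epsilon> \<in> {-a<..<a}" 
    for g :: "real \<Rightarrow> real \<Rightarrow> real" and \<epsilon>
  proof -
    have "continuous_on {0..T} (\<lambda>w. (\<lambda>(\<epsilon>, t). g \<epsilon> t) (\<epsilon>, w))"
      by (rule continuous_on_compose2[OF that(1)]) (use that in \<open>auto intro!: continuous_intros\<close>)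
    then show ?thesis by simp
  qed
  have "((\<lambda>r. integral (cbox 0 T) (lagr (qf r) (\<mu>f r))) has_vector_derivative integral (cbox 0 T) (fe 0)) 
      (at 0 within {-a<..<a})"
    by (rule leibniz_rule_vector_derivative)
      (use a fe fc slice[OF lc] in \<open>auto intro: has_vector_derivative_at_within integrable_continuous_interval\<close>)
  moreover have "at 0 within {-a<..<a} = at (0::real)"
    using a by (intro at_within_open) auto
  moreover have "fe 0 t = f0 t" if "t \<in> {0..T}" for t
    using vector_derivative_at[OF f0[OF that]] by (simp add: fe_def)
  moreover from this have "integral {0..T} (fe 0) = integral {0..T} f0"
    by (intro integral_cong) auto
  ultimately show "((\<lambda>\<epsilon>. action A \<Phi> h T (qf \<epsilon>) (\<mu>f \<epsilon>)) has_real_derivative integral {0..T} f0) (at 0)"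
    by (simp add: has_real_derivative_iff_has_vector_derivative action_def lagr_def[abs_def])
  have "continuous_on {0..T} (fe 0)"
    using slice[OF fc, of 0] a by simp
  then show "continuous_on {0..T} f0"
    by (rule continuous_on_eq) (use \<open>\<And>t. t \<in> {0..T} \<Longrightarrow> fe 0 t = f0 t\<close> in simp)
qed

end

section \<open>The first variation of the action\<close>

lemma has_vector_derivative_chain:
  assumes "(f has_vector_derivative f') (at x within S)" "(g has_derivative g') (at y)" "f x = y"
  shows "((\<lambda>s. g (f s)) has_vector_derivative g' f') (at x within S)"
  using vector_derivative_diff_chain_within[OF assms(1) has_derivative_at_withinI] assms(2,3) by (simp add: o_def)

section \<open>Derivatives of the local trivialization and linearity of the bracket\<close>

context trivialized_atlas
begin

text \<open>The coordinate form of D\<Phi>(q)\<cdot>dx\<cdot>u is \<open>dloc c x u dx\<close>: the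
  vector u of V comes first and the direction dx last.\<close>

definition dloc :: "('m, 'e) chart \<Rightarrow> 'e \<Rightarrow> 'v \<Rightarrow> 'e \<Rightarrow> 'e" where
  "dloc c x u = frechet_derivative (\<lambda>x. loc c x u) (at x)"

text \<open>The total derivative exists because \<open>loc\<close> is C1 in both variables together.
  Its restrictions to the two axes are identified separately, the second one by linearity of
  \<open>loc c x\<close>; their sum is the product rule for a matrix applied to a vector.\<close>

lemma loc_has_derivative:
  assumes c: "c \<in> charts_at A p"
  shows "((\<lambda>(x, u). loc c x u) has_derivative (\<lambda>(dx, du). dloc c (snd c p) u dx + loc c (snd c p) du)) 
    (at (snd c p, u))"
    and "((\<lambda>x. loc c x u) has_derivative dloc c (snd c p) u) (at (snd c p))"
proof -
  let ?X = "snd c p" and ?L = "\<lambda>(x, u). loc c x u"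
  have cA: "c \<in> A" "p \<in> fst c" using c by auto
  from C1_param_loc[OF cA(1), of "{0}"] obtain D where D: "(?L has_derivative D) (at (?X, u))"
    unfolding C1_param_def using cA(2) by force
  interpret D: bounded_linear D using D by (rule has_derivative_bounded_linear)
  have "((\<lambda>x. ?L (x, u)) has_derivative (\<lambda>dx. D (dx, 0))) (at ?X)"
    by (rule has_derivative_compose[OF has_derivative_Pair[OF has_derivative_ident has_derivative_const] D])
  then have 1: "((\<lambda>x. loc c x u) has_derivative (\<lambda>dx. D (dx, 0))) (at ?X)" by simp
  from frechet_derivative_at[OF this] have dloc: "dloc c ?X u = (\<lambda>dx. D (dx, 0))" by (simp add: dloc_def)
  with 1 show "((\<lambda>x. loc c x u) has_derivative dloc c ?X u) (at ?X)" by simp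
  have "((\<lambda>u. ?L (?X, u)) has_derivative (\<lambda>du. D (0, du))) (at u)"
    by (rule has_derivative_compose[OF has_derivative_Pair[OF has_derivative_const has_derivative_ident] D])
  then have "((\<lambda>u. loc c ?X u) has_derivative (\<lambda>du. D (0, du))) (at u)" by simp
  moreover have "((\<lambda>u. loc c ?X u) has_derivative loc c ?X) (at u)"
    by (rule linear_imp_has_derivative) (rule linear_loc[OF c])
  ultimately have "loc c ?X = (\<lambda>du. D (0, du))"
    using has_derivative_unique by blast
  then have "D = (\<lambda>(dx, du). dloc c ?X u dx + loc c ?X du)"
    by (auto simp: fun_eq_iff dloc D.add[symmetric])
  then show "(?L has_derivative (\<lambda>(dx, du). dloc c ?X u dx + loc c ?X du)) (at (?X, u))" 
    using D by simp
qed

text \<open>Linearity of \<open>loc c x\<close> in u holds at every x in the open chart image, and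
  differentiating these identities in x preserves them.\<close>

lemma linear_dloc: 
  assumes c: "c \<in> charts_at A p"
  shows "linear (\<lambda>u. dloc c (snd c p) u dx)"
proof (rule linearI)
  let ?X = "snd c p"
  have cA: "c \<in> A" "p \<in> fst c" using c by auto
  have lin: "linear (loc c x)" if "x \<in> snd c ` fst c" for x
    using that linear_loc[OF charts_atI[OF cA(1)]] by auto
  note d = loc_has_derivative(2)[OF c]
  fix u w r
  have "((\<lambda>x. loc c x (u + w)) has_derivative (\<lambda>dx. dloc c ?X u dx + dloc c ?X w dx)) (at ?X)"
    by (rule has_derivative_transform_within_open[OF has_derivative_add[OF d d] open_chart_image[OF cA(1)]])
      (use cA lin in \<open>auto simp: linear_add\<close>)
  from has_derivative_unique[OF this d] 
  show "dloc c ?X (u + w) dx = dloc c ?X u dx + dloc c ?X w dx" by (metis)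
  have "((\<lambda>x. loc c x (r *\<^sub>R u)) has_derivative (\<lambda>dx. r *\<^sub>R dloc c ?X u dx)) (at ?X)"
    by (rule has_derivative_transform_within_open[OF has_derivative_scaleR_right[OF d] open_chart_image[OF cA(1)]])
      (use cA lin in \<open>auto simp: linear_scale\<close>)
  from has_derivative_unique[OF this d] 
  show "dloc c ?X (r *\<^sub>R u) dx = r *\<^sub>R dloc c ?X u dx" by (metis)
qed

lemma bracket_eq:
  assumes p: "p \<in> points A" and c: "c = chart_at A p"
  shows "bracket A \<Phi> p u v = loc_inv c (snd c p)
     (dloc c (snd c p) v (loc c (snd c p) u) - dloc c (snd c p) u (loc c (snd c p) v))"
proof -
  have c': "c \<in> charts_at A p" using chart_at_charts_at[OF p] c by simp
  have "triv_deriv A \<Phi> c p (\<Phi> p u) v = tvec_of A c p (dloc c (snd c p) v (loc c (snd c p) u))" for u v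
    unfolding triv_deriv_def dloc_def loc_at[OF c'] by (simp add: loc_def)
  then show ?thesis
    by (simp add: bracket_def Let_def c[symmetric] loc_inv_at[OF c', symmetric] 
        linear_diff[OF linear_loc_inv[OF c']])
qed

text \<open>What has to be shown is linearity of the bracket in its second argument: only for
  bounded linear maps does \<open>Blinfun\<close> return the map it is given.\<close>

lemma ad_star_apply:
  assumes p: "p \<in> points A"
  shows "blinfun_apply (ad_star A \<Phi> p \<xi> \<alpha>) v = blinfun_apply \<alpha> (bracket A \<Phi> p \<xi> v)"
proof -
  define c where "c = chart_at A p"
  have c: "c \<in> charts_at A p" using chart_at_charts_at[OF p] c_def by simp
  interpret D: bounded_linear "dloc c (snd c p) \<xi>"
    using loc_has_derivative(2)[OF c] by (rule has_derivative_bounded_linear)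
  have "linear (bracket A \<Phi> p \<xi>)"
    unfolding bracket_eq[OF p c_def]
    by (rule linearI) 
      (simp_all add: linear_add[OF linear_dloc[OF c]] linear_scale[OF linear_dloc[OF c]]
        linear_add[OF linear_loc[OF c]] linear_scale[OF linear_loc[OF c]]
        linear_add[OF linear_loc_inv[OF c]] linear_scale[OF linear_loc_inv[OF c]] 
        linear_diff[OF linear_loc_inv[OF c]] D.add D.scaleR algebra_simps)
  then have "bounded_linear (\<lambda>v. blinfun_apply \<alpha> (bracket A \<Phi> p \<xi> v))"
    by (intro bounded_linear_compose[OF blinfun.bounded_linear_right]) (simp add: linear_conv_bounded_linear)
  then show ?thesis
    by (simp add: ad_star_def bounded_linear_Blinfun_apply)
qed

end

section \<open>The pointwise first variation\<close>

context hamiltonian_system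
begin

lemma loc_ham_differentiable:
  assumes "t \<in> {0..T}" "c \<in> charts_at A p"
  obtains D where "(loc_ham c t has_derivative D) (at (snd c p, m))"
proof -
  have "c \<in> A" "p \<in> fst c" using assms(2) by auto
  with C1_param_loc_ham[of c] assms(1) show ?thesis
    unfolding C1_param_def using that by (metis SigmaI UNIV_I imageI)
qed

lemma triv_dual_D_q:
  assumes t: "t \<in> {0..T}" and p: "p \<in> points A"
  shows "blinfun_apply (triv_dual \<Phi> p (D_q A h t p \<mu>)) v = D_q A h t p \<mu> (\<Phi> p v)"
proof -
  define c where "c = chart_at A p"
  have c: "c \<in> charts_at A p" using chart_at_charts_at[OF p] c_def by simp
  obtain D where D: "(loc_ham c t has_derivative D) (at (snd c p, riesz \<mu>))"
    by (rule loc_ham_differentiable[OF t c])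
  interpret D: bounded_linear D using D by (rule has_derivative_bounded_linear)
  have eq: "D_q A h t p \<mu> (\<Phi> p v) = D (loc c (snd c p) v, 0)" for v
    by (simp add: D_q_eq[OF t p c_def D triv_tangent[OF p]] loc_at[OF c])
  have "bounded_linear (loc c (snd c p))"
    using linear_loc[OF c] by (simp add: linear_conv_bounded_linear)
  then have "bounded_linear (\<lambda>v. D (loc c (snd c p) v, 0))"
    by (intro bounded_linear_compose[OF D.bounded_linear_axioms] bounded_linear_Pair bounded_linear_zero)
  then show ?thesis
    by (simp add: triv_dual_def eq bounded_linear_Blinfun_apply)
qed

text \<open>In the chart, xt = \<Phi> \<omega> with \<omega> the trivialized velocity along the
  family, and xe = \<Phi> \<eta> along the base curve. Differentiating the first identity in
  \<epsilon> and the second in t gives two expressions for the mixed derivative,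
  D\<Phi>\<cdot>xe\<cdot>\<xi> + \<Phi> \<omega>' and D\<Phi>\<cdot>xt\<cdot>\<eta> + \<Phi>
  \<eta>'. Their equality reads \<omega>' = \<eta>' + [\<xi>, \<eta>]. The rest is the product rule
  for \<langle>\<mu>, \<omega>\<rangle> and the chain rule for h.\<close>

lemma lagr_first_variation:
  assumes fam: "variation_family A \<Phi> T q\<^sub>0 q \<mu> \<eta> \<delta>\<mu> a qf \<mu>f" 
    and t: "t \<in> {0..T}" and \<eta>': "(\<eta> has_vector_derivative \<eta>') (at t within {0..T})"
    and \<xi>_def: "\<xi> = triv_velocity A \<Phi> T q t"
  shows "((\<lambda>r. lagr (qf r) (\<mu>f r) t) has_vector_derivative
     blinfun_apply (\<delta>\<mu> t) (\<xi> - D_mu h t (q t) (\<mu> t)) + blinfun_apply (\<mu> t) \<eta>'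
     + blinfun_apply (ad_star A \<Phi> (q t) \<xi> (\<mu> t) - triv_dual \<Phi> (q t) (D_q A h t (q t) (\<mu> t))) (\<eta> t)) (at 0)"
proof -
  have cont: "continuous_map (top_of_set (strip a T)) (atlas_topology A) (\<lambda>(\<epsilon>, t). qf \<epsilon> t)" and a: "a > 0"
    and base: "\<And>t. t \<in> {0..T} \<Longrightarrow> qf 0 t = q t" "\<And>t. t \<in> {0..T} \<Longrightarrow> \<mu>f 0 t = \<mu> t"
    and vel: "\<And>t. t \<in> {0..T} \<Longrightarrow> velocity A {-a<..<a} (\<lambda>\<epsilon>. qf \<epsilon> t) 0 = \<Phi> (q t) (\<eta> t)"
    and \<delta>\<mu>: "((\<lambda>\<epsilon>. \<mu>f \<epsilon> t) has_vector_derivative \<delta>\<mu> t) (at 0)"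
    using fam t by (auto simp: variation_family_def)
  define p where "p = q t"
  have "qf 0 t \<in> points A"
    using cont t a by (auto simp: continuous_map_def Pi_iff)
  then have p: "p \<in> points A" using base t by (simp add: p_def)
  define c where "c = chart_at A p"
  have c: "c \<in> charts_at A p" using chart_at_charts_at[OF p] c_def by simp
  then have cA: "c \<in> A" "p \<in> fst c" by auto
  let ?D = "chart_part a qf c"
  note D = openin_chart_part[OF cont cA(1)]
  have 0: "(0, t) \<in> ?D" using a t cA base by (auto simp: chart_part_def p_def)
  obtain xt xe xet \<mu>e where X: 
    "\<And>\<epsilon> t. (\<epsilon>, t) \<in> ?D \<Longrightarrow> ((\<lambda>s. snd c (qf \<epsilon> s)) has_vector_derivative xt \<epsilon> t) (at t within {0..T})"
    "\<And>\<epsilon> t. (\<epsilon>, t) \<in> ?D \<Longrightarrow> ((\<lambda>r. snd c (qf r t)) has_vector_derivative xe \<epsilon> t) (at \<epsilon>)"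
    "\<And>\<epsilon> t. (\<epsilon>, t) \<in> ?D \<Longrightarrow> ((\<lambda>r. xt r t) has_vector_derivative xet \<epsilon> t) (at \<epsilon>)"
    "\<And>\<epsilon> t. (\<epsilon>, t) \<in> ?D \<Longrightarrow> ((\<lambda>r. \<mu>f r t) has_vector_derivative \<mu>e \<epsilon> t) (at \<epsilon>)"
    "continuous_on ?D (\<lambda>(\<epsilon>, t). snd c (qf \<epsilon> t))" "continuous_on ?D (\<lambda>(\<epsilon>, t). xt \<epsilon> t)"
    "continuous_on ?D (\<lambda>(\<epsilon>, t). xe \<epsilon> t)" "continuous_on ?D (\<lambda>(\<epsilon>, t). xet \<epsilon> t)"
    "continuous_on ?D (\<lambda>(\<epsilon>, t). \<mu>f \<epsilon> t)" "continuous_on ?D (\<lambda>(\<epsilon>, t). \<mu>e \<epsilon> t)"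
    "\<And>\<epsilon> t. (\<epsilon>, t) \<in> ?D \<Longrightarrow> triv_velocity A \<Phi> T (qf \<epsilon>) t = loc_inv c (snd c (qf \<epsilon> t)) (xt \<epsilon> t)"
    by (rule family_chartE[OF fam cA(1)]) (rule that)
  let ?X = "snd c p" and ?L = "\<lambda>(x, u). loc c x u"
  \<comment> \<open>\<open>qf 0\<close> and q are known to agree only on [0,T], which suffices for a
    derivative within [0,T].\<close>
  have tv0: "triv_velocity A \<Phi> T (qf 0) t = \<xi>"
  proof -
    have "((\<lambda>s. snd c (q s)) has_vector_derivative xt 0 t) (at t within {0..T})"
      by (rule has_vector_derivative_transform[OF t _ X(1)[OF 0]]) (simp add: base)
    moreover have "eventually (\<lambda>s. q s \<in> fst c) (at t within {0..T})"
      using strip_slices(3)[OF D 0] by (rule eventually_mono) (auto simp: chart_part_def base)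
    ultimately have "triv_velocity A \<Phi> T q t = loc_inv c (snd c (q t)) (xt 0 t)"
      using c by (intro triv_velocity_eq(2) t) (auto simp: p_def)
    then show ?thesis using X(11)[OF 0] base t by (simp add: \<xi>_def)
  qed
  have \<xi>: "\<xi> = loc_inv c ?X (xt 0 t)"
    using X(11)[OF 0] base[OF t] by (simp add: tv0 p_def)
  \<comment> \<open>Stated for all times s in the chart and not only for t, since xe is about to be
    differentiated in time.\<close>
  have xe: "xe 0 s = loc c (snd c (qf 0 s)) (\<eta> s)" if s: "(0, s) \<in> ?D" for s
  proof -
    have s': "s \<in> {0..T}" "c \<in> charts_at A (q s)" using s cA base by (auto simp: chart_part_def charts_at_def)
    have "velocity A {-a<..<a} (\<lambda>\<epsilon>. qf \<epsilon> s) 0 = tvec_of A c (qf 0 s) (xe 0 s)"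
    proof (rule velocity_eq)
      show "((snd c \<circ> (\<lambda>\<epsilon>. qf \<epsilon> s)) has_vector_derivative xe 0 s) (at 0 within {-a<..<a})"
        using X(2)[OF s] by (simp add: o_def has_vector_derivative_at_within)
      have *: "at 0 within {-a<..<a} = at (0::real)" using a by (intro at_within_open) auto
      show "eventually (\<lambda>\<epsilon>. qf \<epsilon> s \<in> fst c) (at 0 within {-a<..<a})"
        unfolding * using strip_slices(4)[OF D s] by (rule eventually_mono) (auto simp: chart_part_def)
      show "at 0 within {-a<..<a} \<noteq> bot" unfolding * by simp
    qed (use s' a base in auto)
    with vel[OF s'(1)] have "tvec_of A c (q s) (xe 0 s) c = \<Phi> (q s) (\<eta> s) c"
      using base s' by simp
    then show ?thesis using s' base by (simp add: loc_at)
  qed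
  have xe0: "xe 0 t = loc c ?X (\<eta> t)" using xe[OF 0] base t by (simp add: p_def)
  have xet: "xet 0 t = dloc c ?X (\<eta> t) (xt 0 t) + loc c ?X \<eta>'"
  proof -
    have "((\<lambda>s. (snd c (qf 0 s), \<eta> s)) has_vector_derivative (xt 0 t, \<eta>')) (at t within {0..T})"
      by (intro has_vector_derivative_Pair X(1)[OF 0] \<eta>')
    from has_vector_derivative_chain[OF this loc_has_derivative(1)[OF c, of "\<eta> t"]]
    have "((\<lambda>s. loc c (snd c (qf 0 s)) (\<eta> s)) has_vector_derivative dloc c ?X (\<eta> t) (xt 0 t) + loc c ?X \<eta>') 
        (at t within {0..T})"
      using base t by (simp add: p_def)
    then have "((\<lambda>s. xe 0 s) has_vector_derivative dloc c ?X (\<eta> t) (xt 0 t) + loc c ?X \<eta>') (at t within {0..T})"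
      unfolding has_vector_derivative_def
      by (rule has_derivative_transform_eventually) 
        (use strip_slices(3)[OF D 0] xe 0 t in \<open>auto elim!: eventually_mono\<close>)
    moreover have "((\<lambda>s. xe 0 s) has_vector_derivative xet 0 t) (at t within {0..T})"
      by (rule mixed_partial[OF D 0 X(1-3) X(6) X(8)])
    ultimately show ?thesis
      using vector_derivative_unique_within[OF at_within_Icc_0_nontrivial[OF t T_pos]] by blast
  qed
  define \<omega> where "\<omega> r = loc_inv c (snd c (qf r t)) (xt r t)" for r
  \<comment> \<open>Existence comes from differentiability of \<open>loc_inv\<close>. The value is
    found afterwards from xt = \<Phi> \<omega>, which avoids a formula for the derivative of an
    inverse matrix.\<close>
  obtain \<omega>' where \<omega>': "(\<omega> has_vector_derivative \<omega>') (at 0)"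
  proof -
    from C1_param_loc_inv[OF cA(1), of "{0}"] 
    obtain D where D: "((\<lambda>(x, y). loc_inv c x y) has_derivative D) (at (?X, xt 0 t))"
      unfolding C1_param_def using cA(2) by force
    have "((\<lambda>r. (snd c (qf r t), xt r t)) has_vector_derivative (xe 0 t, xet 0 t)) (at 0)"
      by (intro has_vector_derivative_Pair X(2)[OF 0] X(3)[OF 0])
    from has_vector_derivative_chain[OF this D]
    have "(\<omega> has_vector_derivative D (xe 0 t, xet 0 t)) (at 0)"
      using base t by (simp add: p_def \<omega>_def[abs_def])
    then show ?thesis by (rule that)
  qed
  have \<omega>0: "\<omega> 0 = \<xi>" using base t by (simp add: \<omega>_def \<xi> p_def)
  have loc_\<xi>: "xt 0 t = loc c ?X \<xi>" by (simp add: \<xi> loc_loc_inv[OF c])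
  have "\<omega>' = \<eta>' + bracket A \<Phi> p \<xi> (\<eta> t)"
  proof -
    have "((\<lambda>r. (snd c (qf r t), \<omega> r)) has_vector_derivative (xe 0 t, \<omega>')) (at 0)"
      by (intro has_vector_derivative_Pair X(2)[OF 0] \<omega>')
    from has_vector_derivative_chain[OF this loc_has_derivative(1)[OF c, of \<xi>]]
    have "((\<lambda>r. loc c (snd c (qf r t)) (\<omega> r)) has_vector_derivative dloc c ?X \<xi> (xe 0 t) + loc c ?X \<omega>') (at 0)"
      using base t \<omega>0 by (simp add: p_def)
    moreover have "eventually (\<lambda>r. loc c (snd c (qf r t)) (\<omega> r) = xt r t) (at 0)"
      using strip_slices(4)[OF D 0] 
      by (rule eventually_mono) 
        (auto simp: \<omega>_def chart_part_def intro: loc_loc_inv charts_atI[OF cA(1)])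
    ultimately have "((\<lambda>r. xt r t) has_vector_derivative dloc c ?X \<xi> (xe 0 t) + loc c ?X \<omega>') (at 0)"
      unfolding has_vector_derivative_def
      by (rule has_derivative_transform_eventually)
        (use base t loc_loc_inv[OF c] in \<open>auto simp: \<omega>_def p_def\<close>)
    then have "xet 0 t = dloc c ?X \<xi> (xe 0 t) + loc c ?X \<omega>'"
      using X(3)[OF 0] vector_derivative_unique_at by blast
    then have "loc c ?X \<omega>' = loc c ?X \<eta>' + (dloc c ?X (\<eta> t) (loc c ?X \<xi>) - dloc c ?X \<xi> (loc c ?X (\<eta> t)))"
      by (simp add: xet xe0 loc_\<xi> algebra_simps)
    then have "loc_inv c ?X (loc c ?X \<omega>') = loc_inv c ?X (loc c ?X \<eta>' 
       + (dloc c ?X (\<eta> t) (loc c ?X \<xi>) - dloc c ?X \<xi> (loc c ?X (\<eta> t))))"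
      by simp
    then show ?thesis
      unfolding bracket_eq[OF p c_def] 
      by (simp add: linear_add[OF linear_loc_inv[OF c]] loc_inv_loc[OF c])
  qed
  obtain K where K: "(loc_ham c t has_derivative K) (at (?X, riesz (\<mu> t)))"
    by (rule loc_ham_differentiable[OF t c])
  interpret K: bounded_linear K using K by (rule has_derivative_bounded_linear)
  \<comment> \<open>The increment is split into its position and momentum parts, on which K gives
    the two partial derivatives of h.\<close>
  have K': "K (xe 0 t, riesz (\<delta>\<mu> t)) = D_q A h t p (\<mu> t) (\<Phi> p (\<eta> t)) + blinfun_apply (\<delta>\<mu> t) (D_mu h t p (\<mu> t))"
    by (simp add: D_q_eq[OF t p c_def K triv_tangent[OF p]] D_mu_eq[OF t c K] xe0 loc_at[OF c] K.add[symmetric])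
  have "((\<lambda>r. blinfun_apply (\<mu>f r t) (\<omega> r)) has_vector_derivative 
      blinfun_apply (\<mu> t) \<omega>' + blinfun_apply (\<delta>\<mu> t) \<xi>) (at 0)"
    using bounded_bilinear.has_vector_derivative[OF bounded_bilinear_blinfun_apply \<delta>\<mu> \<omega>'] base t \<omega>0 by simp
  moreover have "((\<lambda>r. loc_ham c t (snd c (qf r t), riesz (\<mu>f r t))) has_vector_derivative 
      K (xe 0 t, riesz (\<delta>\<mu> t))) (at 0)"
  proof -
    have "((\<lambda>r. (snd c (qf r t), riesz (\<mu>f r t))) has_vector_derivative (xe 0 t, riesz (\<delta>\<mu> t))) (at 0)"
      by (intro has_vector_derivative_Pair X(2)[OF 0] bounded_linear.has_vector_derivative[OF bounded_linear_riesz] \<delta>\<mu>)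
    from has_vector_derivative_chain[OF this K]
    show ?thesis using base t by (simp add: p_def)
  qed
  ultimately have "((\<lambda>r. blinfun_apply (\<mu>f r t) (\<omega> r) - loc_ham c t (snd c (qf r t), riesz (\<mu>f r t))) has_vector_derivative 
      blinfun_apply (\<mu> t) \<omega>' + blinfun_apply (\<delta>\<mu> t) \<xi> - K (xe 0 t, riesz (\<delta>\<mu> t))) (at 0)"
    by (rule has_vector_derivative_diff)
  moreover have "blinfun_apply (\<mu>f r t) (\<omega> r) - loc_ham c t (snd c (qf r t), riesz (\<mu>f r t)) = lagr (qf r) (\<mu>f r) t"
    if r: "(r, t) \<in> ?D" for r
    using X(11)[OF r] r cA by (auto simp: lagr_def loc_ham_def \<omega>_def chart_part_def)
  then have "eventually (\<lambda>r. blinfun_apply (\<mu>f r t) (\<omega> r) - loc_ham c t (snd c (qf r t), riesz (\<mu>f r t)) 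
      = lagr (qf r) (\<mu>f r) t) (at 0)"
    and "blinfun_apply (\<mu>f 0 t) (\<omega> 0) - loc_ham c t (snd c (qf 0 t), riesz (\<mu>f 0 t)) = lagr (qf 0) (\<mu>f 0) t"
    using strip_slices(4)[OF D 0] 0 by (auto elim!: eventually_mono)
  ultimately have "((\<lambda>r. lagr (qf r) (\<mu>f r) t) has_vector_derivative 
      blinfun_apply (\<mu> t) \<omega>' + blinfun_apply (\<delta>\<mu> t) \<xi> - K (xe 0 t, riesz (\<delta>\<mu> t))) (at 0)"
    unfolding has_vector_derivative_def
    by (rule has_derivative_transform_eventually) simp
  moreover have "blinfun_apply (\<mu> t) \<omega>' + blinfun_apply (\<delta>\<mu> t) \<xi> - K (xe 0 t, riesz (\<delta>\<mu> t)) =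
     blinfun_apply (\<delta>\<mu> t) (\<xi> - D_mu h t (q t) (\<mu> t)) + blinfun_apply (\<mu> t) \<eta>'
     + blinfun_apply (ad_star A \<Phi> (q t) \<xi> (\<mu> t) - triv_dual \<Phi> (q t) (D_q A h t (q t) (\<mu> t))) (\<eta> t)"
    using p
    by (simp add: K' \<open>\<omega>' = _\<close> blinfun.diff_left ad_star_apply triv_dual_D_q[OF t] blinfun.add_right 
        blinfun.diff_right p_def)
  ultimately show ?thesis by simp
qed

end

section \<open>Bump functions\<close>

text \<open>For \<alpha> < \<beta>, the squared positive part of a parabola with zeros \<alpha> and
  \<beta>. It is positive exactly between the zeros, and the square removes the kinks there.
  Variations are C1 curves, so this much regularity is enough.\<close>

definition bump :: "real \<Rightarrow> real \<Rightarrow> real \<Rightarrow> real" where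
  "bump \<alpha> \<beta> t = (max 0 ((t - \<alpha>) * (\<beta> - t)))\<^sup>2"

definition bump' :: "real \<Rightarrow> real \<Rightarrow> real \<Rightarrow> real" where
  "bump' \<alpha> \<beta> t = 2 * max 0 ((t - \<alpha>) * (\<beta> - t)) * (\<alpha> + \<beta> - 2 * t)"

lemma max_0_square_has_derivative: "((\<lambda>x. (max 0 x)\<^sup>2) has_real_derivative 2 * max 0 x) (at (x::real))"
proof -
  consider "x < 0" | "x > 0" | "x = 0" by linarith
  then show ?thesis
  proof cases
    case 1
    have "((\<lambda>_. 0) has_real_derivative 0) (at x)" by simp
    then have "((\<lambda>x. (max 0 x)\<^sup>2) has_real_derivative 0) (at x)"
      by (rule has_field_derivative_transform_within_open[where S = "{..<0}"]) (use 1 in auto)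
    with 1 show ?thesis by simp
  next
    case 2
    have "((\<lambda>x. x\<^sup>2) has_real_derivative 2 * x) (at x)" by (auto intro!: derivative_eq_intros)
    then have "((\<lambda>x. (max 0 x)\<^sup>2) has_real_derivative 2 * x) (at x)"
      by (rule has_field_derivative_transform_within_open[where S = "{0<..}"]) (use 2 in auto)
    with 2 show ?thesis by simp
  next
    case 3
    \<comment> \<open>The difference quotient at 0 is a continuous function with limit 0.\<close>
    have "(max 0 k)\<^sup>2 / k = max 0 k" for k :: real
      by (auto simp: max_def power2_eq_square)
    moreover have "((\<lambda>k. max 0 k) \<longlongrightarrow> max 0 (0::real)) (at 0)"
      by (intro tendsto_intros)
    ultimately show ?thesis using 3 by (simp add: DERIV_def)
  qed
qed

lemma bump_has_derivative: "(bump \<alpha> \<beta> has_real_derivative bump' \<alpha> \<beta> t) (at t within S)"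
proof -
  have "((\<lambda>t. (t - \<alpha>) * (\<beta> - t)) has_real_derivative \<alpha> + \<beta> - 2 * t) (at t within S)"
    by (auto intro!: derivative_eq_intros simp: algebra_simps)
  from DERIV_chain2[OF max_0_square_has_derivative this]
  show ?thesis by (simp add: bump_def[abs_def] bump'_def)
qed

lemma bump_scaleR_has_derivative:
  "((\<lambda>t. bump \<alpha> \<beta> t *\<^sub>R v) has_vector_derivative bump' \<alpha> \<beta> t *\<^sub>R v) (at t within S)"
  using has_vector_derivative_scaleR[OF bump_has_derivative has_vector_derivative_const] by simp

lemma continuous_on_bump: "continuous_on S (bump \<alpha> \<beta>)" "continuous_on S (bump' \<alpha> \<beta>)"
  unfolding bump_def[abs_def] bump'_def[abs_def] by (intro continuous_intros)+

lemma bump_nonneg: "bump \<alpha> \<beta> t \<ge> 0"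
  by (simp add: bump_def)

lemma bump_eq_0: 
  assumes "\<alpha> \<le> \<beta>" "t \<notin> {\<alpha><..<\<beta>}"
  shows "bump \<alpha> \<beta> t = 0"
proof -
  have "(t - \<alpha>) * (\<beta> - t) \<le> 0" using assms by (auto simp: mult_le_0_iff not_less)
  then show ?thesis by (simp add: bump_def max_absorb1)
qed

lemma bump_pos: "t \<in> {\<alpha><..<\<beta>} \<Longrightarrow> bump \<alpha> \<beta> t > 0"
  by (auto simp: bump_def max_def zero_less_mult_iff)

section \<open>Construction of variations\<close>

lemma C1_family_on_cong:
  assumes "\<And>\<epsilon> t. (\<epsilon>, t) \<in> D \<Longrightarrow> x \<epsilon> t = y \<epsilon> t" and "C1_family_on D y"
  shows "C1_family_on D x"
proof -
  obtain yt ye yet where y: "\<And>\<epsilon> t. (\<epsilon>, t) \<in> D \<Longrightarrow>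
           ((\<lambda>s. y \<epsilon> s) has_vector_derivative yt \<epsilon> t) (at t within {s. (\<epsilon>, s) \<in> D}) \<and>
           ((\<lambda>r. y r t) has_vector_derivative ye \<epsilon> t) (at \<epsilon> within {r. (r, t) \<in> D}) \<and>
           ((\<lambda>r. yt r t) has_vector_derivative yet \<epsilon> t) (at \<epsilon> within {r. (r, t) \<in> D})"
    and c: "continuous_on D (\<lambda>(\<epsilon>, t). y \<epsilon> t)" "continuous_on D (\<lambda>(\<epsilon>, t). yt \<epsilon> t)"
      "continuous_on D (\<lambda>(\<epsilon>, t). ye \<epsilon> t)" "continuous_on D (\<lambda>(\<epsilon>, t). yet \<epsilon> t)"
    using assms(2) unfolding C1_family_on_def by blast
  have "((\<lambda>s. x \<epsilon> s) has_vector_derivative yt \<epsilon> t) (at t within {s. (\<epsilon>, s) \<in> D})"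
    "((\<lambda>r. x r t) has_vector_derivative ye \<epsilon> t) (at \<epsilon> within {r. (r, t) \<in> D})" if p: "(\<epsilon>, t) \<in> D" for \<epsilon> t
    using y[OF p] assms(1) p by (auto intro: has_vector_derivative_transform[where f = "\<lambda>s. y \<epsilon> s"]
        has_vector_derivative_transform[where f = "\<lambda>r. y r t"])
  moreover have "continuous_on D (\<lambda>(\<epsilon>, t). x \<epsilon> t)"
    using c(1) by (rule continuous_on_eq) (auto simp: assms(1))
  ultimately show ?thesis
    unfolding C1_family_on_def using y c(2-)
    by - (rule exI[of _ yt], rule exI[of _ ye], rule exI[of _ yet], auto)
qed

text \<open>Different neighbourhoods come with different witnesses for the derivatives. Replacing
  them by \<open>vector_derivative\<close> removes the choice; T > 0 makes derivatives within [0,T]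
  unique.\<close>

lemma C1_family_on_local:
  assumes D: "openin (top_of_set (strip a T)) D" and T: "0 < T"
    and loc: "\<And>p. p \<in> D \<Longrightarrow> \<exists>N. openin (top_of_set (strip a T)) N \<and> p \<in> N \<and> C1_family_on N x"
  shows "C1_family_on D x"
proof -
  define xt where "xt \<epsilon> t = vector_derivative (x \<epsilon>) (at t within {0..T})" for \<epsilon> t
  define xe where "xe \<epsilon> t = vector_derivative (\<lambda>r. x r t) (at \<epsilon>)" for \<epsilon> t
  define xet where "xet \<epsilon> t = vector_derivative (\<lambda>r. xt r t) (at \<epsilon>)" for \<epsilon> t
  have DS: "D \<subseteq> strip a T" using D by (rule openin_imp_subset)
  have *: "\<exists>U. open U \<and> p \<in> U \<and> (\<forall>(\<epsilon>, t)\<in>D \<inter> U.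
           ((\<lambda>s. x \<epsilon> s) has_vector_derivative xt \<epsilon> t) (at t within {0..T}) \<and>
           ((\<lambda>r. x r t) has_vector_derivative xe \<epsilon> t) (at \<epsilon>) \<and>
           ((\<lambda>r. xt r t) has_vector_derivative xet \<epsilon> t) (at \<epsilon>)) \<and>
        continuous_on (D \<inter> U) (\<lambda>(\<epsilon>, t). x \<epsilon> t) \<and> continuous_on (D \<inter> U) (\<lambda>(\<epsilon>, t). xt \<epsilon> t) \<and>
        continuous_on (D \<inter> U) (\<lambda>(\<epsilon>, t). xe \<epsilon> t) \<and> continuous_on (D \<inter> U) (\<lambda>(\<epsilon>, t). xet \<epsilon> t)" if p: "p \<in> D" for p
  proof -
    obtain N where N: "openin (top_of_set (strip a T)) N" "p \<in> N" "C1_family_on N x"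
      using loc[OF p] by blast
    obtain U where U: "open U" "N = strip a T \<inter> U" using N(1) by (auto simp: openin_open)
    obtain yt ye yet where y: "\<forall>(\<epsilon>, t)\<in>N.
           ((\<lambda>s. x \<epsilon> s) has_vector_derivative yt \<epsilon> t) (at t within {0..T}) \<and>
           ((\<lambda>r. x r t) has_vector_derivative ye \<epsilon> t) (at \<epsilon>) \<and>
           ((\<lambda>r. yt r t) has_vector_derivative yet \<epsilon> t) (at \<epsilon>)"
      and c: "continuous_on N (\<lambda>(\<epsilon>, t). x \<epsilon> t)" "continuous_on N (\<lambda>(\<epsilon>, t). yt \<epsilon> t)"
        "continuous_on N (\<lambda>(\<epsilon>, t). ye \<epsilon> t)" "continuous_on N (\<lambda>(\<epsilon>, t). yet \<epsilon> t)"
      using N(3) unfolding C1_family_on_strip[OF N(1)] by blast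
    have xt: "xt \<epsilon> t = yt \<epsilon> t" if "(\<epsilon>, t) \<in> N" for \<epsilon> t
      unfolding xt_def using y that U 
      by (intro vector_derivative_within at_within_Icc_0_nontrivial T) auto
    have xe: "xe \<epsilon> t = ye \<epsilon> t" if "(\<epsilon>, t) \<in> N" for \<epsilon> t
      unfolding xe_def using y that by (intro vector_derivative_at) auto
    \<comment> \<open>\<open>xt\<close> is known to coincide with \<open>yt\<close> only on N, but N
      contains an \<epsilon>-neighbourhood of each of its points, so the derivative carries
      over.\<close>
    have yet: "((\<lambda>r. xt r t) has_vector_derivative yet \<epsilon> t) (at \<epsilon>)" if p: "(\<epsilon>, t) \<in> N" for \<epsilon> t
    proof -
      have "((\<lambda>r. yt r t) has_vector_derivative yet \<epsilon> t) (at \<epsilon>)" using y p by auto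
      then show ?thesis
        unfolding has_vector_derivative_def
        by (rule has_derivative_transform_eventually)
          (use strip_slices(4)[OF N(1) p] xt p in \<open>auto elim!: eventually_mono\<close>)
    qed
    have xet: "xet \<epsilon> t = yet \<epsilon> t" if "(\<epsilon>, t) \<in> N" for \<epsilon> t
      unfolding xet_def using yet[OF that] by (rule vector_derivative_at)
    have sub: "D \<inter> U \<subseteq> N" using DS U by auto
    have "\<forall>(\<epsilon>, t)\<in>D \<inter> U.
           ((\<lambda>s. x \<epsilon> s) has_vector_derivative xt \<epsilon> t) (at t within {0..T}) \<and>
           ((\<lambda>r. x r t) has_vector_derivative xe \<epsilon> t) (at \<epsilon>) \<and>
           ((\<lambda>r. xt r t) has_vector_derivative xet \<epsilon> t) (at \<epsilon>)"
    proof (clarify)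
      fix \<epsilon> t assume "(\<epsilon>, t) \<in> D" "(\<epsilon>, t) \<in> U"
      then have "(\<epsilon>, t) \<in> N" using sub by auto
      then show "((\<lambda>s. x \<epsilon> s) has_vector_derivative xt \<epsilon> t) (at t within {0..T}) \<and>
           ((\<lambda>r. x r t) has_vector_derivative xe \<epsilon> t) (at \<epsilon>) \<and>
           ((\<lambda>r. xt r t) has_vector_derivative xet \<epsilon> t) (at \<epsilon>)"
        using y yet xt xe xet by auto
    qed
    moreover have "continuous_on N (\<lambda>(\<epsilon>, t). xt \<epsilon> t)" 
      by (rule continuous_on_eq[OF c(2)]) (auto simp: xt)
    moreover have "continuous_on N (\<lambda>(\<epsilon>, t). xe \<epsilon> t)" 
      by (rule continuous_on_eq[OF c(3)]) (auto simp: xe)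
    moreover have "continuous_on N (\<lambda>(\<epsilon>, t). xet \<epsilon> t)" 
      by (rule continuous_on_eq[OF c(4)]) (auto simp: xet)
    ultimately show ?thesis
      using c(1) U N(2) by (intro exI[of _ U]) (auto intro: continuous_on_subset[OF _ sub])
  qed
  show ?thesis
    unfolding C1_family_on_strip[OF D]
  proof (rule exI[of _ xt], rule exI[of _ xe], rule exI[of _ xet], intro conjI)
    show "\<forall>(\<epsilon>, t)\<in>D.
           ((\<lambda>s. x \<epsilon> s) has_vector_derivative xt \<epsilon> t) (at t within {0..T}) \<and>
           ((\<lambda>r. x r t) has_vector_derivative xe \<epsilon> t) (at \<epsilon>) \<and>
           ((\<lambda>r. xt r t) has_vector_derivative xet \<epsilon> t) (at \<epsilon>)"
      using * by blast
  qed (rule continuous_on_local; use * in blast)+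
qed

text \<open>For a line y = x + \<epsilon> u in one chart, seen in another through \<tau>, the time
  derivative is D\<tau>(y) y', and its \<epsilon>-derivative differentiates D\<tau> once more. Hence
  the map \<open>D\<close>, taking the pair (y, y') to D\<tau>(y) y', has to be C1, with derivative
  \<open>D2\<close>.\<close>

lemma C1_family_on_transition:
  fixes \<tau> :: "'a::euclidean_space \<Rightarrow> 'b::real_normed_vector"
  assumes \<tau>: "smooth_on V \<tau>" "open V" and N: "openin (top_of_set (strip a T)) N"
    and J: "\<And>\<epsilon> t. (\<epsilon>, t) \<in> N \<Longrightarrow> t \<in> J \<and> x t + \<epsilon> *\<^sub>R u t \<in> V"
    and x: "\<And>t. t \<in> J \<Longrightarrow> (x has_vector_derivative x' t) (at t within {0..T})" "continuous_on J x'"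
    and u: "\<And>t. t \<in> J \<Longrightarrow> (u has_vector_derivative u' t) (at t within {0..T})" "continuous_on J u'"
    and J_sub: "J \<subseteq> {0..T}"
  shows "C1_family_on N (\<lambda>\<epsilon> t. \<tau> (x t + \<epsilon> *\<^sub>R u t))"
proof -
  define D where "D = (\<lambda>(x, w). frechet_derivative \<tau> (at x) w)"
  have D: "(\<tau> has_derivative (\<lambda>w. D (x, w))) (at x)" if "x \<in> V" for x
    using smooth_on_open_derivative(1)[OF \<tau> that] by (simp add: D_def frechet_derivative_works)
  \<comment> \<open>\<open>{0}\<close> is a dummy set of times: \<tau> does not depend on
    time.\<close>
  have "C1_param {0} (V \<times> UNIV) (\<lambda>_. D)"
    unfolding D_def by (rule smooth_on_derivative_C1_param[OF \<tau>])
  then obtain D2' where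
    D2': "\<And>t z. t \<in> {0::real} \<Longrightarrow> z \<in> V \<times> UNIV \<Longrightarrow> (D has_derivative D2' t z) (at z)"
     "continuous_on ({0::real} \<times> (V \<times> UNIV)) (\<lambda>(t, z). D z)"
     "continuous_on ({0::real} \<times> (V \<times> UNIV) \<times> UNIV) (\<lambda>(t, z, w). D2' t z w)"
    by (rule C1_paramE) (rule that)
  define D2 where "D2 = D2' 0"
  have D2: "(D has_derivative D2 (x, w)) (at (x, w))" if "x \<in> V" for x w
    using D2'(1)[of 0 "(x, w)"] that by (simp add: D2_def)
  have "continuous_on (V \<times> UNIV) (\<lambda>p. (\<lambda>(t, z). D z) (0::real, p))"
    by (rule continuous_on_compose2[OF D2'(2)]) (auto intro!: continuous_intros)
  then have Dc: "continuous_on (V \<times> UNIV) D" by simp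
  have "continuous_on ((V \<times> UNIV) \<times> UNIV) (\<lambda>p. (\<lambda>(t, z, w). D2' t z w) (0, p))"
    by (rule continuous_on_compose2[OF D2'(3)]) (auto intro!: continuous_intros)
  then have D2c: "continuous_on ((V \<times> UNIV) \<times> UNIV) (\<lambda>(z, w). D2 z w)"
    by (simp add: D2_def case_prod_unfold)
  have NJ: "snd ` N \<subseteq> J" using J by auto
  have xc: "continuous_on J x" and uc: "continuous_on J u"
    using x(1) u(1) J_sub
    by (auto simp: continuous_on_eq_continuous_within 
        intro: has_vector_derivative_continuous has_vector_derivative_within_subset)
  note J_cont = continuous_on_compose2[OF _ continuous_on_snd[OF continuous_on_id] NJ]
  let ?y = "\<lambda>\<epsilon> t. x t + \<epsilon> *\<^sub>R u t" and ?y' = "\<lambda>\<epsilon> t. x' t + \<epsilon> *\<^sub>R u' t"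
  have c: "continuous_on N (\<lambda>p. ?y (fst p) (snd p))" "continuous_on N (\<lambda>p. ?y' (fst p) (snd p))"
    "continuous_on N (\<lambda>p. u (snd p))" "continuous_on N (\<lambda>p. u' (snd p))"
    by (intro continuous_intros J_cont[OF xc] J_cont[OF uc] J_cont[OF x(2)] J_cont[OF u(2)])+
  show ?thesis
    unfolding C1_family_on_strip[OF N]
  proof (rule exI[of _ "\<lambda>\<epsilon> t. D (?y \<epsilon> t, ?y' \<epsilon> t)"], rule exI[of _ "\<lambda>\<epsilon> t. D (?y \<epsilon> t, u t)"],
      rule exI[of _ "\<lambda>\<epsilon> t. D2 (?y \<epsilon> t, ?y' \<epsilon> t) (u t, u' t)"], unfold case_prod_unfold, intro conjI)
    show "\<forall>p\<in>N. ((\<lambda>s. \<tau> (?y (fst p) s)) has_vector_derivative D (?y (fst p) (snd p), ?y' (fst p) (snd p))) (at (snd p) within {0..T}) \<and>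
       ((\<lambda>r. \<tau> (?y r (snd p))) has_vector_derivative D (?y (fst p) (snd p), u (snd p))) (at (fst p)) \<and>
       ((\<lambda>r. D (?y r (snd p), ?y' r (snd p))) has_vector_derivative D2 (?y (fst p) (snd p), ?y' (fst p) (snd p)) (u (snd p), u' (snd p))) (at (fst p))"
    proof (intro ballI conjI)
      fix p assume p: "p \<in> N"
      then have p': "snd p \<in> J" "?y (fst p) (snd p) \<in> V" using J[of "fst p" "snd p"] by auto
      have "((\<lambda>s. ?y (fst p) s) has_vector_derivative ?y' (fst p) (snd p)) (at (snd p) within {0..T})"
        using has_vector_derivative_scaleR[OF DERIV_const u(1)[OF p'(1)], of "fst p"] x(1)[OF p'(1)]
        by (auto intro!: has_vector_derivative_add)
      from has_vector_derivative_chain[OF this D[OF p'(2)] refl]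
      show "((\<lambda>s. \<tau> (?y (fst p) s)) has_vector_derivative D (?y (fst p) (snd p), ?y' (fst p) (snd p))) (at (snd p) within {0..T})" .
      have lin: "((\<lambda>r. b + r *\<^sub>R d) has_vector_derivative d) (at r)" for b d :: 'a and r :: real
        by (auto intro!: derivative_eq_intros)
      from has_vector_derivative_chain[OF lin D[OF p'(2)] refl]
      show "((\<lambda>r. \<tau> (?y r (snd p))) has_vector_derivative D (?y (fst p) (snd p), u (snd p))) (at (fst p))" .
      from has_vector_derivative_chain[OF has_vector_derivative_Pair[OF lin lin] D2[OF p'(2)] refl]
      show "((\<lambda>r. D (?y r (snd p), ?y' r (snd p))) has_vector_derivative D2 (?y (fst p) (snd p), ?y' (fst p) (snd p)) (u (snd p), u' (snd p))) (at (fst p))" .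
    qed
    have *: "continuous_on N (\<lambda>p. \<tau> (?y (fst p) (snd p)))"
      by (rule continuous_on_compose2[OF smooth_on_imp_continuous_on[OF \<tau>(1)] c(1)]) (use J in auto)
    show "continuous_on N (\<lambda>p. \<tau> (?y (fst p) (snd p)))" by (fact *)
    show "continuous_on N (\<lambda>p. D (?y (fst p) (snd p), ?y' (fst p) (snd p)))"
      by (rule continuous_on_compose2[OF Dc continuous_on_Pair[OF c(1,2)]]) (use J in auto)
    show "continuous_on N (\<lambda>p. D (?y (fst p) (snd p), u (snd p)))"
      by (rule continuous_on_compose2[OF Dc continuous_on_Pair[OF c(1,3)]]) (use J in auto)
    have "continuous_on N (\<lambda>p. (\<lambda>(z, w). D2 z w) ((?y (fst p) (snd p), ?y' (fst p) (snd p)), (u (snd p), u' (snd p))))"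
      by (rule continuous_on_compose2[OF D2c continuous_on_Pair[OF continuous_on_Pair[OF c(1,2)] continuous_on_Pair[OF c(3,4)]]]) 
        (use J in auto)
    then show "continuous_on N (\<lambda>p. D2 (?y (fst p) (snd p), ?y' (fst p) (snd p)) (u (snd p), u' (snd p)))"
      by simp
  qed
qed


context atlas
begin

text \<open>The times spent in a chart form a relatively open subset of [0,T], so derivatives within
  that subset are derivatives within [0,T].\<close>

lemma curve_chartE:
  assumes \<gamma>: "C1_curve_on A {0..T} \<gamma>" and d: "d \<in> A"
  obtains W x' where "open W" "{t \<in> {0..T}. \<gamma> t \<in> fst d} = {0..T} \<inter> W"
    "\<And>t. t \<in> {0..T} \<inter> W \<Longrightarrow> ((\<lambda>t. snd d (\<gamma> t)) has_vector_derivative x' t) (at t within {0..T})"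
    "continuous_on ({0..T} \<inter> W) x'"
proof -
  have "openin (top_of_set {0..T}) {t \<in> {0..T}. \<gamma> t \<in> fst d}"
    using openin_continuous_map_preimage[OF _ openin_chart_domain[OF d]] \<gamma> by (fastforce simp: C1_curve_on_def)
  then obtain W where W: "open W" "{t \<in> {0..T}. \<gamma> t \<in> fst d} = {0..T} \<inter> W" by (auto simp: openin_open)
  from \<gamma> d have "C1_on ({0..T} \<inter> W) (snd d \<circ> \<gamma>)"
    unfolding C1_curve_on_def W(2)[symmetric] by blast
  then obtain x' where x': "\<And>t. t \<in> {0..T} \<inter> W \<Longrightarrow> ((snd d \<circ> \<gamma>) has_vector_derivative x' t) (at t within {0..T} \<inter> W)"
    "continuous_on ({0..T} \<inter> W) x'"
    unfolding C1_on_def by blast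
  have "at t within {0..T} \<inter> W = at t within {0..T}" if "t \<in> {0..T} \<inter> W" for t
    by (rule at_within_nhd[OF _ W(1)]) (use that in auto)
  with x' W show ?thesis by (intro that[of W x']) (auto simp: o_def)
qed

end

lemma partial_variation_bump:
  assumes "0 \<le> \<alpha>" "\<alpha> \<le> \<beta>"
  shows "partial_variation T (\<lambda>t. bump \<alpha> \<beta> t *\<^sub>R v) (\<lambda>t. bump \<alpha> \<beta> t *\<^sub>R \<nu>)"
  unfolding partial_variation_def C1_on_def
  using assms by (auto intro!: exI[of _ "\<lambda>t. bump' \<alpha> \<beta> t *\<^sub>R _"] bump_scaleR_has_derivative 
      continuous_intros continuous_on_bump bump_eq_0)

section \<open>Variations supported in one chart\<close>

context hamiltonian_system
begin

text \<open>At times in \<open>J\<close> the family moves inside the chart c; outside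
  [\<alpha>, \<beta>] the displacement vanishes and the family equals q. The corresponding regions
  \<open>N1\<close> and \<open>N2\<close> are relatively open and cover the strip, so continuity and
  differentiability are checked on each. The bound \<beta> may exceed T, which admits variations
  that move the end of the curve at T.\<close>

lemma variation_exists:
  assumes adm: "admissible_curve A T q\<^sub>0 q \<mu>" and c: "c \<in> A" and \<alpha>\<beta>: "0 \<le> \<alpha>" "\<alpha> < \<beta>"
    and in_chart: "\<And>t. t \<in> {0..T} \<Longrightarrow> t \<in> {\<alpha>..\<beta>} \<Longrightarrow> q t \<in> fst c"
  obtains a qf \<mu>f where
    "variation_family A \<Phi> T q\<^sub>0 q \<mu> (\<lambda>t. bump \<alpha> \<beta> t *\<^sub>R v) (\<lambda>t. bump \<alpha> \<beta> t *\<^sub>R \<nu>) a qf \<mu>f"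
proof -
  have q: "C1_curve_on A {0..T} q" and \<mu>: "C1_on {0..T} \<mu>" and q0: "q 0 = q\<^sub>0"
    using adm by (auto simp: admissible_curve_def)
  have q_cont: "continuous_map (top_of_set {0..T}) (atlas_topology A) q"
    using q by (simp add: C1_curve_on_def)
  then have q_points: "q t \<in> points A" if "t \<in> {0..T}" for t
    using that by (auto simp: continuous_map_def Pi_iff)
  let ?U = "snd c ` fst c"
  have U: "open ?U" by (rule open_chart_image[OF c])
  obtain W x' where W: "open W" "{t \<in> {0..T}. q t \<in> fst c} = {0..T} \<inter> W"
    and x': "\<And>t. t \<in> {0..T} \<inter> W \<Longrightarrow> ((\<lambda>t. snd c (q t)) has_vector_derivative x' t) (at t within {0..T})"
    "continuous_on ({0..T} \<inter> W) x'"
    by (rule curve_chartE[OF q c]) (rule that)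
  define J where "J = {0..T} \<inter> W"
  have J: "t \<in> J \<longleftrightarrow> t \<in> {0..T} \<and> q t \<in> fst c" for t unfolding J_def W(2)[symmetric] by simp
  define x where "x t = snd c (q t)" for t
  have x_deriv: "(x has_vector_derivative x' t) (at t within {0..T})" if "t \<in> J" for t
    using x'(1) that by (simp add: x_def[abs_def] J_def)
  have x'_cont: "continuous_on J x'" using x'(2) by (simp add: J_def)
  have J_sub: "J \<subseteq> {0..T}" by (auto simp: J_def)
  have continuous_on_J: "continuous_on J f" 
    if "\<And>t. t \<in> J \<Longrightarrow> (f has_vector_derivative f' t) (at t within {0..T})" 
    for f f' :: "real \<Rightarrow> 'e"
    using that J_sub
    by (auto simp: continuous_on_eq_continuous_within 
        intro: has_vector_derivative_continuous has_vector_derivative_within_subset)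
  note x_cont = continuous_on_J[OF x_deriv]
  have x_U: "x t \<in> ?U" if "t \<in> J" for t using that by (auto simp: J x_def)
  \<comment> \<open>The coordinates of \<Phi>(q)\<eta> for \<eta> = bump \<cdot> v: the prescribed
    \<epsilon>-velocity of the family.\<close>
  define u where "u t = bump \<alpha> \<beta> t *\<^sub>R loc c (x t) v" for t
  define u' where "u' t = bump \<alpha> \<beta> t *\<^sub>R dloc c (x t) v (x' t) + bump' \<alpha> \<beta> t *\<^sub>R loc c (x t) v" for t
  have loc_deriv: "((\<lambda>t. loc c (x t) v) has_vector_derivative dloc c (x t) v (x' t)) (at t within {0..T})" if "t \<in> J" for t
  proof -
    have "c \<in> charts_at A (q t)" using that c by (auto simp: J charts_at_def)
    from has_vector_derivative_chain[OF x_deriv[OF that] loc_has_derivative(2)[OF this]]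
    show ?thesis by (simp add: x_def)
  qed
  have u_deriv: "(u has_vector_derivative u' t) (at t within {0..T})" if "t \<in> J" for t
    unfolding u_def[abs_def] u'_def
    by (rule has_vector_derivative_scaleR[OF bump_has_derivative loc_deriv[OF that]])
  have u'_cont: "continuous_on J u'"
  proof -
    have "C1_param {0} ?U (\<lambda>_ x. (x, v))"
      by (intro C1_param_Pair C1_param_linear C1_param_const bounded_linear_intros)
    from C1_param_compose[OF C1_param_loc[OF c] this]
    have "C1_param {0} ?U (\<lambda>_ x. loc c x v)" by auto
    then obtain D where D: "\<And>t z. t \<in> {0::real} \<Longrightarrow> z \<in> ?U \<Longrightarrow> ((\<lambda>x. loc c x v) has_derivative D t z) (at z)"
      "continuous_on ({0::real} \<times> ?U) (\<lambda>(t, z). loc c z v)"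
      "continuous_on ({0::real} \<times> ?U \<times> UNIV) (\<lambda>(t, z, w). D t z w)"
      by (rule C1_paramE) (rule that)
    have "continuous_on J (\<lambda>t. (\<lambda>(t, z, w). D t z w) (0, x t, x' t))"
      by (rule continuous_on_compose2[OF D(3)]) (use x_U in \<open>auto intro!: continuous_intros x_cont x'_cont\<close>)
    moreover have "D 0 (x t) = dloc c (x t) v" if "t \<in> J" for t
      using frechet_derivative_at[OF D(1)[OF _ x_U[OF that], of 0]] by (simp add: dloc_def)
    ultimately have "continuous_on J (\<lambda>t. dloc c (x t) v (x' t))"
      by (auto elim!: continuous_on_eq)
    then show ?thesis
      unfolding u'_def[abs_def]
      by (intro continuous_intros continuous_on_bump continuous_on_J[OF loc_deriv])
  qed
  have u_0: "u t = 0" if "t \<notin> {\<alpha>..\<beta>}" for t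
    using bump_eq_0[of \<alpha> \<beta> t] that \<alpha>\<beta> by (auto simp: u_def)
  define y where "y \<epsilon> t = x t + \<epsilon> *\<^sub>R u t" for \<epsilon> t
  \<comment> \<open>On the compact set of times in [0,T] and [\<alpha>, \<beta>], balls of some
    radius e around x stay in the chart image and u has norm at most B. So \<bar>\<epsilon>\<bar> <
    e / B keeps the line in the chart image; at the other times of \<open>J\<close> the line is
    constant.\<close>
  obtain a where a: "a > 0" and y_U: "\<And>\<epsilon> t. \<epsilon> \<in> {-a<..<a} \<Longrightarrow> t \<in> J \<Longrightarrow> y \<epsilon> t \<in> ?U"
  proof -
    let ?K = "{0..T} \<inter> {\<alpha>..\<beta>}"
    have K: "compact ?K" "?K \<subseteq> J" using in_chart by (auto simp: J compact_Int_closed)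
    have xK: "compact (x ` ?K)"
      by (rule compact_continuous_image[OF continuous_on_subset[OF x_cont K(2)] K(1)])
    have uK: "compact (u ` ?K)"
      by (rule compact_continuous_image[OF continuous_on_subset[OF continuous_on_J[OF u_deriv] K(2)] K(1)])
    obtain e where e: "e > 0" "(\<Union>z\<in>x ` ?K. ball z e) \<subseteq> ?U"
      by (rule compact_subset_open_imp_ball_epsilon_subset[OF xK U]) (use x_U K(2) in auto)
    obtain B where B: "B > 0" "\<And>z. z \<in> u ` ?K \<Longrightarrow> norm z \<le> B"
      using compact_imp_bounded[OF uK] unfolding bounded_pos by blast
    show ?thesis
    proof (rule that[of "e / B"])
      show "e / B > 0" using e B by simp
      fix \<epsilon> t assume \<epsilon>: "\<epsilon> \<in> {- (e / B)<..<e / B}" and t: "t \<in> J"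
      show "y \<epsilon> t \<in> ?U"
      proof (cases "t \<in> {\<alpha>..\<beta>}")
        case True
        then have tK: "t \<in> ?K" using t J_sub by auto
        have "norm (\<epsilon> *\<^sub>R u t) \<le> \<bar>\<epsilon>\<bar> * B" using B(2)[of "u t"] tK by (auto intro!: mult_left_mono)
        also have "\<dots> < e" using \<epsilon> B(1) by (auto simp: abs_less_iff field_simps)
        finally have "y \<epsilon> t \<in> ball (x t) e" by (simp add: y_def dist_norm)
        then show ?thesis using e(2) tK by blast
      next
        case False
        then show ?thesis using x_U[OF t] by (simp add: y_def u_0)
      qed
    qed
  qed
  \<comment> \<open>Outside \<open>J\<close> the curve is not in the chart and is left fixed. Where
    t lies in \<open>J\<close> but outside [\<alpha>, \<beta>] the first case returns q t as
    well.\<close>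
  define qf where "qf \<epsilon> t = (if t \<in> J then chart_inv c (y \<epsilon> t) else q t)" for \<epsilon> t
  define \<mu>f where "\<mu>f \<epsilon> t = \<mu> t + \<epsilon> *\<^sub>R (bump \<alpha> \<beta> t *\<^sub>R \<nu>)" for \<epsilon> t
  have qf_J: "qf \<epsilon> t \<in> fst c" "snd c (qf \<epsilon> t) = y \<epsilon> t" if "\<epsilon> \<in> {-a<..<a}" "t \<in> J" for \<epsilon> t
    using chart_inv_right[OF y_U[OF that]] that by (auto simp: qf_def)
  have qf_out: "qf \<epsilon> t = q t" if "t \<notin> {\<alpha>..\<beta>}" for \<epsilon> t
    using that c by (auto simp: qf_def y_def u_0 x_def J)
  have qf_0: "qf 0 t = q t" for t
    using c by (auto simp: qf_def y_def x_def J)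
  have cover: "t \<in> J \<or> t \<notin> {\<alpha>..\<beta>}" if "t \<in> {0..T}" for t
    using that in_chart J by auto
  define N1 where "N1 = strip a T \<inter> (UNIV \<times> W)"
  define N2 where "N2 = strip a T \<inter> (UNIV \<times> - {\<alpha>..\<beta>})"
  have N1_J: "(\<epsilon>, t) \<in> N1 \<longleftrightarrow> \<epsilon> \<in> {-a<..<a} \<and> t \<in> J" for \<epsilon> t
    by (auto simp: N1_def J_def)
  have N: "openin (top_of_set (strip a T)) N1" "openin (top_of_set (strip a T)) N2"
    using W(1) by (auto simp: N1_def N2_def intro!: openin_open_Int open_Times)
  have y_cont: "continuous_on N1 (\<lambda>p. y (fst p) (snd p))"
  proof -
    have "snd ` N1 \<subseteq> J" by (auto simp: N1_def J_def)
    note * = continuous_on_compose2[OF _ continuous_on_snd[OF continuous_on_id] this]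
    show ?thesis
      unfolding y_def by (intro continuous_intros *[OF x_cont] *[OF continuous_on_J[OF u_deriv]])
  qed
  have qf_cont: "continuous_map (top_of_set (strip a T)) (atlas_topology A) (\<lambda>(\<epsilon>, t). qf \<epsilon> t)"
    unfolding continuous_map_def
  proof (intro conjI allI impI)
    have "qf \<epsilon> t \<in> points A" if "(\<epsilon>, t) \<in> strip a T" for \<epsilon> t
    proof (cases "t \<in> J")
      case True
      then show ?thesis using qf_J(1)[of \<epsilon> t] that c by (force simp: points_def)
    next
      case False
      then have "qf \<epsilon> t = q t" using cover[of t] that by (intro qf_out) auto
      then show ?thesis using q_points[of t] that by simp
    qed
    then show "(\<lambda>(\<epsilon>, t). qf \<epsilon> t) \<in> topspace (top_of_set (strip a T)) \<rightarrow> topspace (atlas_topology A)"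
      by auto
    fix V assume V: "openin (atlas_topology A) V"
    then have oV: "open (snd c ` (V \<inter> fst c))" using c by (simp add: openin_atlas_topology)
    have "openin (top_of_set {0..T}) {t \<in> {0..T}. q t \<in> V}"
      using openin_continuous_map_preimage[OF q_cont V] by simp
    then obtain W' where W': "open W'" "{t \<in> {0..T}. q t \<in> V} = {0..T} \<inter> W'" by (auto simp: openin_open)
    have W'_iff: "q t \<in> V \<longleftrightarrow> t \<in> W'" if "t \<in> {0..T}" for t
      using W'(2) that by blast
    \<comment> \<open>By injectivity of the chart, membership in V can be tested on
      coordinates.\<close>
    have y_V: "qf \<epsilon> t \<in> V \<longleftrightarrow> y \<epsilon> t \<in> snd c ` (V \<inter> fst c)" if "(\<epsilon>, t) \<in> N1" for \<epsilon> t
    proof -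
      have "\<epsilon> \<in> {-a<..<a}" "t \<in> J" using that by (auto simp: N1_J)
      note * = qf_J[OF this]
      show ?thesis
        using * inj_onD[OF chart_inj_on[OF c]] by (force simp flip: *(2))
    qed
    \<comment> \<open>On \<open>N1\<close> the preimage of V is read off from the coordinates y, on
      \<open>N2\<close> from the undisturbed curve; both pieces are relatively open.\<close>
    have "{p \<in> topspace (top_of_set (strip a T)). (case p of (\<epsilon>, t) \<Rightarrow> qf \<epsilon> t) \<in> V} =
       (N1 \<inter> (\<lambda>p. y (fst p) (snd p)) -` (snd c ` (V \<inter> fst c))) \<union> (N2 \<inter> (UNIV \<times> W'))" (is "?L = ?R1 \<union> ?R2")
    proof (intro set_eqI)
      fix p :: "real \<times> real"
      obtain \<epsilon> t where p: "p = (\<epsilon>, t)" by (cases p)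
      have N2: "(\<epsilon>, t) \<in> N2 \<Longrightarrow> qf \<epsilon> t \<in> V \<longleftrightarrow> t \<in> W'"
        using W'_iff[of t] by (auto simp: N2_def qf_out)
      have "(\<epsilon>, t) \<in> strip a T \<longleftrightarrow> (\<epsilon>, t) \<in> N1 \<or> (\<epsilon>, t) \<in> N2"
        using cover[of t] by (auto simp: N1_def N2_def J_def)
      then show "p \<in> ?L \<longleftrightarrow> p \<in> ?R1 \<union> ?R2"
        using y_V[of \<epsilon> t] N2 unfolding p by auto
    qed
    moreover have "openin (top_of_set (strip a T)) ?R1"
      by (rule openin_trans[OF continuous_openin_preimage_gen[OF y_cont oV] N(1)])
    moreover have "openin (top_of_set (strip a T)) ?R2"
      using W'(1) N(2) unfolding N2_def by (auto simp: Int_assoc intro!: openin_open_Int open_Int open_Times)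
    ultimately show "openin (top_of_set (strip a T)) ?L" by auto
  qed
  \<comment> \<open>Every chart d has to be treated. On \<open>N1\<close> the transition from c to d
    is applied to the line; on \<open>N2\<close> nothing moves, which is the case of the transition
    from d to itself with zero displacement.\<close>
  have qf_C1: "C1_family_on (chart_part a qf d) (\<lambda>\<epsilon> t. snd d (qf \<epsilon> t))" if d: "d \<in> A" for d
  proof (rule C1_family_on_local[OF openin_chart_part[OF qf_cont d] T_pos])
    note D = openin_chart_part[OF qf_cont d]
    fix p assume p: "p \<in> chart_part a qf d"
    then have "p \<in> N1 \<or> p \<in> N2"
      using cover[of "snd p"] by (auto simp: chart_part_def N1_def N2_def J_def)
    then show "\<exists>N. openin (top_of_set (strip a T)) N \<and> p \<in> N \<and> C1_family_on N (\<lambda>\<epsilon> t. snd d (qf \<epsilon> t))"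
    proof
      assume "p \<in> N1"
      have "C1_family_on (chart_part a qf d \<inter> N1) (\<lambda>\<epsilon> t. (snd d \<circ> chart_inv c) (x t + \<epsilon> *\<^sub>R u t))"
      proof (rule C1_family_on_transition[OF smooth_transition[OF c d] open_overlap[OF c d] openin_Int[OF D N(1)]
            _ x_deriv x'_cont u_deriv u'_cont J_sub])
        fix \<epsilon> t assume "(\<epsilon>, t) \<in> chart_part a qf d \<inter> N1"
        then have *: "\<epsilon> \<in> {-a<..<a}" "t \<in> J" "qf \<epsilon> t \<in> fst d" by (auto simp: N1_J chart_part_def)
        then show "t \<in> J \<and> x t + \<epsilon> *\<^sub>R u t \<in> snd c ` (fst c \<inter> fst d)"
          using qf_J[OF *(1,2)] by (auto simp: y_def image_iff intro!: bexI[of _ "qf \<epsilon> t"])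
      qed
      then have "C1_family_on (chart_part a qf d \<inter> N1) (\<lambda>\<epsilon> t. snd d (qf \<epsilon> t))"
        by (rule C1_family_on_cong[rotated]) (auto simp: N1_J qf_def y_def)
      then show ?thesis using openin_Int[OF D N(1)] p \<open>p \<in> N1\<close> by blast
    next
      assume "p \<in> N2"
      obtain W2 x2 where W2: "open W2" "{t \<in> {0..T}. q t \<in> fst d} = {0..T} \<inter> W2"
        and x2: "\<And>t. t \<in> {0..T} \<inter> W2 \<Longrightarrow> ((\<lambda>t. snd d (q t)) has_vector_derivative x2 t) (at t within {0..T})"
        "continuous_on ({0..T} \<inter> W2) x2"
        by (rule curve_chartE[OF q d]) (rule that)
      have "C1_family_on (chart_part a qf d \<inter> N2) (\<lambda>\<epsilon> t. (snd d \<circ> chart_inv d) (snd d (q t) + \<epsilon> *\<^sub>R 0))"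
      proof (rule C1_family_on_transition[OF smooth_transition[OF d d] open_overlap[OF d d] openin_Int[OF D N(2)]
            _ x2 has_vector_derivative_const continuous_on_const])
        fix \<epsilon> t assume "(\<epsilon>, t) \<in> chart_part a qf d \<inter> N2"
        then have "t \<in> {0..T}" "q t \<in> fst d" by (auto simp: N2_def chart_part_def qf_out)
        moreover from this have "t \<in> {0..T} \<inter> W2" unfolding W2(2)[symmetric] by simp
        ultimately show "t \<in> {0..T} \<inter> W2 \<and> snd d (q t) + \<epsilon> *\<^sub>R 0 \<in> snd d ` (fst d \<inter> fst d)"
          by simp
      qed auto
      then have "C1_family_on (chart_part a qf d \<inter> N2) (\<lambda>\<epsilon> t. snd d (qf \<epsilon> t))"
        by (rule C1_family_on_cong[rotated]) (use d in \<open>auto simp: N2_def qf_out chart_part_def\<close>)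
      then show ?thesis using openin_Int[OF D N(2)] p \<open>p \<in> N2\<close> by blast
    qed
  qed
  obtain \<mu>' where \<mu>': "\<And>t. t \<in> {0..T} \<Longrightarrow> (\<mu> has_vector_derivative \<mu>' t) (at t within {0..T})" "continuous_on {0..T} \<mu>'"
    using \<mu> unfolding C1_on_def by blast
  have \<mu>_cont: "continuous_on {0..T} \<mu>"
    unfolding continuous_on_eq_continuous_within by (intro ballI has_vector_derivative_continuous[OF \<mu>'(1)])
  have \<mu>f_t: "((\<lambda>t. \<mu>f \<epsilon> t) has_vector_derivative \<mu>' t + \<epsilon> *\<^sub>R (bump' \<alpha> \<beta> t *\<^sub>R \<nu>)) (at t within {0..T})" if "t \<in> {0..T}" for \<epsilon> t
    unfolding \<mu>f_def 
    using has_vector_derivative_scaleR[OF DERIV_const bump_scaleR_has_derivative, of \<epsilon>]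
    by (auto intro!: has_vector_derivative_add \<mu>'(1) that)
  have lin: "((\<lambda>r. b + r *\<^sub>R d) has_vector_derivative d) (at r)" for b d :: "'v \<Rightarrow>\<^sub>L real" and r :: real
    by (auto intro!: derivative_eq_intros)
  have \<mu>f_C1: "C1_family_on (strip a T) \<mu>f"
  proof -
    have s: "continuous_on (strip a T) (\<lambda>p. f (snd p))" if "continuous_on {0..T} f" for f :: "real \<Rightarrow> 'v \<Rightarrow>\<^sub>L real"
      by (rule continuous_on_compose2[OF that]) (auto intro!: continuous_intros)
    have b: "continuous_on {0..T} (\<lambda>t. bump \<alpha> \<beta> t *\<^sub>R \<nu>)" "continuous_on {0..T} (\<lambda>t. bump' \<alpha> \<beta> t *\<^sub>R \<nu>)"
      by (intro continuous_intros continuous_on_bump)+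
    have "openin (top_of_set (strip a T)) (strip a T)" by simp
    from C1_family_on_strip[OF this] show ?thesis
      apply (rule iffD2)
      apply (rule exI[of _ "\<lambda>\<epsilon> t. \<mu>' t + \<epsilon> *\<^sub>R (bump' \<alpha> \<beta> t *\<^sub>R \<nu>)"])
      apply (rule exI[of _ "\<lambda>\<epsilon> t. bump \<alpha> \<beta> t *\<^sub>R \<nu>"])
      apply (rule exI[of _ "\<lambda>\<epsilon> t. bump' \<alpha> \<beta> t *\<^sub>R \<nu>"])
      unfolding case_prod_unfold
      apply (intro conjI ballI)
      subgoal using \<mu>f_t by auto
      subgoal unfolding \<mu>f_def by (rule lin)
      subgoal by (rule lin)
      subgoal unfolding \<mu>f_def by (intro continuous_intros s[OF \<mu>_cont] s[OF b(1), simplified])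
      subgoal by (intro continuous_intros s[OF \<mu>'(2)] s[OF b(2), simplified])
      subgoal by (rule s[OF b(1)])
      subgoal by (rule s[OF b(2)])
      done
  qed
  have adm_f: "admissible_curve A T q\<^sub>0 (qf \<epsilon>) (\<mu>f \<epsilon>)" if \<epsilon>: "\<epsilon> \<in> {-a<..<a}" for \<epsilon>
    unfolding admissible_curve_def C1_curve_on_def
  proof (intro conjI ballI)
    have "continuous_map (top_of_set {0..T}) (top_of_set (strip a T)) (Pair \<epsilon>)"
      using \<epsilon> by (auto intro!: continuous_intros)
    from continuous_map_compose[OF this qf_cont]
    show "continuous_map (top_of_set {0..T}) (atlas_topology A) (qf \<epsilon>)" by (simp add: o_def)
    show "C1_on {0..T} (\<mu>f \<epsilon>)"
      unfolding C1_on_def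
      by (intro exI[of _ "\<lambda>t. \<mu>' t + \<epsilon> *\<^sub>R (bump' \<alpha> \<beta> t *\<^sub>R \<nu>)"] conjI ballI \<mu>f_t 
          continuous_intros \<mu>'(2) continuous_on_bump)
    \<comment> \<open>As \<alpha> \<ge> 0, the bump vanishes at time 0 and the initial point stays
      fixed.\<close>
    have "y \<epsilon> 0 = x 0" using \<alpha>\<beta> by (simp add: y_def u_def bump_eq_0)
    then show "qf \<epsilon> 0 = q\<^sub>0" using c q0 by (auto simp: qf_def x_def J)
    fix d assume d: "d \<in> A"
    let ?D = "chart_part a qf d"
    have slice: "{s. (\<epsilon>, s) \<in> ?D} = {t \<in> {0..T}. qf \<epsilon> t \<in> fst d}" using \<epsilon> by (auto simp: chart_part_def)
    obtain xt where xt: "\<And>t. (\<epsilon>, t) \<in> ?D \<Longrightarrow> 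
        ((\<lambda>s. snd d (qf \<epsilon> s)) has_vector_derivative xt \<epsilon> t) (at t within {s. (\<epsilon>, s) \<in> ?D})"
      "continuous_on ?D (\<lambda>(\<epsilon>, t). xt \<epsilon> t)"
      using qf_C1[OF d] unfolding C1_family_on_def by blast
    have "continuous_on {s. (\<epsilon>, s) \<in> ?D} (\<lambda>t. (\<lambda>(\<epsilon>, t). xt \<epsilon> t) (\<epsilon>, t))"
      by (rule continuous_on_compose2[OF xt(2)]) (auto intro!: continuous_intros)
    with xt(1) show "C1_on {t \<in> {0..T}. qf \<epsilon> t \<in> fst d} (snd d \<circ> qf \<epsilon>)"
      unfolding C1_on_def slice[symmetric] by (intro exI[of _ "xt \<epsilon>"]) (auto simp: o_def)
  qed
  have at_0: "at 0 within {-a<..<a} = at (0::real)" using a by (intro at_within_open) auto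
  have vel: "velocity A {-a<..<a} (\<lambda>\<epsilon>. qf \<epsilon> t) 0 = \<Phi> (q t) (bump \<alpha> \<beta> t *\<^sub>R v)" if t: "t \<in> {0..T}" for t
  proof -
    \<comment> \<open>At times in \<open>J\<close> the chart c shows the \<epsilon>-curve as a line;
      at other times the \<epsilon>-curve is constant and any chart at q t will do.\<close>
    have "\<exists>d\<in>charts_at A (q t). (\<forall>\<epsilon>\<in>{-a<..<a}. qf \<epsilon> t \<in> fst d \<and> 
        snd d (qf \<epsilon> t) = snd d (q t) + \<epsilon> *\<^sub>R (bump \<alpha> \<beta> t *\<^sub>R loc d (snd d (q t)) v))"
    proof (cases "t \<in> J")
      case True
      then show ?thesis
        using c qf_J[OF _ True] by (intro bexI[of _ c]) (auto simp: J y_def u_def x_def charts_at_def)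
    next
      case False
      then have "t \<notin> {\<alpha>..\<beta>}" using cover t by auto
      then show ?thesis
        using chart_at_charts_at[OF q_points[OF t]] \<alpha>\<beta>
        by (intro bexI[of _ "chart_at A (q t)"]) (auto simp: qf_out bump_eq_0)
    qed
    then obtain d where d: "d \<in> charts_at A (q t)" and dq: "\<And>\<epsilon>. \<epsilon> \<in> {-a<..<a} \<Longrightarrow> qf \<epsilon> t \<in> fst d"
      "\<And>\<epsilon>. \<epsilon> \<in> {-a<..<a} \<Longrightarrow> snd d (qf \<epsilon> t) = snd d (q t) + \<epsilon> *\<^sub>R (bump \<alpha> \<beta> t *\<^sub>R loc d (snd d (q t)) v)"
      by blast
    let ?w = "bump \<alpha> \<beta> t *\<^sub>R loc d (snd d (q t)) v"
    have ev: "eventually (\<lambda>\<epsilon>. \<epsilon> \<in> {-a<..<a}) (at 0 within {-a<..<a})"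
      by (simp add: eventually_at_topological) (use open_UNIV in blast)
    have "velocity A {-a<..<a} (\<lambda>\<epsilon>. qf \<epsilon> t) 0 = tvec_of A d (qf 0 t) ?w"
    proof (rule velocity_eq)
      have "((\<lambda>r. snd d (q t) + r *\<^sub>R ?w) has_vector_derivative ?w) (at 0 within {-a<..<a})"
        by (auto intro!: derivative_eq_intros)
      then show "((snd d \<circ> (\<lambda>\<epsilon>. qf \<epsilon> t)) has_vector_derivative ?w) (at 0 within {-a<..<a})"
        by (rule has_vector_derivative_transform[rotated 2]) (use a dq(2) in auto)
      show "eventually (\<lambda>\<epsilon>. qf \<epsilon> t \<in> fst d) (at 0 within {-a<..<a})"
        using ev by (rule eventually_mono) (rule dq(1))
    qed (use d a at_0 in \<open>auto simp: qf_0\<close>)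
    also have "\<dots> = \<Phi> (q t) (bump \<alpha> \<beta> t *\<^sub>R v)"
      using triv_eq_tvec_of[OF d] by (simp add: qf_0 linear_scale[OF linear_loc[OF d]])
    finally show ?thesis .
  qed
  have \<mu>f_0: "\<mu>f 0 t = \<mu> t" "((\<lambda>\<epsilon>. \<mu>f \<epsilon> t) has_vector_derivative bump \<alpha> \<beta> t *\<^sub>R \<nu>) (at 0)" for t
    unfolding \<mu>f_def by (simp, rule lin)
  have "variation_family A \<Phi> T q\<^sub>0 q \<mu> (\<lambda>t. bump \<alpha> \<beta> t *\<^sub>R v) (\<lambda>t. bump \<alpha> \<beta> t *\<^sub>R \<nu>) a qf \<mu>f"
    unfolding variation_family_def
    using a adm_f qf_cont qf_C1 \<mu>f_C1 vel qf_0 \<mu>f_0 by (auto simp: chart_part_def)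
  then show ?thesis by (rule that)
qed

end

section \<open>The fundamental lemma and Hamel's equations\<close>

context hamiltonian_system
begin

text \<open>
  The function multiplying the bump in the first variation for \<open>\<eta> = bump \<cdot> v\<close>, \<open>\<delta>\<mu> = bump \<cdot> \<nu>\<close>, after
  integrating \<open>\<langle>\<mu>, \<eta>'\<rangle>\<close> by parts.
\<close>

definition residual ::
  "(real \<Rightarrow> 'm) \<Rightarrow> (real \<Rightarrow> 'v \<Rightarrow>\<^sub>L real) \<Rightarrow> (real \<Rightarrow> 'v \<Rightarrow>\<^sub>L real) \<Rightarrow> 'v \<Rightarrow> ('v \<Rightarrow>\<^sub>L real) \<Rightarrow> real \<Rightarrow> real" where
  "residual q \<mu> \<mu>' v \<nu> t = 
     blinfun_apply \<nu> (triv_velocity A \<Phi> T q t - D_mu h t (q t) (\<mu> t)) +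
     blinfun_apply (ad_star A \<Phi> (q t) (triv_velocity A \<Phi> T q t) (\<mu> t) 
       - triv_dual \<Phi> (q t) (D_q A h t (q t) (\<mu> t)) - \<mu>' t) v"

lemma chart_near:
  assumes q: "C1_curve_on A {0..T} q" and t: "t \<in> {0..T}"
  obtains c d where "c \<in> charts_at A (q t)" "d > 0" "\<And>s. s \<in> {0..T} \<Longrightarrow> s \<in> cball t d \<Longrightarrow> q s \<in> fst c"
proof -
  have "q t \<in> points A" using q t by (auto simp: C1_curve_on_def continuous_map_def Pi_iff)
  then obtain c where c: "c \<in> A" "q t \<in> fst c" by (auto simp: points_def)
  obtain W where W: "open W" "{t \<in> {0..T}. q t \<in> fst c} = {0..T} \<inter> W"
    by (rule curve_chartE[OF q c(1)]) (rule that)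
  have iff: "s \<in> W \<longleftrightarrow> q s \<in> fst c" if "s \<in> {0..T}" for s using W(2) that by blast
  obtain d where "d > 0" "cball t d \<subseteq> W"
    using W(1) iff[OF t] c(2) open_contains_cball by blast
  then show ?thesis using iff c by (intro that[of c d]) (auto simp: charts_at_def)
qed

text \<open>\<open>inv (\<Phi> p)\<close> is undone by \<open>\<Phi> p\<close> only on the tangent
  space, so the velocity has to be known to lie there before it can be recovered from \<xi>.\<close>

lemma velocity_tangent:
  assumes q: "C1_curve_on A {0..T} q" and t: "t \<in> {0..T}"
  shows "velocity A {0..T} q t \<in> tangent_space A (q t)" "q t \<in> points A"
proof -
  obtain c d where c: "c \<in> charts_at A (q t)" and d: "d > 0" "\<And>s. s \<in> {0..T} \<Longrightarrow> s \<in> cball t d \<Longrightarrow> q s \<in> fst c"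
    by (rule chart_near[OF assms]) (rule that)
  then show "q t \<in> points A" using points_chart by blast
  obtain W x' where W: "open W" "{t \<in> {0..T}. q t \<in> fst c} = {0..T} \<inter> W"
    and x': "\<And>t. t \<in> {0..T} \<inter> W \<Longrightarrow> ((\<lambda>t. snd c (q t)) has_vector_derivative x' t) (at t within {0..T})"
    by (rule curve_chartE[OF q charts_atD(1)[OF c]]) (rule that)
  have iff: "s \<in> W \<longleftrightarrow> q s \<in> fst c" if "s \<in> {0..T}" for s using W(2) that by blast
  then have tW: "t \<in> W" using c t by auto
  have "eventually (\<lambda>s. q s \<in> fst c) (at t within {0..T})"
    unfolding eventually_at_topological using W(1) tW iff by blast
  then show "velocity A {0..T} q t \<in> tangent_space A (q t)"
    using triv_velocity_eq(1)[OF c t x'] tW t tvec_of_tangent[OF c] by auto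
qed

text \<open>Subtracting the derivative of bump \<cdot> \<langle>\<mu>, v\<rangle> from the first
  variation cancels the term with bump' and leaves the bump times the residual. Of the boundary
  terms, the one at 0 vanishes with the bump, and the one at T combines with the prescribed
  \<open>\<mu>\<^sub>1\<close>. Continuity of the product comes from
  \<open>action_has_derivative\<close>.\<close>

lemma weak_Hamel:
  assumes adm: "admissible_curve A T q\<^sub>0 q \<mu>" and dA: "type_II_dAlembert A \<Phi> h T q\<^sub>0 \<mu>\<^sub>1 q \<mu>"
    and c: "c \<in> A" and \<alpha>\<beta>: "0 \<le> \<alpha>" "\<alpha> < \<beta>"
    and in_chart: "\<And>t. t \<in> {0..T} \<Longrightarrow> t \<in> {\<alpha>..\<beta>} \<Longrightarrow> q t \<in> fst c"
    and \<mu>': "\<And>t. t \<in> {0..T} \<Longrightarrow> (\<mu> has_vector_derivative \<mu>' t) (at t within {0..T})" "continuous_on {0..T} \<mu>'"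
  shows "continuous_on {0..T} (\<lambda>t. bump \<alpha> \<beta> t * residual q \<mu> \<mu>' v \<nu> t)"
    and "integral {0..T} (\<lambda>t. bump \<alpha> \<beta> t * residual q \<mu> \<mu>' v \<nu> t) = bump \<alpha> \<beta> T * blinfun_apply (\<mu>\<^sub>1 - \<mu> T) v"
proof -
  let ?\<phi> = "bump \<alpha> \<beta>" and ?\<phi>' = "bump' \<alpha> \<beta>"
  obtain a qf \<mu>f where fam: "variation_family A \<Phi> T q\<^sub>0 q \<mu> (\<lambda>t. ?\<phi> t *\<^sub>R v) (\<lambda>t. ?\<phi> t *\<^sub>R \<nu>) a qf \<mu>f"
    by (rule variation_exists[OF adm c \<alpha>\<beta> in_chart])
  define f0 where "f0 t = blinfun_apply (?\<phi> t *\<^sub>R \<nu>) (triv_velocity A \<Phi> T q t - D_mu h t (q t) (\<mu> t)) 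
     + blinfun_apply (\<mu> t) (?\<phi>' t *\<^sub>R v)
     + blinfun_apply (ad_star A \<Phi> (q t) (triv_velocity A \<Phi> T q t) (\<mu> t) 
       - triv_dual \<Phi> (q t) (D_q A h t (q t) (\<mu> t))) (?\<phi> t *\<^sub>R v)" for t
  have f0: "((\<lambda>r. lagr (qf r) (\<mu>f r) t) has_vector_derivative f0 t) (at 0)" if "t \<in> {0..T}" for t
    unfolding f0_def by (rule lagr_first_variation[OF fam that bump_scaleR_has_derivative refl])
  define k where "k t = ?\<phi> t * blinfun_apply (\<mu> t) v" for t
  define k' where "k' t = ?\<phi> t * blinfun_apply (\<mu>' t) v + ?\<phi>' t * blinfun_apply (\<mu> t) v" for t
  have \<mu>_cont: "continuous_on {0..T} \<mu>"
    unfolding continuous_on_eq_continuous_within by (intro ballI has_vector_derivative_continuous[OF \<mu>'(1)])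
  have k: "(k has_vector_derivative k' t) (at t within {0..T})" if "t \<in> {0..T}" for t
  proof -
    have "((\<lambda>t. blinfun_apply (\<mu> t) v) has_vector_derivative blinfun_apply (\<mu>' t) v) (at t within {0..T})"
      by (rule bounded_linear.has_vector_derivative[OF blinfun.bounded_linear_left \<mu>'(1)[OF that]])
    from has_vector_derivative_scaleR[OF bump_has_derivative this] 
    show ?thesis by (simp add: k_def[abs_def] k'_def)
  qed
  have k'_cont: "continuous_on {0..T} k'"
    unfolding k'_def[abs_def] by (intro continuous_intros continuous_on_bump \<mu>_cont \<mu>'(2))
  have eq: "?\<phi> t * residual q \<mu> \<mu>' v \<nu> t = f0 t - k' t" for t
    by (simp add: residual_def f0_def k'_def blinfun.scaleR_left blinfun.scaleR_right blinfun.diff_left blinfun.add_left algebra_simps)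
  note f0_cont = action_has_derivative(2)[OF fam f0]
  show "continuous_on {0..T} (\<lambda>t. ?\<phi> t * residual q \<mu> \<mu>' v \<nu> t)"
    unfolding eq by (intro continuous_intros f0_cont k'_cont)
  have "((\<lambda>\<epsilon>. action A \<Phi> h T (qf \<epsilon>) (\<mu>f \<epsilon>)) has_real_derivative blinfun_apply \<mu>\<^sub>1 (?\<phi> T *\<^sub>R v)) (at 0)"
    by (rule dA[unfolded type_II_dAlembert_def, rule_format, OF partial_variation_bump fam]) (use \<alpha>\<beta> in auto)
  from DERIV_unique[OF this action_has_derivative(1)[OF fam f0]]
  have "integral {0..T} f0 = ?\<phi> T * blinfun_apply \<mu>\<^sub>1 v" by (simp add: blinfun.scaleR_right)
  moreover have "integral {0..T} k' = k T - k 0"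
    using k T_pos by (intro integral_unique fundamental_theorem_of_calculus) auto
  moreover have "k 0 = 0" using \<alpha>\<beta> by (simp add: k_def bump_eq_0)
  ultimately show "integral {0..T} (\<lambda>t. ?\<phi> t * residual q \<mu> \<mu>' v \<nu> t) = ?\<phi> T * blinfun_apply (\<mu>\<^sub>1 - \<mu> T) v"
    unfolding eq
    by (subst integral_diff) 
      (auto intro!: integrable_continuous_interval f0_cont k'_cont simp: k_def blinfun.diff_left algebra_simps)
qed

text \<open>The weak form is used with two bumps. The large one, positive on \<open>I\<close>,
  yields continuity of the residual near t by division; the small one sits inside the region where
  the residual is positive and produces a nonnegative continuous integrand with integral zero. One
  inequality suffices, since (v, \<nu>) can be replaced by its negative.\<close>

lemma residual_nonpos:
  assumes adm: "admissible_curve A T q\<^sub>0 q \<mu>" and dA: "type_II_dAlembert A \<Phi> h T q\<^sub>0 \<mu>\<^sub>1 q \<mu>"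
    and \<mu>': "\<And>t. t \<in> {0..T} \<Longrightarrow> (\<mu> has_vector_derivative \<mu>' t) (at t within {0..T})" "continuous_on {0..T} \<mu>'"
    and t: "t \<in> {0<..<T}"
  shows "residual q \<mu> \<mu>' v \<nu> t \<le> 0"
proof (rule ccontr)
  let ?G = "residual q \<mu> \<mu>' v \<nu>"
  assume "\<not> ?G t \<le> 0"
  then have pos: "?G t > 0" by simp
  have q: "C1_curve_on A {0..T} q" and t': "t \<in> {0..T}" using adm t by (auto simp: admissible_curve_def)
  obtain c d where c: "c \<in> charts_at A (q t)" and d: "d > 0" "\<And>s. s \<in> {0..T} \<Longrightarrow> s \<in> cball t d \<Longrightarrow> q s \<in> fst c"
    by (rule chart_near[OF q t']) (rule that)
  have cA: "c \<in> A" using c by auto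
  \<comment> \<open>This radius keeps the large bump inside [0,T] and inside the chart c.\<close>
  define e where "e = min d (min t (T - t))"
  have e: "e > 0" "e \<le> d" "e \<le> t" "e \<le> T - t" using d t by (auto simp: e_def)
  define I where "I = {t - e<..<t + e}"
  have I: "I \<subseteq> {0..T}" using e by (auto simp: I_def)
  have in_chart: "q s \<in> fst c" if "s \<in> {0..T}" "s \<in> {t - r..t + r}" "r \<le> d" for s r
    using that by (intro d(2)) (auto simp: dist_real_def)
  have \<phi>_pos: "bump (t - e) (t + e) s > 0" if "s \<in> I" for s
    using that by (auto simp: I_def intro: bump_pos)
  have G_cont: "continuous_on {0..T} (\<lambda>s. bump (t - e) (t + e) s * ?G s)"
    by (rule weak_Hamel(1)[OF adm dA cA _ _ in_chart[OF _ _ e(2)] \<mu>']) (use e in auto)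
  have "continuous_on I (\<lambda>s. bump (t - e) (t + e) s * ?G s / bump (t - e) (t + e) s)"
    by (rule continuous_on_divide[OF continuous_on_subset[OF G_cont I] continuous_on_bump(1)]) (use \<phi>_pos in force)
  then have "continuous_on I ?G"
    by (rule continuous_on_eq) (use \<phi>_pos in \<open>force\<close>)
  then have "open (?G -` {0<..} \<inter> I)"
    using continuous_on_open_vimage[of I ?G] by (simp add: I_def)
  moreover have "t \<in> ?G -` {0<..} \<inter> I" using pos e by (simp add: I_def)
  ultimately obtain r where r: "r > 0" "cball t r \<subseteq> ?G -` {0<..} \<inter> I"
    using open_contains_cball by metis
  let ?\<phi> = "bump (t - r) (t + r)"
  have rI: "{t - r..t + r} \<subseteq> I" "\<And>s. s \<in> {t - r..t + r} \<Longrightarrow> ?G s > 0"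
    using r(2) by (auto simp: subset_iff dist_real_def abs_le_iff)
  have "t - r \<in> I" "t + r \<in> I" using rI(1) r(1) by auto
  \<comment> \<open>A closed ball inside the open interval \<open>I\<close> has radius below e, so
    the small bump vanishes at T and there is no boundary term.\<close>
  then have re: "r < e" by (simp add: I_def)
  have "continuous_on {0..T} (\<lambda>s. ?\<phi> s * ?G s)"
    and int: "integral {0..T} (\<lambda>s. ?\<phi> s * ?G s) = ?\<phi> T * blinfun_apply (\<mu>\<^sub>1 - \<mu> T) v"
    by (rule weak_Hamel[OF adm dA cA _ _ in_chart[of _ r] \<mu>']; use re e r in simp)+
  moreover have "?\<phi> s * ?G s \<ge> 0" if "s \<in> {0..T}" for s
  proof (cases "s \<in> {t - r..t + r}")
    case True
    then show ?thesis using rI(2)[OF True] bump_nonneg by (auto intro: mult_nonneg_nonneg less_imp_le)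
  next
    case False
    then show ?thesis using r(1) bump_eq_0[of "t - r" "t + r" s] by auto
  qed
  moreover have "?\<phi> T = 0" using re e r by (intro bump_eq_0) auto
  ultimately have "\<forall>s\<in>{0..T}. ?\<phi> s * ?G s = 0"
    using integral_eq_0_iff[of 0 T "\<lambda>s. ?\<phi> s * ?G s"] T_pos by simp
  then have "?\<phi> t * ?G t = 0" using t' by blast
  moreover have "?\<phi> t > 0" using r(1) by (intro bump_pos) auto
  ultimately show False using pos by simp
qed

lemma residual_uminus: "residual q \<mu> \<mu>' (- v) (- \<nu>) t = - residual q \<mu> \<mu>' v \<nu> t"
  by (simp add: residual_def blinfun.minus_left blinfun.minus_right)

lemma dAlembert_iff_Hamel:
  assumes adm: "admissible_curve A T q\<^sub>0 q \<mu>"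
  shows "type_II_dAlembert A \<Phi> h T q\<^sub>0 \<mu>\<^sub>1 q \<mu> \<longleftrightarrow>
    (\<forall>t\<in>{0<..<T}. velocity A {0..T} q t = \<Phi> (q t) (D_mu h t (q t) (\<mu> t))) \<and>
    (\<forall>t\<in>{0<..<T}.
       (\<mu> has_vector_derivative
          ad_star A \<Phi> (q t) (triv_velocity A \<Phi> T q t) (\<mu> t)
            - triv_dual \<Phi> (q t) (D_q A h t (q t) (\<mu> t))) (at t)) \<and>
    q 0 = q\<^sub>0 \<and> \<mu> T = \<mu>\<^sub>1" (is "?dA \<longleftrightarrow> ?H")
proof
  have q: "C1_curve_on A {0..T} q" and q0: "q 0 = q\<^sub>0" and "C1_on {0..T} \<mu>"
    using adm by (auto simp: admissible_curve_def)
  then obtain \<mu>' where \<mu>': "\<And>t. t \<in> {0..T} \<Longrightarrow> (\<mu> has_vector_derivative \<mu>' t) (at t within {0..T})" 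
    "continuous_on {0..T} \<mu>'"
    unfolding C1_on_def by blast
  have \<mu>'_at: "(\<mu> has_vector_derivative \<mu>' t) (at t)" if "t \<in> {0<..<T}" for t
    using \<mu>'(1)[of t] that by (simp add: at_within_Icc_at)
  let ?\<xi> = "\<lambda>t. triv_velocity A \<Phi> T q t" and ?w = "\<lambda>t. D_mu h t (q t) (\<mu> t)"
  let ?\<beta> = "\<lambda>t. ad_star A \<Phi> (q t) (?\<xi> t) (\<mu> t) - triv_dual \<Phi> (q t) (D_q A h t (q t) (\<mu> t))"
  {
    assume dA: ?dA
    have res: "residual q \<mu> \<mu>' v \<nu> t = 0" if "t \<in> {0<..<T}" for v \<nu> t
      using residual_nonpos[OF adm dA \<mu>' that, of v \<nu>] residual_nonpos[OF adm dA \<mu>' that, of "- v" "- \<nu>"]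
      by (simp add: residual_uminus)
    have 1: "velocity A {0..T} q t = \<Phi> (q t) (?w t)" if t: "t \<in> {0<..<T}" for t
    proof -
      have t': "t \<in> {0..T}" using t by auto
      \<comment> \<open>With v = 0 and \<nu> the inner product with \<xi> - w, the residual is a
        squared norm.\<close>
      have "(?\<xi> t - ?w t) \<bullet> (?\<xi> t - ?w t) = 0"
        using res[OF t, of 0 "blinfun_inner_left (?\<xi> t - ?w t)"] by (simp add: residual_def)
      then have "?\<xi> t = ?w t" by simp
      then show ?thesis
        using triv_inv[OF velocity_tangent(2,1)[OF q t']] by (simp add: triv_velocity_def)
    qed
    have 2: "(\<mu> has_vector_derivative ?\<beta> t) (at t)" if t: "t \<in> {0<..<T}" for t
    proof -
      have "?\<beta> t = \<mu>' t"
        using res[OF t, of _ 0] by (intro blinfun_eqI) (simp add: residual_def blinfun.diff_left)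
      then show ?thesis using \<mu>'_at[OF t] by simp
    qed
    have "blinfun_apply (\<mu>\<^sub>1 - \<mu> T) v = 0" for v
    proof -
      have T: "T \<in> {0..T}" using T_pos by simp
      obtain c d where c: "c \<in> charts_at A (q T)" and d: "d > 0" "\<And>s. s \<in> {0..T} \<Longrightarrow> s \<in> cball T d \<Longrightarrow> q s \<in> fst c"
        by (rule chart_near[OF q T]) (rule that)
      \<comment> \<open>The right end T + 1 lies beyond the time interval, so the bump is positive
        at T and the boundary term survives. The left end is clipped at 0 to keep the initial point
        fixed.\<close>
      let ?\<alpha> = "max 0 (T - d)"
      have "integral {0..T} (\<lambda>t. bump ?\<alpha> (T + 1) t * residual q \<mu> \<mu>' v 0 t) = bump ?\<alpha> (T + 1) T * blinfun_apply (\<mu>\<^sub>1 - \<mu> T) v"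
        by (rule weak_Hamel(2)[OF adm dA charts_atD(1)[OF c] _ _ d(2) \<mu>']) 
          (use T_pos d in \<open>auto simp: dist_real_def\<close>)
      \<comment> \<open>The residual is known to vanish on the open interval; the two endpoints form
        a null set.\<close>
      moreover have "integral {0..T} (\<lambda>t. bump ?\<alpha> (T + 1) t * residual q \<mu> \<mu>' v 0 t) = integral {0..T} (\<lambda>t. 0)"
        by (rule integral_spike[of "{0, T}"]) (auto simp: res)
      moreover have "bump ?\<alpha> (T + 1) T > 0" using T_pos d by (intro bump_pos) auto
      ultimately show ?thesis by simp
    qed
    then have "\<mu> T = \<mu>\<^sub>1" by (intro blinfun_eqI) (simp add: blinfun.diff_left)
    with 1 2 q0 show ?H by blast
  }
  {
    assume H: ?H
    show ?dA
      unfolding type_II_dAlembert_def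
    proof (intro allI impI)
      fix \<eta> \<delta>\<mu> a qf \<mu>f
      assume pv: "partial_variation T \<eta> \<delta>\<mu>" and fam: "variation_family A \<Phi> T q\<^sub>0 q \<mu> \<eta> \<delta>\<mu> a qf \<mu>f"
      obtain \<eta>' where \<eta>': "\<And>t. t \<in> {0..T} \<Longrightarrow> (\<eta> has_vector_derivative \<eta>' t) (at t within {0..T})"
        using pv unfolding partial_variation_def C1_on_def by blast
      define f0 where "f0 t = blinfun_apply (\<delta>\<mu> t) (?\<xi> t - ?w t) + blinfun_apply (\<mu> t) (\<eta>' t) + blinfun_apply (?\<beta> t) (\<eta> t)" for t
      have f0: "((\<lambda>r. lagr (qf r) (\<mu>f r) t) has_vector_derivative f0 t) (at 0)" if "t \<in> {0..T}" for t
        unfolding f0_def by (rule lagr_first_variation[OF fam that \<eta>'[OF that] refl])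
      have k: "((\<lambda>t. blinfun_apply (\<mu> t) (\<eta> t)) has_vector_derivative 
          blinfun_apply (\<mu> t) (\<eta>' t) + blinfun_apply (\<mu>' t) (\<eta> t)) (at t within {0..T})" if "t \<in> {0..T}" for t
        by (rule bounded_bilinear.has_vector_derivative[OF bounded_bilinear_blinfun_apply \<mu>'(1)[OF that] \<eta>'[OF that]])
      \<comment> \<open>Hamel's equations are given on the open interval, hence the interior form of
        the fundamental theorem, with continuity up to the ends.\<close>
      have "(f0 has_integral blinfun_apply (\<mu> T) (\<eta> T) - blinfun_apply (\<mu> 0) (\<eta> 0)) {0..T}"
      proof (rule fundamental_theorem_of_calculus_interior)
        show "continuous_on {0..T} (\<lambda>t. blinfun_apply (\<mu> t) (\<eta> t))"
          unfolding continuous_on_eq_continuous_within by (intro ballI has_vector_derivative_continuous[OF k])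
        fix t assume t: "t \<in> {0<..<T}"
        then have t': "t \<in> {0..T}" by auto
        have "?\<xi> t = ?w t"
          using H t velocity_tangent(2)[OF q t'] by (simp add: triv_velocity_def)
        moreover have "?\<beta> t = \<mu>' t"
          using H t \<mu>'_at[OF t] vector_derivative_unique_at by blast
        ultimately have "f0 t = blinfun_apply (\<mu> t) (\<eta>' t) + blinfun_apply (\<mu>' t) (\<eta> t)"
          unfolding f0_def by simp
        then show "((\<lambda>t. blinfun_apply (\<mu> t) (\<eta> t)) has_vector_derivative f0 t) (at t)"
          using k[OF t'] t by (simp add: at_within_Icc_at)
      qed (use T_pos in simp)
      \<comment> \<open>The term at 0 vanishes by \<open>\<eta> 0 = 0\<close>; the term at T uses
        \<open>\<mu> T = \<mu>\<^sub>1\<close>.\<close>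
      then have "integral {0..T} f0 = blinfun_apply \<mu>\<^sub>1 (\<eta> T)"
        using H pv by (auto simp: partial_variation_def dest: integral_unique)
      then show "((\<lambda>\<epsilon>. action A \<Phi> h T (qf \<epsilon>) (\<mu>f \<epsilon>)) has_real_derivative blinfun_apply \<mu>\<^sub>1 (\<eta> T)) (at 0)"
        using action_has_derivative(1)[OF fam f0] by simp
    qed
  }
qed

end

theorem proposition2p3:
  fixes A :: "('m, 'e::euclidean_space) chart set"
    and \<Phi> :: "'m \<Rightarrow> 'v::euclidean_space \<Rightarrow> ('m, 'e) tvec"
    and T :: real
    and H :: "real \<Rightarrow> 'm \<times> ('m, 'e) covec \<Rightarrow> real"
    and h :: "real \<Rightarrow> 'm \<Rightarrow> ('v \<Rightarrow>\<^sub>L real) \<Rightarrow> real"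
    and q\<^sub>0 :: 'm and \<mu>\<^sub>1 :: "'v \<Rightarrow>\<^sub>L real"
    and q :: "real \<Rightarrow> 'm" and \<mu> :: "real \<Rightarrow> 'v \<Rightarrow>\<^sub>L real"
  assumes "smooth_manifold A"
    and "trivialization A \<Phi>"
    and "T > 0"
    and "smooth_hamiltonian A T H"
    and "h = triv_hamiltonian A \<Phi> H"
    and "q\<^sub>0 \<in> points A"
    and "admissible_curve A T q\<^sub>0 q \<mu>"
  shows "type_II_dAlembert A \<Phi> h T q\<^sub>0 \<mu>\<^sub>1 q \<mu> \<longleftrightarrow>
    (\<forall>t\<in>{0<..<T}. velocity A {0..T} q t = \<Phi> (q t) (D_mu h t (q t) (\<mu> t))) \<and>
    (\<forall>t\<in>{0<..<T}.
       (\<mu> has_vector_derivative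
          ad_star A \<Phi> (q t) (triv_velocity A \<Phi> T q t) (\<mu> t)
            - triv_dual \<Phi> (q t) (D_q A h t (q t) (\<mu> t))) (at t)) \<and>
    q 0 = q\<^sub>0 \<and> \<mu> T = \<mu>\<^sub>1"
proof -
  interpret hamiltonian_system A \<Phi> T H h
    using assms by unfold_locales (auto simp: smooth_manifold_def)
  show ?thesis by (rule dAlembert_iff_Hamel[OF assms(7)])
qed

end
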